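(* Let $\ell\ge2$ and let $\mathcal R$ be a bounded-size $\ell$-vertex rule. Then $t_{\mathrm b}^{\mathcal R}=t_{\mathrm c}^{\mathcal R}$. More precisely, for any $t>t_{\mathrm b}^{\mathcal R}$ and $\varepsilon>0$ there exist $\delta,n_0>0$ (depending only on $\mathcal R,\ell,t,\varepsilon$) such that $\Pr(L_1(G_{tn}^{\mathcal R})\ge\delta n)\ge1-\varepsilon$ for $n\ge n_0$. Moreover, for any $\varepsilon>0$ there is an $\alpha>0$ such that whp $L_1(G^{\mathcal R}_{(t_{\mathrm b}^{\mathcal R}+\varepsilon)n})\ge\alpha n$.
   Context: An $\ell$-vertex size rule $\mathcal R$ (fixed, not depending on $n$) is a map assigning to every list $(c_1,\ldots,c_\ell)$ of positive integers a non-empty set of pairs $\{a,b\}\subset\{1,\ldots,\ell\}$, $a\ne b$. For each $n$ it defines a random sequence $(G_i^{\mathcal R})_{i\ge0}$ of graphs on $[n]$: $G_0^{\mathcal R}$ is the empty graph (no edges); in step $i+1$, vertices $v_1,\ldots,v_\ell$ are chosen from $[n]$ independently and uniformly at random (independently of previous steps), $c_j$ denotes the size (number of vertices) of the component of $G_i^{\mathcal R}$ containing $v_j$, and $G_{i+1}^{\mathcal R}$ is obtained from $G_i^{\mathcal R}$ by adding the edges $v_av_b$ for all pairs $\{a,b\}$ selected by $\mathcal R$ on input $(c_1,\ldots,c_\ell)$ (a pair with $v_a=v_b$ or an already present edge does not affect the component structure). A bounded-size $\ell$-vertex rule is an $\ell$-vertex size rule for which there is a constant $B$ such that all component sizes larger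 than $B$ are treated in the same way (the selected set of pairs is unchanged if every $c_j$ is replaced by $\min\{c_j,B+1\}$). $L_1(G)$ is the number of vertices in a largest component of $G$; $S(G)=\sum_{k}kN_k(G)/n$ for an $n$-vertex graph $G$, where $N_k(G)$ is the number of vertices in components of size $k$. $t_{\mathrm c}^{\mathcal R}$ is the supremum of the set of $t\ge0$ for which $L_1(G_{tn}^{\mathcal R})/n\overset{\mathrm p}{\to}0$ as $n\to\infty$; $t_{\mathrm b}^{\mathcal R}$ is the supremum of the set of $t\ge0$ for which $S(G_{tn}^{\mathcal R})$ is bounded in probability (as $n\to\infty$); for size rules the latter equals the infimum of the set of $t\ge 0$ for which $S(G_{tn}^{\mathcal R})\overset{\mathrm p}{\to}\infty$. "Whp" means with probability tending to $1$ as $n\to\infty$. Rounding to integers is ignored. *)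

theory Defs
  imports "HOL-Probability.Probability"
begin

(* List positions count from 0, so the pairs selected by an ell-vertex rule are two-element
   subsets of {..<ell}.  Only the values on lists of ell positive integers are constrained. *)

definition size_rule :: "nat \<Rightarrow> (nat list \<Rightarrow> nat set set) \<Rightarrow> bool" where
  "size_rule ell R \<longleftrightarrow>
     (\<forall>cs. length cs = ell \<and> (\<forall>c\<in>set cs. 0 < c) \<longrightarrow>
        R cs \<noteq> {} \<and> R cs \<subseteq> {{a, b} | a b. a < ell \<and> b < ell \<and> a \<noteq> b})"

definition bounded_size_rule :: "nat \<Rightarrow> (nat list \<Rightarrow> nat set set) \<Rightarrow> bool" where
  "bounded_size_rule ell R \<longleftrightarrow>
     size_rule ell R \<and>
     (\<exists>B. \<forall>cs. length cs = ell \<and> (\<forall>c\<in>set cs. 0 < c) \<longrightarrow>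
        R (map (\<lambda>c. min c (B + 1)) cs) = R cs)"

(* A graph on the vertex set {1..n} is given by its edge set, a set of two-element subsets
   of {1..n}.  A vertex lying on no edge is its own component. *)

definition component :: "nat set set \<Rightarrow> nat \<Rightarrow> nat set" where
  "component E v = {w. (v, w) \<in> {(x, y). {x, y} \<in> E}\<^sup>*}"

definition largest_component :: "nat \<Rightarrow> nat set set \<Rightarrow> nat" where
  "largest_component n E = Max ((\<lambda>v. card (component E v)) ` {1..n})"

definition vertices_in_components_of_size :: "nat \<Rightarrow> nat set set \<Rightarrow> nat \<Rightarrow> nat" where
  "vertices_in_components_of_size n E k = card {v \<in> {1..n}. card (component E v) = k}"

(* Components of an n-vertex graph have between 1 and n vertices, so k ranges over {1..n}. *)

definition susceptibility :: "nat \<Rightarrow> nat set set \<Rightarrow> real" where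
  "susceptibility n E =
     (\<Sum>k=1..n. real k * real (vertices_in_components_of_size n E k)) / real n"

(* A selected pair with vs ! a = vs ! b would be a loop and adds nothing. *)

definition add_edges :: "(nat list \<Rightarrow> nat set set) \<Rightarrow> nat set set \<Rightarrow> nat list \<Rightarrow> nat set set" where
  "add_edges R E vs =
     E \<union> {{vs ! a, vs ! b} | a b.
           {a, b} \<in> R (map (\<lambda>v. card (component E v)) vs) \<and> vs ! a \<noteq> vs ! b}"

(* A sample point is the infinite stream of the choices [v_1, ..., v_ell] made in
   successive steps.  For n = 0 there is nothing to choose from and the space is
   meaningless; all statements below only concern large n. *)

definition choices :: "nat \<Rightarrow> nat \<Rightarrow> nat list stream measure" where
  "choices ell n = stream_space (measure_pmf (replicate_pmf ell (pmf_of_set {1..n})))"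

primrec rule_graph :: "(nat list \<Rightarrow> nat set set) \<Rightarrow> nat list stream \<Rightarrow> nat \<Rightarrow> nat set set" where
  "rule_graph R \<omega> 0 = {}"
| "rule_graph R \<omega> (Suc i) = add_edges R (rule_graph R \<omega> i) (\<omega> !! i)"

(* The graph after tn steps, with tn rounded down. *)

definition rule_graph_at ::
    "(nat list \<Rightarrow> nat set set) \<Rightarrow> real \<Rightarrow> nat \<Rightarrow> nat list stream \<Rightarrow> nat set set" where
  "rule_graph_at R t n \<omega> = rule_graph R \<omega> (nat \<lfloor>t * real n\<rfloor>)"

(* The n-th random variable X n lives on its own probability space M n. *)

definition tendsto_in_prob ::
    "(nat \<Rightarrow> 'a measure) \<Rightarrow> (nat \<Rightarrow> 'a \<Rightarrow> real) \<Rightarrow> real \<Rightarrow> bool" where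
  "tendsto_in_prob M X c \<longleftrightarrow>
     (\<forall>\<epsilon>>0. (\<lambda>n. \<P>(\<omega> in M n. \<bar>X n \<omega> - c\<bar> > \<epsilon>)) \<longlonglongrightarrow> 0)"

definition bounded_in_prob :: "(nat \<Rightarrow> 'a measure) \<Rightarrow> (nat \<Rightarrow> 'a \<Rightarrow> real) \<Rightarrow> bool" where
  "bounded_in_prob M X \<longleftrightarrow>
     (\<forall>\<epsilon>>0. \<exists>C. \<forall>\<^sub>F n in sequentially. \<P>(\<omega> in M n. \<bar>X n \<omega>\<bar> > C) \<le> \<epsilon>)"

definition whp :: "(nat \<Rightarrow> 'a measure) \<Rightarrow> (nat \<Rightarrow> 'a \<Rightarrow> bool) \<Rightarrow> bool" where
  "whp M P \<longleftrightarrow> (\<lambda>n. \<P>(\<omega> in M n. P n \<omega>)) \<longlonglongrightarrow> 1"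

(* Both sets below contain 0 and, for a size rule with ell >= 2, are bounded above by 1:
   while all components have o(n) vertices, almost every step merges two of them. *)

definition t_c :: "nat \<Rightarrow> (nat list \<Rightarrow> nat set set) \<Rightarrow> real" where
  "t_c ell R = Sup {t. t \<ge> 0 \<and>
     tendsto_in_prob (choices ell)
       (\<lambda>n \<omega>. real (largest_component n (rule_graph_at R t n \<omega>)) / real n) 0}"

definition t_b :: "nat \<Rightarrow> (nat list \<Rightarrow> nat set set) \<Rightarrow> real" where
  "t_b ell R = Sup {t. t \<ge> 0 \<and>
     bounded_in_prob (choices ell) (\<lambda>n \<omega>. susceptibility n (rule_graph_at R t n \<omega>))}"

end

theory Submission
  imports Defs
begin

text \<open>
  Write \<open>n * tail n k E\<close> for the number of vertices in components of size at least \<open>k\<close>, and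
  \<open>trunc_sus n K E = (\<Sum>k=1..K. tail n k E)\<close> for the susceptibility in which every component size
  is replaced by its minimum with \<open>K\<close>. For a bounded-size rule the numbers of vertices in
  components of each bounded size change by bounded amounts in a step, and the expected change is,
  up to \<open>O(1/n)\<close>, a polynomial in the current fractions. The differential equation method therefore
  shows that \<open>tail n k\<close> after \<open>t n\<close> steps converges in probability to a constant \<open>profile t k\<close>
  (\<open>tail_concentration\<close>). Let \<open>T\<close> be the time at which \<open>(\<Sum>k. profile t k)\<close> becomes infinite;
  both thresholds turn out to be \<open>T\<close>.

  If the sum is infinite at \<open>t\<close>, then already the truncated susceptibilities are arbitrarily
  large, so the susceptibility is not bounded in probability. If it is finite, then so is the
  limit of every truncated susceptibility, and one has to exclude that a few huge components
  carry unbounded susceptibility. The excess over the truncation at level \<open>K\<close> grows at rate at most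
  a constant times the susceptibility times the excess over a level \<open>L\<close> smaller than \<open>K\<close> by a
  constant factor. Both excesses differ by \<open>trunc_sus n K - trunc_sus n L\<close>, and among many
  disjoint ranges \<open>(L, K]\<close> some range makes this difference small on average over time. Gronwall's
  inequality then keeps the excess small (\<open>susceptibility_tight\<close>).

  Now let the sum be infinite at \<open>t1\<close>, and let \<open>t1 < t2 < t\<close>. The fraction \<open>\<gamma>\<close> of vertices in
  components larger than the cutoff \<open>B\<close> is bounded below, and whenever all chosen vertices are of
  this kind the rule joins a fixed pair of them, as in an Erdos-Renyi process. If \<open>k * profile t2 k\<close>
  were bounded for \<open>k > B\<close>, the truncated susceptibility \<open>y\<close> would satisfy \<open>y' \<ge> c * y\<^sup>2\<close>
  between \<open>t1\<close> and \<open>t2\<close>, from an arbitrarily large initial value and with \<open>c\<close> independent of the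
  truncation; its solutions blow up before \<open>t2\<close> (\<open>heavy_level\<close>). So there is a level \<open>k\<close> for which
  \<open>k * profile t2 k\<close> is as large as desired. The components of size at least \<open>k\<close> can be divided
  in at most \<open>2 powr (n * tail n k / k)\<close> ways into two parts, and each balanced division survives
  the steps up to \<open>t n\<close> with a probability exponentially smaller than that. Hence whp no balanced
  division survives, which forces a linear component (\<open>sprinkling\<close>, \<open>giant_after\<close>).

  Since \<open>L\<^sub>1\<^sup>2 \<le> n * S\<close>, a bounded susceptibility implies sublinear components, so
  \<open>t_b \<le> t_c\<close>. Any time beyond \<open>t_b\<close> has a linear component whp, which gives \<open>t_c \<le> t_b\<close> and the two
  remaining claims with one and the same constant. Both suprema are over sets bounded by 1, because
  as long as all components are sublinear almost every step reduces the number of components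
  (\<open>sublinear_time_le_1\<close>).
\<close>

section \<open>Components and the effect of one step\<close>

abbreviation csize :: "nat set set \<Rightarrow> nat \<Rightarrow> nat" where
  "csize E v \<equiv> card (component E v)"

abbreviation steps :: "real \<Rightarrow> nat \<Rightarrow> nat" where
  "steps t n \<equiv> nat \<lfloor>t * real n\<rfloor>"

definition graph_on :: "nat \<Rightarrow> nat set set \<Rightarrow> bool" where
  "graph_on n E \<longleftrightarrow> (\<forall>e\<in>E. \<exists>x\<in>{1..n}. \<exists>y\<in>{1..n}. x \<noteq> y \<and> e = {x, y})"

definition edge_closed :: "nat set set \<Rightarrow> nat set \<Rightarrow> bool" where
  "edge_closed E A \<longleftrightarrow> (\<forall>x y. {x, y} \<in> E \<longrightarrow> x \<in> A \<longrightarrow> y \<in> A)"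

lemma component_refl [simp]: "v \<in> component E v"
  by (simp add: component_def)

lemma component_sym: "w \<in> component E v \<Longrightarrow> v \<in> component E w"
proof -
  have "sym ({(x, y). {x, y} \<in> E}\<^sup>*)"
    by (rule sym_rtrancl) (auto simp: sym_def insert_commute)
  then show "w \<in> component E v \<Longrightarrow> v \<in> component E w"
    by (auto simp: component_def dest: symD)
qed

lemma component_trans: "w \<in> component E v \<Longrightarrow> u \<in> component E w \<Longrightarrow> u \<in> component E v"
  by (auto simp: component_def)

lemma component_eq: "w \<in> component E v \<Longrightarrow> component E w = component E v"
  by (blast intro: component_sym component_trans)

lemma component_mono: "E \<subseteq> E' \<Longrightarrow> component E v \<subseteq> component E' v"
proof -
  assume "E \<subseteq> E'"
  then have "{(x, y). {x, y} \<in> E}\<^sup>* \<subseteq> {(x, y). {x, y} \<in> E'}\<^sup>*"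
    by (intro rtrancl_mono) auto
  then show ?thesis by (auto simp: component_def)
qed

lemma component_edge: "{x, y} \<in> E \<Longrightarrow> y \<in> component E x"
  by (auto simp: component_def)

lemma component_subset_closed:
  assumes "edge_closed E A" "v \<in> A"
  shows "component E v \<subseteq> A"
proof
  fix w assume "w \<in> component E v"
  then have "(v, w) \<in> {(x, y). {x, y} \<in> E}\<^sup>*" by (simp add: component_def)
  then show "w \<in> A"
    by (induction rule: rtrancl_induct) (use assms in \<open>auto simp: edge_closed_def\<close>)
qed

lemma component_subset: "graph_on n E \<Longrightarrow> v \<in> {1..n} \<Longrightarrow> component E v \<subseteq> {1..n}"
  by (rule component_subset_closed) (fastforce simp: edge_closed_def graph_on_def doubleton_eq_iff)+

lemma finite_component: "graph_on n E \<Longrightarrow> v \<in> {1..n} \<Longrightarrow> finite (component E v)"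
  by (rule finite_subset[OF component_subset]) auto

lemma csize_pos: "graph_on n E \<Longrightarrow> v \<in> {1..n} \<Longrightarrow> 0 < csize E v"
  using finite_component[of n E v] component_refl[of v E] by (metis card_gt_0_iff empty_iff)

lemma csize_le: "graph_on n E \<Longrightarrow> v \<in> {1..n} \<Longrightarrow> csize E v \<le> n"
  using card_mono[OF _ component_subset, of n E v] by simp

lemma csize_mono: "E \<subseteq> E' \<Longrightarrow> graph_on n E' \<Longrightarrow> v \<in> {1..n} \<Longrightarrow> csize E v \<le> csize E' v"
  by (intro card_mono finite_component component_mono)

lemma csize_empty [simp]: "csize {} v = 1"
proof -
  have "component {} v = {v}" by (auto simp: component_def)
  then show ?thesis by simp
qed

lemma graph_on_empty [simp]: "graph_on n {}" by (simp add: graph_on_def)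

text \<open>
  All counts of vertices are handled as sums of indicators, which commute with means.
\<close>

lemma card_Collect_sum:
  "real (card {v \<in> {1..n::nat}. P v}) = (\<Sum>v=1..n. of_bool (P v))"
  by (simp add: of_bool_def sum.If_cases Int_def)

definition touched :: "nat set set \<Rightarrow> nat list \<Rightarrow> nat set" where
  "touched E vs = (\<Union>v\<in>set vs. component E v)"

locale sized_rule =
  fixes ell :: nat and R :: "nat list \<Rightarrow> nat set set"
  assumes ell2: "2 \<le> ell" and rule: "size_rule ell R"
begin

definition draws :: "nat \<Rightarrow> nat list set" where
  "draws n = {vs. length vs = ell \<and> set vs \<subseteq> {1..n}}"

lemma draws_nth: "vs \<in> draws n \<Longrightarrow> j < ell \<Longrightarrow> vs ! j \<in> {1..n}"
  unfolding draws_def by (auto simp: subset_iff)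

abbreviation pairs :: "nat set set \<Rightarrow> nat list \<Rightarrow> nat set set" where
  "pairs E vs \<equiv> R (map (\<lambda>v. csize E v) vs)"

lemma pairs_wf:
  assumes "graph_on n E" "vs \<in> draws n"
  shows "pairs E vs \<noteq> {}" "pairs E vs \<subseteq> {{a, b} | a b. a < ell \<and> b < ell \<and> a \<noteq> b}"
proof -
  have "length (map (\<lambda>v. csize E v) vs) = ell \<and> (\<forall>c\<in>set (map (\<lambda>v. csize E v) vs). 0 < c)"
    using assms csize_pos[of n E] by (auto simp: draws_def subset_iff)
  then show "pairs E vs \<noteq> {}" "pairs E vs \<subseteq> {{a, b} | a b. a < ell \<and> b < ell \<and> a \<noteq> b}"
    using rule unfolding size_rule_def by blast+
qed

lemma pairsD:
  assumes "graph_on n E" "vs \<in> draws n" "{a, b} \<in> pairs E vs"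
  shows "a < ell" "b < ell" "a \<noteq> b"
  using pairs_wf(2)[OF assms(1,2)] assms(3) by (auto simp: doubleton_eq_iff)

lemma add_edges_supset: "E \<subseteq> add_edges R E vs"
  by (auto simp: add_edges_def)

lemma graph_on_add_edges:
  assumes "graph_on n E" "vs \<in> draws n"
  shows "graph_on n (add_edges R E vs)"
  unfolding graph_on_def
proof
  fix e assume "e \<in> add_edges R E vs"
  then consider "e \<in> E" | a b where "{a, b} \<in> pairs E vs" "e = {vs ! a, vs ! b}" "vs ! a \<noteq> vs ! b"
    unfolding add_edges_def by blast
  then show "\<exists>x\<in>{1..n}. \<exists>y\<in>{1..n}. x \<noteq> y \<and> e = {x, y}"
  proof cases
    case 1
    then show ?thesis using assms(1) by (simp add: graph_on_def)
  next
    case 2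
    show ?thesis
      by (intro bexI[of _ "vs ! a"] bexI[of _ "vs ! b"])
        (use 2 draws_nth[OF assms(2)] pairsD(1,2)[OF assms 2(1)] in auto)
  qed
qed

lemma pair_connected:
  assumes "{a, b} \<in> pairs E vs"
  shows "vs ! b \<in> component (add_edges R E vs) (vs ! a)"
proof (cases "vs ! a = vs ! b")
  case False
  then show ?thesis using assms by (intro component_edge) (auto simp: add_edges_def)
qed simp

text \<open>
  An edge \<open>{x, y}\<close> is unordered, so the two endpoints may correspond to the selected pair in
  either order; here the indices are renamed so that \<open>a\<close> belongs to \<open>x\<close>.
\<close>

lemma new_edge_touched:
  assumes "graph_on n E" "vs \<in> draws n" "{x, y} \<in> add_edges R E vs" "{x, y} \<notin> E"
  obtains a b where "{a, b} \<in> pairs E vs" "a < ell" "b < ell" "x = vs ! a" "y = vs ! b"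
proof -
  obtain a b where ab: "{a, b} \<in> pairs E vs" "{x, y} = {vs ! a, vs ! b}"
    using assms(3,4) by (auto simp: add_edges_def)
  then consider "x = vs ! a" "y = vs ! b" | "x = vs ! b" "y = vs ! a"
    by (auto simp: doubleton_eq_iff)
  then show thesis
  proof cases
    case 1 then show ?thesis using that[of a b] ab pairsD[OF assms(1,2)] by blast
  next
    case 2 then show ?thesis using that[of b a] ab pairsD[OF assms(1,2)]
      by (metis insert_commute)
  qed
qed

lemma edge_closed_touched:
  assumes "graph_on n E" "vs \<in> draws n"
  shows "edge_closed (add_edges R E vs) (touched E vs)"
  unfolding edge_closed_def
proof (intro allI impI)
  fix x y assume e: "{x, y} \<in> add_edges R E vs" and x: "x \<in> touched E vs"
  show "y \<in> touched E vs"
  proof (cases "{x, y} \<in> E")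
    case True
    then show ?thesis using x by (auto simp: touched_def intro: component_edge component_trans)
  next
    case False
    then obtain a b where "b < ell" "y = vs ! b" using new_edge_touched[OF assms e] by metis
    moreover have "vs ! b \<in> set vs" using assms(2) \<open>b < ell\<close> by (simp add: draws_def)
    ultimately show ?thesis unfolding touched_def by (metis UN_I component_refl)
  qed
qed

text \<open>
  No new edge meets the old component of \<open>v\<close>, so that component is still closed under all edges.
\<close>

lemma component_untouched:
  assumes "graph_on n E" "vs \<in> draws n" "v \<notin> touched E vs"
  shows "component (add_edges R E vs) v = component E v"
proof
  show "component (add_edges R E vs) v \<subseteq> component E v"
  proof (rule component_subset_closed)
    show "edge_closed (add_edges R E vs) (component E v)"
      unfolding edge_closed_def
    proof (intro allI impI)
      fix x y assume e: "{x, y} \<in> add_edges R E vs" and x: "x \<in> component E v"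
      show "y \<in> component E v"
      proof (cases "{x, y} \<in> E")
        case True
        then show ?thesis using x by (auto intro: component_edge component_trans)
      next
        case False
        then obtain a b where "a < ell" "x = vs ! a" using new_edge_touched[OF assms(1,2) e] by metis
        then have "x \<in> set vs" using assms(2) by (auto simp: draws_def)
        moreover have "v \<in> component E x" using x by (rule component_sym)
        ultimately show ?thesis using assms(3) by (auto simp: touched_def)
      qed
    qed
  qed simp
qed (rule component_mono[OF add_edges_supset])

lemma component_touched:
  assumes "graph_on n E" "vs \<in> draws n" "v \<in> touched E vs"
  shows "component (add_edges R E vs) v \<subseteq> touched E vs"
  using component_subset_closed[OF edge_closed_touched] assms by blast

lemma card_touched_le:
  assumes "graph_on n E" "vs \<in> draws n"
  shows "card (touched E vs) \<le> (\<Sum>j<ell. csize E (vs ! j))"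
proof -
  have "touched E vs = (\<Union>j<ell. component E (vs ! j))"
    using assms(2) unfolding touched_def draws_def by (fastforce simp: in_set_conv_nth)
  then show ?thesis by (simp add: card_UN_le)
qed

lemma finite_touched:
  assumes "graph_on n E" "vs \<in> draws n"
  shows "finite (touched E vs)" "touched E vs \<subseteq> {1..n}"
proof -
  show *: "touched E vs \<subseteq> {1..n}"
    unfolding touched_def
    by (intro UN_least component_subset[OF assms(1)]) (use assms(2) in \<open>auto simp: draws_def\<close>)
  show "finite (touched E vs)" by (rule finite_subset[OF *]) simp
qed

section \<open>Susceptibility and its truncations\<close>

definition tail :: "nat \<Rightarrow> nat \<Rightarrow> nat set set \<Rightarrow> real" where
  "tail n k E = real (card {v \<in> {1..n}. k \<le> csize E v}) / real n"

definition sus :: "nat \<Rightarrow> nat set set \<Rightarrow> real" where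
  "sus n E = (\<Sum>v=1..n. real (csize E v)) / real n"

definition trunc_sus :: "nat \<Rightarrow> nat \<Rightarrow> nat set set \<Rightarrow> real" where
  "trunc_sus n K E = (\<Sum>v=1..n. real (min (csize E v) K)) / real n"

text \<open>
  Subtraction of naturals makes each summand the positive part of \<open>csize E v - K\<close>.
\<close>

definition excess :: "nat \<Rightarrow> nat \<Rightarrow> nat set set \<Rightarrow> real" where
  "excess n K E = (\<Sum>v=1..n. real (csize E v - K)) / real n"

lemma sus_split: "sus n E = trunc_sus n K E + excess n K E"
  unfolding sus_def trunc_sus_def excess_def
  by (auto simp: add_divide_distrib[symmetric] sum.distrib[symmetric] intro!: arg_cong2[where f="(/)"] sum.cong)

text \<open>
  Layer-cake summation: \<open>min c K\<close> counts the levels \<open>k \<le> K\<close> with \<open>k \<le> c\<close>.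
\<close>

lemma trunc_sus_eq_sum_tail: "trunc_sus n K E = (\<Sum>k=1..K. tail n k E)"
proof -
  have "real (min c K) = (\<Sum>k=1..K. of_bool (k \<le> c))" for c
  proof -
    have "{1..K} \<inter> {k. k \<le> c} = {1..min c K}" by auto
    then show ?thesis by (simp add: of_bool_def sum.If_cases)
  qed
  then have "(\<Sum>v=1..n. real (min (csize E v) K)) = (\<Sum>v=1..n. \<Sum>k=1..K. of_bool (k \<le> csize E v))"
    by (intro sum.cong) auto
  also have "\<dots> = (\<Sum>k=1..K. \<Sum>v=1..n. of_bool (k \<le> csize E v))" by (rule sum.swap)
  finally show ?thesis
    unfolding trunc_sus_def tail_def card_Collect_sum by (simp add: sum_divide_distrib)
qed

lemma susceptibility_eq_sus:
  assumes "graph_on n E"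
  shows "susceptibility n E = sus n E"
proof -
  have "(\<Sum>k=1..n. real k * real (vertices_in_components_of_size n E k))
      = (\<Sum>k=1..n. \<Sum>v=1..n. real k * of_bool (csize E v = k))"
    unfolding vertices_in_components_of_size_def card_Collect_sum sum_distrib_left ..
  also have "\<dots> = (\<Sum>v=1..n. \<Sum>k=1..n. real k * of_bool (csize E v = k))" by (rule sum.swap)
  also have "\<dots> = (\<Sum>v=1..n. real (csize E v))"
  proof (intro sum.cong refl)
    fix v assume v: "v \<in> {1..n}"
    have "csize E v \<in> {1..n}" using csize_pos[OF assms v] csize_le[OF assms v] by auto
    then show "(\<Sum>k=1..n. real k * of_bool (csize E v = k)) = real (csize E v)"
      by (simp add: of_bool_def if_distrib sum.delta cong: if_cong)
  qed
  finally show ?thesis by (simp add: susceptibility_def sus_def)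
qed

lemma tail_bounds: "0 \<le> tail n k E" "tail n k E \<le> 1"
proof -
  have "card {v \<in> {1..n}. k \<le> csize E v} \<le> card {1..n}" by (intro card_mono) auto
  then show "tail n k E \<le> 1" by (cases "n = 0") (auto simp: tail_def divide_le_eq_1)
qed (simp add: tail_def)

lemma tail_antimono: "j \<le> k \<Longrightarrow> tail n k E \<le> tail n j E"
  unfolding tail_def by (intro divide_right_mono of_nat_mono card_mono) auto

lemma tail_mono:
  assumes "E \<subseteq> E'" "graph_on n E'"
  shows "tail n k E \<le> tail n k E'"
  unfolding tail_def
  using csize_mono[OF assms] by (intro divide_right_mono of_nat_mono card_mono) (auto intro: order.trans)

lemma trunc_sus_mono: "E \<subseteq> E' \<Longrightarrow> graph_on n E' \<Longrightarrow> trunc_sus n K E \<le> trunc_sus n K E'"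
  unfolding trunc_sus_eq_sum_tail by (intro sum_mono tail_mono)

lemma trunc_sus_bounds: "0 \<le> trunc_sus n K E" "trunc_sus n K E \<le> real K"
proof -
  show "0 \<le> trunc_sus n K E" by (simp add: trunc_sus_eq_sum_tail sum_nonneg tail_bounds)
  have "trunc_sus n K E \<le> (\<Sum>k=1..K. 1)" unfolding trunc_sus_eq_sum_tail by (intro sum_mono tail_bounds)
  then show "trunc_sus n K E \<le> real K" by simp
qed

lemma trunc_sus_le_sus: "trunc_sus n K E \<le> sus n E"
  unfolding trunc_sus_def sus_def by (intro divide_right_mono sum_mono) auto

lemma excess_nonneg: "0 \<le> excess n K E"
  by (simp add: excess_def sum_nonneg)

lemma sus_le_n:
  assumes "graph_on n E" "0 < n"
  shows "sus n E \<le> real n"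
proof -
  have "(\<Sum>v=1..n. real (csize E v)) \<le> (\<Sum>v=1..n. real n)"
    using csize_le[OF assms(1)] by (intro sum_mono) auto
  then show ?thesis using assms(2) by (simp add: sus_def divide_le_eq)
qed

lemma largest_ge: "v \<in> {1..n} \<Longrightarrow> csize E v \<le> largest_component n E"
  unfolding largest_component_def by (intro Max_ge) auto

lemma largest_attained:
  assumes "0 < n" obtains v where "v \<in> {1..n}" "largest_component n E = csize E v"
proof -
  have "largest_component n E \<in> (\<lambda>v. csize E v) ` {1..n}"
    unfolding largest_component_def using assms by (intro Max_in) auto
  then show thesis using that by auto
qed

text \<open>
  The vertices of a largest component alone contribute the square of its size to \<open>n\<close> times the
  susceptibility.
\<close>

lemma largest_sq_le:
  assumes "graph_on n E" "0 < n"
  shows "(real (largest_component n E))\<^sup>2 \<le> real n * sus n E"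
proof -
  obtain v where v: "v \<in> {1..n}" "largest_component n E = csize E v"
    using largest_attained[OF assms(2)] .
  have "(real (csize E v))\<^sup>2 = (\<Sum>w\<in>component E v. real (csize E w))"
    using component_eq by (simp add: power2_eq_square)
  also have "\<dots> \<le> (\<Sum>w=1..n. real (csize E w))"
    using component_subset[OF assms(1) v(1)] by (intro sum_mono2) auto
  finally show ?thesis using v assms(2) by (simp add: sus_def)
qed

lemma sus_le_largest: "0 < n \<Longrightarrow> sus n E \<le> real (largest_component n E)"
proof -
  assume n: "0 < n"
  have "(\<Sum>v=1..n. real (csize E v)) \<le> (\<Sum>v=1..n. real (largest_component n E))"
    by (intro sum_mono) (use largest_ge in auto)
  then show ?thesis using n by (simp add: sus_def divide_le_eq mult.commute)
qed

end

section \<open>Means of finitely supported distributions\<close>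

abbreviation mean :: "'a pmf \<Rightarrow> ('a \<Rightarrow> real) \<Rightarrow> real" where
  "mean p f \<equiv> measure_pmf.expectation p f"

lemma mean_bind:
  assumes "finite (set_pmf p)" "\<And>x. x \<in> set_pmf p \<Longrightarrow> finite (set_pmf (f x))"
  shows "mean (bind_pmf p f) h = mean p (\<lambda>x. mean (f x) h)"
  using pmf_expectation_bind[OF assms order_refl, where h = h]
  by (simp add: integral_measure_pmf[OF assms(1)])

lemma mean_mono:
  assumes "finite (set_pmf p)" "\<And>x. x \<in> set_pmf p \<Longrightarrow> f x \<le> g x"
  shows "mean p f \<le> mean p (g :: _ \<Rightarrow> real)"
  using assms
  by (intro integral_mono_AE integrable_measure_pmf_finite) (auto simp: AE_measure_pmf_iff)

lemma mean_cong: "(\<And>x. x \<in> set_pmf p \<Longrightarrow> f x = g x) \<Longrightarrow> mean p f = mean p (g :: _ \<Rightarrow> real)"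
  by (intro integral_cong_AE) (auto simp: AE_measure_pmf_iff)

lemma mean_add: "finite (set_pmf p) \<Longrightarrow> mean p (\<lambda>x. f x + g x) = mean p f + mean p g"
  by (intro Bochner_Integration.integral_add integrable_measure_pmf_finite)

lemma mean_diff: "finite (set_pmf p) \<Longrightarrow> mean p (\<lambda>x. f x - g x) = mean p f - mean p g"
  by (intro Bochner_Integration.integral_diff integrable_measure_pmf_finite)

lemma mean_sum: "finite (set_pmf p) \<Longrightarrow> mean p (\<lambda>x. \<Sum>i\<in>I. f i x) = (\<Sum>i\<in>I. mean p (f i))"
  by (intro Bochner_Integration.integral_sum integrable_measure_pmf_finite)

lemma mean_const: "mean p (\<lambda>x. c) = c"
  by simp

lemma mean_nonneg: "(\<And>x. x \<in> set_pmf p \<Longrightarrow> 0 \<le> f x) \<Longrightarrow> 0 \<le> mean p f"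
  by (intro integral_nonneg_AE) (auto simp: AE_measure_pmf_iff)

lemma mean_abs_le:
  assumes "finite (set_pmf p)" "\<And>x. x \<in> set_pmf p \<Longrightarrow> \<bar>f x\<bar> \<le> g x"
  shows "\<bar>mean p f\<bar> \<le> mean p g"
proof -
  have "mean p f \<le> mean p g" "- mean p f \<le> mean p g"
    using mean_mono[OF assms(1), of f g] mean_mono[OF assms(1), of "\<lambda>x. - f x" g] assms(2)
    by (fastforce simp: abs_le_iff)+
  then show ?thesis by linarith
qed

lemma prob_eq_mean: "measure_pmf.prob p {x. P x} = mean p (\<lambda>x. of_bool (P x))"
proof -
  have *: "(\<lambda>x. of_bool (P x)) = (indicator {x. P x} :: _ \<Rightarrow> real)" by (auto simp: indicator_def)
  show ?thesis unfolding * by simp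
qed

lemma prob_mono:
  assumes "\<And>x. x \<in> set_pmf p \<Longrightarrow> P x \<Longrightarrow> Q x"
  shows "measure_pmf.prob p {x. P x} \<le> measure_pmf.prob p {x. Q x}"
  by (intro measure_pmf.finite_measure_mono_AE) (auto simp: AE_measure_pmf_iff assms)

lemma prob_Markov:
  assumes "finite (set_pmf p)" "\<And>x. x \<in> set_pmf p \<Longrightarrow> 0 \<le> f x" "0 < c"
  shows "measure_pmf.prob p {x. c \<le> f x} \<le> mean p f / c"
proof -
  have "mean p (\<lambda>x. of_bool (c \<le> f x)) \<le> mean p (\<lambda>x. f x / c)"
    using assms by (intro mean_mono) (auto simp: of_bool_def)
  then show ?thesis by (simp add: prob_eq_mean)
qed

lemma mean_replicate_pmf_Suc:
  assumes "finite (set_pmf p)"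
  shows "mean (replicate_pmf (Suc l) p) h = mean p (\<lambda>x. mean (replicate_pmf l p) (\<lambda>xs. h (x # xs)))"
proof -
  have fin: "finite (set_pmf (replicate_pmf l p))"
    using assms finite_lists_length_eq[of "set_pmf p" l]
    by (simp add: set_replicate_pmf lists_eq_set Int_def conj_commute)
  have "replicate_pmf (Suc l) p = bind_pmf p (\<lambda>x. map_pmf ((#) x) (replicate_pmf l p))"
    by (simp add: map_pmf_def)
  then show ?thesis using assms fin by (simp add: mean_bind del: replicate_pmf.simps)
qed

lemma finite_replicate_pmf: "finite (set_pmf p) \<Longrightarrow> finite (set_pmf (replicate_pmf l p))"
  using finite_lists_length_eq[of "set_pmf p" l]
  by (simp add: set_replicate_pmf lists_eq_set Int_def conj_commute)

lemma mean_replicate_pmf_prod: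
  assumes "finite (set_pmf p)"
  shows "mean (replicate_pmf l p) (\<lambda>xs. \<Prod>i<l. h i (xs ! i)) = (\<Prod>i<l. mean p (h i))"
proof (induction l arbitrary: h)
  case (Suc l)
  show ?case
    unfolding mean_replicate_pmf_Suc[OF assms] prod.lessThan_Suc_shift
    by (simp add: Suc.IH[of "\<lambda>i. h (Suc i)"])
qed simp

section \<open>The law of the random graph\<close>

context sized_rule
begin

definition draw :: "nat \<Rightarrow> nat list pmf" where
  "draw n = replicate_pmf ell (pmf_of_set {1..n})"

lemma set_draw: "0 < n \<Longrightarrow> set_pmf (draw n) = draws n"
  by (auto simp: draw_def draws_def set_replicate_pmf set_pmf_of_set)

lemma finite_draw: "0 < n \<Longrightarrow> finite (set_pmf (draw n))"
  unfolding draw_def by (intro finite_replicate_pmf) (simp add: set_pmf_of_set)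

lemma mean_draw_prod:
  assumes "0 < n"
  shows "mean (draw n) (\<lambda>vs. \<Prod>i<ell. h i (vs ! i)) = (\<Prod>i<ell. (\<Sum>v=1..n. h i v) / real n)"
  unfolding draw_def using assms
  by (subst mean_replicate_pmf_prod) (simp_all add: integral_pmf_of_set set_pmf_of_set)

lemma prod_pair:
  fixes f :: "nat \<Rightarrow> real"
  assumes "i < ell" "j < ell" "i \<noteq> j"
  shows "(\<Prod>k<ell. if k = i then x else if k = j then y else f k) = x * y * (\<Prod>k\<in>{..<ell} - {i, j}. f k)"
proof -
  have "{..<ell} = insert i (insert j ({..<ell} - {i, j}))" using assms by auto
  then have "(\<Prod>k<ell. if k = i then x else if k = j then y else f k)
     = (\<Prod>k\<in>insert i (insert j ({..<ell} - {i, j})). if k = i then x else if k = j then y else f k)"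
    by simp
  also have "\<dots> = x * y * (\<Prod>k\<in>{..<ell} - {i, j}. if k = i then x else if k = j then y else f k)"
    using assms by simp
  also have "(\<Prod>k\<in>{..<ell} - {i, j}. if k = i then x else if k = j then y else f k) = (\<Prod>k\<in>{..<ell} - {i, j}. f k)"
    by (intro prod.cong) auto
  finally show ?thesis .
qed

text \<open>
  The chosen vertices are independent and uniform, so the mean of a product of functions of
  the separate vertices factorizes. This form singles out the two vertices that a step may join.
\<close>

lemma mean_draw_pair_rest:
  assumes "0 < n" "i < ell" "j < ell" "i \<noteq> j"
  shows "mean (draw n) (\<lambda>vs. f (vs ! i) * g (vs ! j) * (\<Prod>k\<in>{..<ell} - {i, j}. h (vs ! k)))
    = (\<Sum>v=1..n. f v) / real n * ((\<Sum>v=1..n. g v) / real n) * ((\<Sum>v=1..n. h v) / real n) ^ (ell - 2)"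
proof -
  have "mean (draw n) (\<lambda>vs. f (vs ! i) * g (vs ! j) * (\<Prod>k\<in>{..<ell} - {i, j}. h (vs ! k)))
    = mean (draw n) (\<lambda>vs. \<Prod>k<ell. (if k = i then f else if k = j then g else h) (vs ! k))"
  proof (rule mean_cong)
    fix vs
    have "(\<Prod>k<ell. (if k = i then f else if k = j then g else h) (vs ! k))
       = (\<Prod>k<ell. if k = i then f (vs ! i) else if k = j then g (vs ! j) else h (vs ! k))"
      by (intro prod.cong) auto
    then show "f (vs ! i) * g (vs ! j) * (\<Prod>k\<in>{..<ell} - {i, j}. h (vs ! k))
       = (\<Prod>k<ell. (if k = i then f else if k = j then g else h) (vs ! k))"
      using prod_pair[OF assms(2-4)] by simp
  qed
  also have "\<dots> = (\<Prod>k<ell. (\<Sum>v=1..n. (if k = i then f else if k = j then g else h) v) / real n)"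
    by (rule mean_draw_prod[OF assms(1)])
  also have "\<dots> = (\<Prod>k<ell. if k = i then (\<Sum>v=1..n. f v) / real n else
      if k = j then (\<Sum>v=1..n. g v) / real n else (\<Sum>v=1..n. h v) / real n)"
    by (intro prod.cong) auto
  also have "\<dots> = (\<Sum>v=1..n. f v) / real n * ((\<Sum>v=1..n. g v) / real n) *
      ((\<Sum>v=1..n. h v) / real n) ^ card ({..<ell} - {i, j})"
    unfolding prod_pair[OF assms(2-4)] prod_constant ..
  also have "card ({..<ell} - {i, j}) = ell - 2"
    using assms by (simp add: card_Diff_subset)
  finally show ?thesis .
qed

text \<open>
  A function of two vertices is a linear combination of products of indicators of points.
\<close>

lemma mean_draw_pair:
  assumes "0 < n" "i < ell" "j < ell" "i \<noteq> j"
  shows "mean (draw n) (\<lambda>vs. f (vs ! i) (vs ! j)) = (\<Sum>u=1..n. \<Sum>w=1..n. f u w) / (real n)\<^sup>2"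
proof -
  have "mean (draw n) (\<lambda>vs. f (vs ! i) (vs ! j)) = mean (draw n)
     (\<lambda>vs. \<Sum>u=1..n. \<Sum>w=1..n. f u w * of_bool (vs ! i = u) * of_bool (vs ! j = w) * (\<Prod>k\<in>{..<ell} - {i, j}. 1))"
  proof (rule mean_cong)
    fix vs assume "vs \<in> set_pmf (draw n)"
    then have v: "vs ! i \<in> {1..n}" "vs ! j \<in> {1..n}"
      using assms draws_nth[of vs n] by (auto simp: set_draw)
    have "(\<Sum>u=1..n. \<Sum>w=1..n. f u w * of_bool (vs ! i = u) * of_bool (vs ! j = w) * (\<Prod>k\<in>{..<ell} - {i, j}. 1))
      = (\<Sum>u=1..n. \<Sum>w=1..n. if w = vs ! j then (if u = vs ! i then f u w else 0) else 0)"
      by (intro sum.cong refl) auto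
    also have "\<dots> = f (vs ! i) (vs ! j)" using v by simp
    finally show "f (vs ! i) (vs ! j) = (\<Sum>u=1..n. \<Sum>w=1..n. f u w * of_bool (vs ! i = u) * of_bool (vs ! j = w) * (\<Prod>k\<in>{..<ell} - {i, j}. 1))" ..
  qed
  also have "\<dots> = (\<Sum>u=1..n. \<Sum>w=1..n. mean (draw n) (\<lambda>vs. f u w * of_bool (vs ! i = u) * of_bool (vs ! j = w) * (\<Prod>k\<in>{..<ell} - {i, j}. 1)))"
    by (simp only: mean_sum[OF finite_draw[OF assms(1)]])
  also have "\<dots> = (\<Sum>u=1..n. \<Sum>w=1..n. f u w / (real n)\<^sup>2)"
  proof (intro sum.cong refl)
    fix u w assume uw: "u \<in> {1..n}" "w \<in> {1..n}"
    have one: "(\<Sum>v=1..n. f u w * of_bool (v = u)) = f u w" "(\<Sum>v=1..n. of_bool (v = w)) = (1::real)"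
      using uw by (simp_all add: of_bool_def if_distrib sum.delta cong: if_cong)
    show "mean (draw n) (\<lambda>vs. f u w * of_bool (vs ! i = u) * of_bool (vs ! j = w) * (\<Prod>k\<in>{..<ell} - {i, j}. 1)) = f u w / (real n)\<^sup>2"
      using mean_draw_pair_rest[OF assms, of "\<lambda>v. f u w * of_bool (v = u)" "\<lambda>v. of_bool (v = w)" "\<lambda>_. 1"] assms(1)
      by (simp only: one) (simp add: power2_eq_square)
  qed
  finally show ?thesis by (simp add: sum_divide_distrib)
qed

text \<open>
  Every statement about the process concerns the graph at one time only. So it suffices to know
  the laws of these graphs, which have finite support, and the stream space
  enters only through \<open>prob_choices\<close>. The starting graph is arbitrary because the process is also
  restarted at an intermediate time.
\<close>

primrec evolve :: "nat \<Rightarrow> nat set set \<Rightarrow> nat \<Rightarrow> nat set set pmf" where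
  "evolve n E 0 = return_pmf E"
| "evolve n E (Suc i) = bind_pmf (evolve n E i) (\<lambda>E'. map_pmf (add_edges R E') (draw n))"

lemma evolve_add: "evolve n E (i + j) = bind_pmf (evolve n E i) (\<lambda>E'. evolve n E' j)"
  by (induction j) (simp_all add: bind_return_pmf' bind_assoc_pmf)

lemma evolve_support:
  assumes "0 < n" "graph_on n E0" "E \<in> set_pmf (evolve n E0 i)"
  shows "graph_on n E" "E0 \<subseteq> E"
proof -
  have "graph_on n E \<and> E0 \<subseteq> E" using assms(3)
  proof (induction i arbitrary: E)
    case (Suc i)
    then obtain E' vs where E': "E' \<in> set_pmf (evolve n E0 i)" "vs \<in> draws n" "E = add_edges R E' vs"
      using set_draw[OF assms(1)] by auto
    then show ?case using Suc.IH[OF E'(1)] graph_on_add_edges add_edges_supset by blast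
  qed (simp add: assms)
  then show "graph_on n E" "E0 \<subseteq> E" by auto
qed

lemma finite_evolve: "0 < n \<Longrightarrow> finite (set_pmf (evolve n E0 i))"
  by (induction i) (auto simp: finite_draw)

lemma mean_evolve_Suc:
  assumes "0 < n"
  shows "mean (evolve n E0 (Suc i)) h = mean (evolve n E0 i) (\<lambda>E. mean (draw n) (\<lambda>vs. h (add_edges R E vs)))"
  using assms by (simp add: mean_bind finite_evolve finite_draw)

lemma mean_evolve_step_le:
  assumes "0 < n" "graph_on n E0"
    "\<And>E. graph_on n E \<Longrightarrow> E0 \<subseteq> E \<Longrightarrow> mean (draw n) (\<lambda>vs. h (add_edges R E vs)) \<le> g E"
  shows "mean (evolve n E0 (Suc i)) h \<le> mean (evolve n E0 i) g"
  unfolding mean_evolve_Suc[OF assms(1)]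
  by (intro mean_mono finite_evolve assms evolve_support[OF assms(1,2)])

lemma mean_evolve_step_ge:
  assumes "0 < n" "graph_on n E0"
    "\<And>E. graph_on n E \<Longrightarrow> E0 \<subseteq> E \<Longrightarrow> g E \<le> mean (draw n) (\<lambda>vs. h (add_edges R E vs))"
  shows "mean (evolve n E0 i) g \<le> mean (evolve n E0 (Suc i)) h"
  unfolding mean_evolve_Suc[OF assms(1)]
  by (intro mean_mono finite_evolve assms evolve_support[OF assms(1,2)])

lemma mean_draw_add_edges_ge:
  assumes "0 < n" "graph_on n E" "\<And>E'. E \<subseteq> E' \<Longrightarrow> graph_on n E' \<Longrightarrow> h E \<le> h E'"
  shows "h E \<le> mean (draw n) (\<lambda>vs. h (add_edges R E vs))"
proof -
  have "mean (draw n) (\<lambda>vs. h E) \<le> mean (draw n) (\<lambda>vs. h (add_edges R E vs))"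
    using assms graph_on_add_edges[OF assms(2)]
    by (intro mean_mono finite_draw assms add_edges_supset) (auto simp: set_draw)
  then show ?thesis by simp
qed

text \<open>
  Edges are never removed. For this reason no stopping times occur below: an event about the past
  can be replaced by a monotone event about the present.
\<close>

lemma mean_evolve_mono:
  assumes "0 < n" "graph_on n E0" "i \<le> j"
    "\<And>E E'. E \<subseteq> E' \<Longrightarrow> graph_on n E \<Longrightarrow> graph_on n E' \<Longrightarrow> h E \<le> h E'"
  shows "mean (evolve n E0 i) h \<le> mean (evolve n E0 j) h"
  using assms(3)
proof (induction rule: dec_induct)
  case (step k)
  have "mean (evolve n E0 k) h \<le> mean (evolve n E0 (Suc k)) h"
    using assms by (intro mean_evolve_step_ge mean_draw_add_edges_ge) auto
  then show ?case using step.IH by linarith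
qed simp

abbreviation prob_at :: "nat \<Rightarrow> nat \<Rightarrow> (nat set set \<Rightarrow> bool) \<Rightarrow> real" where
  "prob_at n i P \<equiv> measure_pmf.prob (evolve n {} i) {E. P E}"

lemma prob_at_mono:
  assumes "0 < n" "i \<le> j" "\<And>E E'. E \<subseteq> E' \<Longrightarrow> graph_on n E \<Longrightarrow> graph_on n E' \<Longrightarrow> P E \<Longrightarrow> P E'"
  shows "prob_at n i P \<le> prob_at n j P"
  unfolding prob_eq_mean using assms by (intro mean_evolve_mono) auto

lemma rule_graph_eq_fold: "rule_graph R \<omega> i = fold (\<lambda>vs E. add_edges R E vs) (stake i \<omega>) {}"
  by (induction i) (simp_all add: stake_Suc del: stake.simps(2))

lemma evolve_Suc_left: "evolve n E (Suc i) = bind_pmf (draw n) (\<lambda>vs. evolve n (add_edges R E vs) i)"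
  using evolve_add[of n E 1 i] by (simp add: bind_return_pmf bind_map_pmf)

text \<open>
  The stream space exposes the first choice, so the induction peels off the first step, with an
  arbitrary starting graph, by means of \<open>evolve_Suc_left\<close>.
\<close>

lemma emeasure_fold_stake:
  "emeasure (stream_space (measure_pmf (draw n)))
     {\<omega> \<in> space (stream_space (measure_pmf (draw n))). fold (\<lambda>vs E. add_edges R E vs) (stake i \<omega>) E \<in> A}
   = emeasure (measure_pmf (evolve n E i)) A"
proof (induction i arbitrary: E)
  case 0
  interpret prob_space "stream_space (measure_pmf (draw n))"
    by (rule prob_space.prob_space_stream_space) (rule prob_space_measure_pmf)
  show ?case using emeasure_space_1 by (simp add: indicator_def)
next
  case (Suc i)
  have stakeC: "stake i \<in> measurable (stream_space (measure_pmf (draw n))) (count_space UNIV)" for i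
    using measurable_stake[of i] by (simp cong: measurable_cong_sets add: sets_stream_space_cong[of "measure_pmf (draw n)" "count_space UNIV"])
  have meas: "{\<omega> \<in> space (stream_space (measure_pmf (draw n))). P (stake i \<omega>)} \<in> sets (stream_space (measure_pmf (draw n)))" for P i
    using measurable_sets[OF stakeC, of "{xs. P xs}" i] by (simp add: vimage_def Int_def conj_commute)
  show ?case
    by (subst prob_space.emeasure_stream_space[OF prob_space_measure_pmf])
       (use Suc meas[of "\<lambda>xs. fold (\<lambda>vs E. add_edges R E vs) xs E \<in> A" "Suc i"] in
         \<open>simp_all add: evolve_Suc_left emeasure_bind_pmf space_stream_space del: evolve.simps(2)\<close>)
qed

lemma prob_choices:
  "\<P>(\<omega> in choices ell n. P (rule_graph R \<omega> i)) = prob_at n i P"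
  using emeasure_fold_stake[of n i "{}" "Collect P"]
  by (simp add: measure_def choices_def rule_graph_eq_fold draw_def)

end

section \<open>Component types under one step of a bounded-size rule\<close>

locale bounded_rule = sized_rule +
  fixes B :: nat
  assumes capped: "\<And>cs. length cs = ell \<Longrightarrow> (\<And>c. c \<in> set cs \<Longrightarrow> 0 < c) \<Longrightarrow>
    R (map (\<lambda>c. min c (B + 1)) cs) = R cs"
begin

abbreviation capped_size :: "nat \<Rightarrow> nat set set \<Rightarrow> nat \<Rightarrow> nat" where
  "capped_size T E v \<equiv> min (csize E v) T"

text \<open>
  Any cap \<open>T > B\<close> preserves the sizes as the rule sees them. Larger caps than \<open>B + 1\<close> are needed
  to follow components of size larger than \<open>B\<close>.
\<close>

lemma rule_capped_sizes:
  assumes "graph_on n E" "vs \<in> draws n" "B + 1 \<le> T"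
  shows "R (map (capped_size T E) vs) = pairs E vs"
proof -
  have pos: "0 < csize E v" if "v \<in> set vs" for v
    using that assms(2) by (intro csize_pos[OF assms(1)]) (auto simp: draws_def)
  have "R (map (capped_size T E) vs) = R (map (\<lambda>c. min c (B + 1)) (map (capped_size T E) vs))"
    using assms pos by (intro capped[symmetric]) (auto simp: draws_def)
  also have "map (\<lambda>c. min c (B + 1)) (map (capped_size T E) vs)
      = map (\<lambda>c. min c (B + 1)) (map (\<lambda>v. csize E v) vs)"
    using assms(3) by (simp add: min.assoc min.absorb2)
  also have "R \<dots> = pairs E vs"
    using assms pos by (intro capped) (auto simp: draws_def)
  finally show ?thesis .
qed

text \<open>
  The capped size of the component of the \<open>j\<close>-th chosen vertex after the step, computed from capped
  sizes alone: the selected pairs form a graph on the indices, and the sizes in the block of \<open>j\<close>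
  add up. This is correct if small chosen components are distinct.
\<close>

definition new_type :: "nat \<Rightarrow> nat list \<Rightarrow> nat \<Rightarrow> nat" where
  "new_type T cs j = min (\<Sum>i\<in>component (R cs) j. cs ! i) T"

text \<open>
  Only components smaller than the cap count, since the type of a vertex in a larger component
  does not change any more.
\<close>

definition increment :: "nat \<Rightarrow> nat \<Rightarrow> nat list \<Rightarrow> real" where
  "increment T k cs = (\<Sum>j | j < ell \<and> cs ! j < T.
     real (cs ! j) * (of_bool (new_type T cs j = k) - of_bool (cs ! j = k)))"

text \<open>
  No two indices hit the same small component. Coincidences in large components are harmless,
  because a block containing a large component stays at the cap in any case.
\<close>

definition lonely :: "nat \<Rightarrow> nat set set \<Rightarrow> nat list \<Rightarrow> bool" where
  "lonely T E vs \<longleftrightarrow> (\<forall>i<ell. \<forall>j<ell. i \<noteq> j \<longrightarrow> csize E (vs ! i) < T \<longrightarrow> vs ! j \<notin> component E (vs ! i))"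

lemma block_lift:
  assumes "graph_on n E" "vs \<in> draws n" "B + 1 \<le> T" "i \<in> component (R (map (capped_size T E) vs)) j"
  shows "vs ! i \<in> component (add_edges R E vs) (vs ! j)"
proof -
  have "(j, i) \<in> {(x, y). {x, y} \<in> pairs E vs}\<^sup>*"
    using assms(4) unfolding rule_capped_sizes[OF assms(1-3)] by (simp add: component_def[of "pairs E vs"])
  then show ?thesis
  proof (induction rule: rtrancl_induct)
    case (step y z)
    then show ?case using pair_connected[of y z E vs] component_trans by blast
  qed simp
qed

lemma block_index:
  assumes "graph_on n E" "vs \<in> draws n" "B + 1 \<le> T" "j < ell"
  shows "component (R (map (capped_size T E) vs)) j \<subseteq> {..<ell}"
  using assms(4)
  by (intro component_subset_closed)
    (auto simp: edge_closed_def rule_capped_sizes[OF assms(1-3)] dest: pairsD[OF assms(1,2)])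

text \<open>
  If the block of \<open>j\<close> contains a large component, both sides are \<open>T\<close>. Otherwise the union of the
  small components in the block is disjoint and closed under all new edges, because a small component
  contains just one chosen vertex; so it is the new component.
\<close>

lemma new_type_eq:
  assumes g: "graph_on n E" "vs \<in> draws n" "B + 1 \<le> T" and "lonely T E vs" and j: "j < ell"
  shows "capped_size T (add_edges R E vs) (vs ! j) = new_type T (map (capped_size T E) vs) j"
proof -
  define cs where "cs = map (capped_size T E) vs"
  define J where "J = component (R cs) j"
  define E' where "E' = add_edges R E vs"
  have len: "length vs = ell" using g(2) by (simp add: draws_def)
  have J: "J \<subseteq> {..<ell}" using block_index[OF g j] by (simp add: J_def cs_def)
  then have finJ: "finite J" using finite_subset by blast
  have cs: "cs ! i = capped_size T E (vs ! i)" if "i \<in> J" for i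
    using that J len by (auto simp: cs_def)
  have sub: "component E (vs ! i) \<subseteq> component E' (vs ! j)" if "i \<in> J" for i
  proof -
    have "vs ! i \<in> component E' (vs ! j)"
      using block_lift[OF g] that by (simp add: J_def cs_def E'_def)
    then show ?thesis using component_mono[OF add_edges_supset, of E "vs ! i" vs] component_eq
      by (auto simp: E'_def)
  qed
  have fin: "finite (component E' (vs ! j))"
    using graph_on_add_edges[OF g(1,2)] draws_nth[OF g(2) j] unfolding E'_def by (rule finite_component)
  show ?thesis
  proof (cases "\<exists>i\<in>J. T \<le> csize E (vs ! i)")
    case True
    then obtain i where i: "i \<in> J" "T \<le> csize E (vs ! i)" by blast
    have "T \<le> csize E' (vs ! j)" using card_mono[OF fin sub[OF i(1)]] i(2) by linarith
    moreover have "T \<le> (\<Sum>i\<in>J. cs ! i)"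
      using member_le_sum[of i J "\<lambda>i. cs ! i"] i cs[OF i(1)] finJ by simp
    ultimately show ?thesis by (simp add: new_type_def J_def cs_def E'_def)
  next
    case False
    then have small: "csize E (vs ! i) < T" if "i \<in> J" for i using that by force
    have alone: "a = i" if "i \<in> J" "a < ell" "vs ! a \<in> component E (vs ! i)" for a i
      using assms(4) that small[OF that(1)] J unfolding lonely_def by blast
    define D where "D = (\<Union>i\<in>J. component E (vs ! i))"
    have "edge_closed E' D"
      unfolding edge_closed_def
    proof (intro allI impI)
      fix x y assume e: "{x, y} \<in> E'" and "x \<in> D"
      then obtain i where i: "i \<in> J" "x \<in> component E (vs ! i)" by (auto simp: D_def)
      show "y \<in> D"
      proof (cases "{x, y} \<in> E")
        case True
        then have "y \<in> component E (vs ! i)" using i component_edge component_trans by blast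
        then show ?thesis using i by (auto simp: D_def)
      next
        case False
        then obtain a b where ab: "{a, b} \<in> pairs E vs" "a < ell" "b < ell" "x = vs ! a" "y = vs ! b"
          using new_edge_touched[OF g(1,2)] e unfolding E'_def by blast
        then have "a = i" using alone i by blast
        then have "b \<in> J"
          using ab(1) i(1) component_edge[of i b "R cs"] component_trans
          unfolding J_def cs_def rule_capped_sizes[OF g] by blast
        then show ?thesis using ab component_refl unfolding D_def by blast
      qed
    qed
    moreover have "vs ! j \<in> D" by (auto simp: D_def J_def intro: bexI[of _ j])
    ultimately have "component E' (vs ! j) = D"
      using component_subset_closed[of E' D "vs ! j"] sub unfolding D_def by (intro equalityI UN_least) blast+
    moreover have "card D = (\<Sum>i\<in>J. csize E (vs ! i))"
      unfolding D_def
    proof (rule card_UN_disjoint[OF finJ])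
      show "\<forall>i\<in>J. finite (component E (vs ! i))"
        using finite_component[OF g(1)] draws_nth[OF g(2)] J by blast
      show "\<forall>i\<in>J. \<forall>i'\<in>J. i \<noteq> i' \<longrightarrow> component E (vs ! i) \<inter> component E (vs ! i') = {}"
      proof (intro ballI impI)
        fix i i' assume i: "i \<in> J" "i' \<in> J" "i \<noteq> i'"
        have "vs ! i' \<in> component E (vs ! i)" if "w \<in> component E (vs ! i)" "w \<in> component E (vs ! i')" for w
          using that component_sym component_trans by blast
        then show "component E (vs ! i) \<inter> component E (vs ! i') = {}"
          using alone[of i i'] i J by blast
      qed
    qed
    moreover have "(\<Sum>i\<in>J. csize E (vs ! i)) = (\<Sum>i\<in>J. cs ! i)"
      using small cs by (intro sum.cong) (auto simp: min_def less_imp_le)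
    ultimately show ?thesis by (simp add: new_type_def J_def cs_def E'_def)
  qed
qed

definition type_count :: "nat \<Rightarrow> nat \<Rightarrow> nat \<Rightarrow> nat set set \<Rightarrow> real" where
  "type_count n T k E = real (card {v \<in> {1..n}. capped_size T E v = k})"

definition small_idx :: "nat \<Rightarrow> nat set set \<Rightarrow> nat list \<Rightarrow> nat set" where
  "small_idx T E vs = {j. j < ell \<and> csize E (vs ! j) < T}"

lemma finite_small_idx: "finite (small_idx T E vs)"
  by (simp add: small_idx_def)

lemma type_unchanged:
  assumes "graph_on n E" "vs \<in> draws n" "v \<in> {1..n}"
    "v \<notin> (\<Union>j\<in>small_idx T E vs. component E (vs ! j))"
  shows "capped_size T (add_edges R E vs) v = capped_size T E v"
proof (cases "v \<in> touched E vs")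
  case True
  then obtain j where j: "j < ell" "v \<in> component E (vs ! j)"
    using assms(2) by (auto simp: touched_def draws_def in_set_conv_nth)
  then have "T \<le> csize E (vs ! j)" using assms(4) by (fastforce simp: small_idx_def not_less)
  then have "T \<le> csize E v" using component_eq[OF j(2)] by simp
  moreover have "csize E v \<le> csize (add_edges R E vs) v"
    using assms by (intro csize_mono[OF add_edges_supset] graph_on_add_edges)
  ultimately show ?thesis by simp
qed (simp add: component_untouched[OF assms(1,2)])

lemma small_union_subset:
  assumes "graph_on n E" "vs \<in> draws n"
  shows "(\<Union>j\<in>small_idx T E vs. component E (vs ! j)) \<subseteq> {1..n}"
  by (intro UN_least component_subset[OF assms(1)] draws_nth[OF assms(2)]) (simp add: small_idx_def)

lemma count_diff:
  assumes "graph_on n E" "vs \<in> draws n"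
  shows "type_count n T k (add_edges R E vs) - type_count n T k E =
    (\<Sum>v\<in>(\<Union>j\<in>small_idx T E vs. component E (vs ! j)).
       of_bool (capped_size T (add_edges R E vs) v = k) - of_bool (capped_size T E v = k))"
proof -
  have "type_count n T k (add_edges R E vs) - type_count n T k E
     = (\<Sum>v=1..n. of_bool (capped_size T (add_edges R E vs) v = k) - of_bool (capped_size T E v = k))"
    unfolding type_count_def card_Collect_sum sum_subtractf ..
  also have "\<dots> = (\<Sum>v\<in>(\<Union>j\<in>small_idx T E vs. component E (vs ! j)).
       of_bool (capped_size T (add_edges R E vs) v = k) - of_bool (capped_size T E v = k))"
    using small_union_subset[OF assms] type_unchanged[OF assms]
    by (intro sum.mono_neutral_right) auto
  finally show ?thesis .
qed

text \<open>
  Vertices outside the small chosen components keep their type by \<open>type_unchanged\<close>, and those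
  components are disjoint by loneliness, so the change is a sum over indices.
\<close>

lemma count_increment:
  assumes g: "graph_on n E" "vs \<in> draws n" "B + 1 \<le> T" and l: "lonely T E vs"
  shows "type_count n T k (add_edges R E vs) - type_count n T k E = increment T k (map (capped_size T E) vs)"
proof -
  let ?E' = "add_edges R E vs" and ?cs = "map (capped_size T E) vs"
  have len: "length vs = ell" using g(2) by (simp add: draws_def)
  have S: "small_idx T E vs = {j. j < ell \<and> ?cs ! j < T}"
    using len by (auto simp: small_idx_def)
  have "type_count n T k ?E' - type_count n T k E =
    (\<Sum>j\<in>small_idx T E vs. \<Sum>v\<in>component E (vs ! j). of_bool (capped_size T ?E' v = k) - of_bool (capped_size T E v = k))"
    unfolding count_diff[OF g(1,2)]
  proof (rule sum.UNION_disjoint[OF finite_small_idx])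
    show "\<forall>i\<in>small_idx T E vs. finite (component E (vs ! i))"
      using finite_component[OF g(1)] draws_nth[OF g(2)] by (simp add: small_idx_def)
    show "\<forall>i\<in>small_idx T E vs. \<forall>j\<in>small_idx T E vs. i \<noteq> j \<longrightarrow>
       component E (vs ! i) \<inter> component E (vs ! j) = {}"
    proof (intro ballI impI)
      fix i i' assume i: "i \<in> small_idx T E vs" "i' \<in> small_idx T E vs" "i \<noteq> i'"
      have "vs ! i' \<in> component E (vs ! i)" if "w \<in> component E (vs ! i)" "w \<in> component E (vs ! i')" for w
        using that component_sym component_trans by blast
      then show "component E (vs ! i) \<inter> component E (vs ! i') = {}"
        using l i unfolding lonely_def small_idx_def by blast
    qed
  qed
  also have "\<dots> = (\<Sum>j\<in>small_idx T E vs.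
     real (?cs ! j) * (of_bool (new_type T ?cs j = k) - of_bool (?cs ! j = k)))"
  proof (intro sum.cong refl)
    fix j assume j: "j \<in> small_idx T E vs"
    then have jl: "j < ell" "csize E (vs ! j) < T" by (auto simp: small_idx_def)
    have "capped_size T ?E' v = new_type T ?cs j \<and> capped_size T E v = ?cs ! j" if "v \<in> component E (vs ! j)" for v
    proof -
      have "component ?E' v = component ?E' (vs ! j)"
        using that component_mono[OF add_edges_supset, of E "vs ! j" vs] by (intro component_eq) auto
      then show ?thesis using new_type_eq[OF g l jl(1)] component_eq[OF that] jl len by simp
    qed
    then show "(\<Sum>v\<in>component E (vs ! j). of_bool (capped_size T ?E' v = k) - of_bool (capped_size T E v = k))
       = real (?cs ! j) * (of_bool (new_type T ?cs j = k) - of_bool (?cs ! j = k))"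
      using jl len by simp
  qed
  finally show ?thesis unfolding increment_def S .
qed

lemma count_diff_abs:
  assumes "graph_on n E" "vs \<in> draws n"
  shows "\<bar>type_count n T k (add_edges R E vs) - type_count n T k E\<bar> \<le> real (ell * T)"
proof -
  let ?U = "\<Union>j\<in>small_idx T E vs. component E (vs ! j)"
  have "\<bar>type_count n T k (add_edges R E vs) - type_count n T k E\<bar> \<le> (\<Sum>v\<in>?U. 1)"
    unfolding count_diff[OF assms] by (rule order.trans[OF sum_abs]) (intro sum_mono, auto)
  also have "\<dots> = real (card ?U)" by simp
  also have "card ?U \<le> (\<Sum>j\<in>small_idx T E vs. csize E (vs ! j))"
    by (rule card_UN_le[OF finite_small_idx])
  also have "\<dots> \<le> (\<Sum>j\<in>small_idx T E vs. T)"
    by (intro sum_mono) (auto simp: small_idx_def)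
  also have "\<dots> \<le> ell * T"
    using card_mono[of "{..<ell}" "small_idx T E vs"] by (auto simp: small_idx_def)
  finally show ?thesis by simp
qed

lemma increment_abs: "\<bar>increment T k cs\<bar> \<le> real (ell * T)"
proof -
  have "\<bar>increment T k cs\<bar> \<le> (\<Sum>j | j < ell \<and> cs ! j < T. real T)"
    unfolding increment_def
    by (rule order.trans[OF sum_abs]) (intro sum_mono, auto simp: abs_mult)
  also have "\<dots> \<le> real (ell * T)"
    using card_mono[of "{..<ell}" "{j. j < ell \<and> cs ! j < T}"] by (auto intro!: mult_right_mono simp flip: of_nat_mult)
  finally show ?thesis .
qed

text \<open>
  Given the first of two vertices, at most \<open>T\<close> of the \<open>n\<close> choices of the second one hit its small
  component.
\<close>

lemma prob_not_lonely:
  assumes "0 < n" "graph_on n E"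
  shows "mean (draw n) (\<lambda>vs. of_bool (\<not> lonely T E vs)) \<le> real (ell\<^sup>2 * T) / real n"
proof -
  let ?f = "\<lambda>u w. of_bool (csize E u < T \<and> w \<in> component E u) :: real"
  have "mean (draw n) (\<lambda>vs. of_bool (\<not> lonely T E vs))
     \<le> mean (draw n) (\<lambda>vs. \<Sum>i<ell. \<Sum>j\<in>{..<ell} - {i}. ?f (vs ! i) (vs ! j))"
  proof (rule mean_mono[OF finite_draw[OF assms(1)]])
    fix vs
    show "of_bool (\<not> lonely T E vs) \<le> (\<Sum>i<ell. \<Sum>j\<in>{..<ell} - {i}. ?f (vs ! i) (vs ! j))"
    proof (cases "lonely T E vs")
      case False
      then obtain i j where ij: "i < ell" "j < ell" "i \<noteq> j" "csize E (vs ! i) < T" "vs ! j \<in> component E (vs ! i)"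
        unfolding lonely_def by blast
      have "1 \<le> (\<Sum>j\<in>{..<ell} - {i}. ?f (vs ! i) (vs ! j))"
        using member_le_sum[of j "{..<ell} - {i}" "\<lambda>j. ?f (vs ! i) (vs ! j)"] ij by auto
      also have "\<dots> \<le> (\<Sum>i<ell. \<Sum>j\<in>{..<ell} - {i}. ?f (vs ! i) (vs ! j))"
        using member_le_sum[of i "{..<ell}" "\<lambda>i. \<Sum>j\<in>{..<ell} - {i}. ?f (vs ! i) (vs ! j)"] ij
        by (simp add: sum_nonneg)
      finally show ?thesis by simp
    qed (simp add: sum_nonneg)
  qed
  also have "\<dots> = (\<Sum>i<ell. \<Sum>j\<in>{..<ell} - {i}. (\<Sum>u=1..n. \<Sum>w=1..n. ?f u w) / (real n)\<^sup>2)"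
    unfolding mean_sum[OF finite_draw[OF assms(1)]]
    by (intro sum.cong refl mean_draw_pair assms) auto
  also have "\<dots> \<le> (\<Sum>i<ell. \<Sum>j\<in>{..<ell} - {i}. real T / real n)"
  proof (intro sum_mono)
    have "(\<Sum>w=1..n. ?f u w) \<le> real T" if "u \<in> {1..n}" for u
    proof (cases "csize E u < T")
      case True
      have "(\<Sum>w=1..n. ?f u w) = real (card {w \<in> {1..n}. w \<in> component E u})"
        unfolding card_Collect_sum using True by simp
      also have "\<dots> \<le> real (csize E u)"
        using finite_component[OF assms(2) that] by (intro of_nat_mono card_mono) auto
      finally show ?thesis using True by linarith
    qed simp
    then have "(\<Sum>u=1..n. \<Sum>w=1..n. ?f u w) \<le> (\<Sum>u=1..n. real T)" by (intro sum_mono)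
    then have "(\<Sum>u=1..n. \<Sum>w=1..n. ?f u w) / (real n)\<^sup>2 \<le> (real n * real T) / (real n)\<^sup>2"
      by (intro divide_right_mono) auto
    then show "(\<Sum>u=1..n. \<Sum>w=1..n. ?f u w) / (real n)\<^sup>2 \<le> real T / real n"
      using assms(1) by (simp add: power2_eq_square)
  qed
  also have "\<dots> \<le> (\<Sum>i<ell. \<Sum>j<ell. real T / real n)"
    by (intro sum_mono sum_mono2) auto
  also have "\<dots> = real (ell\<^sup>2 * T) / real n" by (simp add: power2_eq_square)
  finally show ?thesis .
qed

lemma mean_count_increment:
  assumes "0 < n" "graph_on n E" "B + 1 \<le> T"
  shows "\<bar>mean (draw n) (\<lambda>vs. type_count n T k (add_edges R E vs) - type_count n T k E)
      - mean (draw n) (\<lambda>vs. increment T k (map (capped_size T E) vs))\<bar>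
    \<le> 2 * real (ell * T) * real (ell\<^sup>2 * T) / real n"
proof -
  let ?d = "\<lambda>vs. (type_count n T k (add_edges R E vs) - type_count n T k E) - increment T k (map (capped_size T E) vs)"
  have "\<bar>mean (draw n) ?d\<bar> \<le> mean (draw n) (\<lambda>vs. 2 * real (ell * T) * of_bool (\<not> lonely T E vs))"
  proof (rule mean_abs_le[OF finite_draw[OF assms(1)]])
    fix vs assume "vs \<in> set_pmf (draw n)"
    then have vs: "vs \<in> draws n" using set_draw assms(1) by simp
    show "\<bar>?d vs\<bar> \<le> 2 * real (ell * T) * of_bool (\<not> lonely T E vs)"
    proof (cases "lonely T E vs")
      case True
      then show ?thesis using count_increment[OF assms(2) vs assms(3)] by simp
    next
      case False
      then show ?thesis using count_diff_abs[OF assms(2) vs, of T k] increment_abs[of T k "map (capped_size T E) vs"]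
        by simp
    qed
  qed
  also have "\<dots> = 2 * real (ell * T) * mean (draw n) (\<lambda>vs. of_bool (\<not> lonely T E vs))" by simp
  also have "\<dots> \<le> 2 * real (ell * T) * (real (ell\<^sup>2 * T) / real n)"
    by (intro mult_left_mono prob_not_lonely assms) simp
  finally show ?thesis unfolding mean_diff[OF finite_draw[OF assms(1)]] by simp
qed

end

section \<open>Gronwall inequality, polynomial drifts and Euler schemes\<close>

lemma gronwall_sum:
  fixes u b :: "nat \<Rightarrow> real"
  assumes "0 \<le> a" "\<And>i. 0 \<le> b i" "\<And>i. i < m \<Longrightarrow> u (Suc i) \<le> (1 + a) * u i + b i" "0 \<le> u 0"
  shows "i \<le> m \<Longrightarrow> u i \<le> exp (a * real i) * (u 0 + (\<Sum>j<i. b j))"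
proof (induction i)
  case (Suc i)
  have S: "0 \<le> u 0 + (\<Sum>j<i. b j)" using assms by (simp add: sum_nonneg)
  have "u (Suc i) \<le> (1 + a) * u i + b i" using assms(3) Suc.prems by simp
  also have "\<dots> \<le> exp a * (exp (a * real i) * (u 0 + (\<Sum>j<i. b j))) + exp (a * real (Suc i)) * b i"
  proof (rule add_mono)
    have "(1 + a) * u i \<le> (1 + a) * (exp (a * real i) * (u 0 + (\<Sum>j<i. b j)))"
      using Suc assms(1) by (intro mult_left_mono) auto
    also have "\<dots> \<le> exp a * (exp (a * real i) * (u 0 + (\<Sum>j<i. b j)))"
      using S by (intro mult_right_mono exp_ge_add_one_self) auto
    finally show "(1 + a) * u i \<le> exp a * (exp (a * real i) * (u 0 + (\<Sum>j<i. b j)))" .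
    have "1 * b i \<le> exp (a * real (Suc i)) * b i"
      using assms(1,2) by (intro mult_right_mono) auto
    then show "b i \<le> exp (a * real (Suc i)) * b i" by simp
  qed
  also have "exp a * (exp (a * real i) * (u 0 + (\<Sum>j<i. b j))) = exp (a * real (Suc i)) * (u 0 + (\<Sum>j<i. b j))"
  proof -
    have "exp a * exp (a * real i) = exp (a * real (Suc i))"
      by (subst exp_add[symmetric]) (simp add: algebra_simps)
    then show ?thesis by (simp only: mult.assoc[symmetric])
  qed
  also have "exp (a * real (Suc i)) * (u 0 + (\<Sum>j<i. b j)) + exp (a * real (Suc i)) * b i
      = exp (a * real (Suc i)) * (u 0 + (\<Sum>j<Suc i. b j))"
    by (simp only: sum.lessThan_Suc distrib_left add.assoc)
  finally show ?case .
qed simp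

text \<open>
  The mean of \<open>g\<close> over lists of \<open>l\<close> independent entries from \<open>{1..T}\<close> with weights \<open>p\<close>,
  as a polynomial in \<open>p\<close>; the weights may be any reals.
\<close>

primrec poly_mean :: "nat \<Rightarrow> nat \<Rightarrow> (nat \<Rightarrow> real) \<Rightarrow> (nat list \<Rightarrow> real) \<Rightarrow> real" where
  "poly_mean T 0 p g = g []"
| "poly_mean T (Suc l) p g = (\<Sum>c=1..T. p c * poly_mean T l p (\<lambda>cs. g (c # cs)))"

lemma poly_mean_abs:
  assumes "\<And>c. \<bar>p c\<bar> \<le> 1" "\<And>cs. \<bar>g cs\<bar> \<le> G"
  shows "\<bar>poly_mean T l p g\<bar> \<le> real T ^ l * G"
  using assms(2)
proof (induction l arbitrary: g)
  case (Suc l)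
  have "\<bar>poly_mean T (Suc l) p g\<bar> \<le> (\<Sum>c=1..T. \<bar>p c\<bar> * \<bar>poly_mean T l p (\<lambda>cs. g (c # cs))\<bar>)"
    unfolding poly_mean.simps by (rule order.trans[OF sum_abs]) (simp add: abs_mult)
  also have "\<dots> \<le> (\<Sum>c=1..T. 1 * (real T ^ l * G))"
    using Suc assms(1) by (intro sum_mono mult_mono) auto
  finally show ?case by simp
qed simp

text \<open>
  Replace the factors one at a time: \<open>p A - q D = p (A - D) + (p - q) D\<close>.
\<close>

lemma poly_mean_Lipschitz:
  assumes "\<And>c. \<bar>p c\<bar> \<le> 1" "\<And>c. \<bar>q c\<bar> \<le> 1" "\<And>cs. \<bar>g cs\<bar> \<le> G" "1 \<le> T"
  shows "\<bar>poly_mean T l p g - poly_mean T l q g\<bar> \<le> real l * real T ^ l * G * (\<Sum>c=1..T. \<bar>p c - q c\<bar>)"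
  using assms(3)
proof (induction l arbitrary: g)
  case (Suc l)
  define \<delta> where "\<delta> = (\<Sum>c=1..T. \<bar>p c - q c\<bar>)"
  have \<delta>: "0 \<le> \<delta>" by (simp add: \<delta>_def sum_nonneg)
  have G: "0 \<le> G" using Suc.prems[of "[]"] by linarith
  have "\<bar>poly_mean T (Suc l) p g - poly_mean T (Suc l) q g\<bar>
     \<le> (\<Sum>c=1..T. \<bar>p c * poly_mean T l p (\<lambda>cs. g (c # cs)) - q c * poly_mean T l q (\<lambda>cs. g (c # cs))\<bar>)"
    unfolding poly_mean.simps sum_subtractf[symmetric] by (rule sum_abs)
  also have "\<dots> \<le> (\<Sum>c=1..T. real l * real T ^ l * G * \<delta> + \<bar>p c - q c\<bar> * (real T ^ l * G))"
  proof (rule sum_mono)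
    fix c assume "c \<in> {1..T}"
    let ?P = "poly_mean T l p (\<lambda>cs. g (c # cs))" and ?Q = "poly_mean T l q (\<lambda>cs. g (c # cs))"
    have "\<bar>p c * ?P - q c * ?Q\<bar> = \<bar>p c * (?P - ?Q) + (p c - q c) * ?Q\<bar>" by (simp add: algebra_simps)
    also have "\<dots> \<le> \<bar>p c\<bar> * \<bar>?P - ?Q\<bar> + \<bar>p c - q c\<bar> * \<bar>?Q\<bar>"
      by (metis abs_mult abs_triangle_ineq)
    also have "\<dots> \<le> 1 * (real l * real T ^ l * G * \<delta>) + \<bar>p c - q c\<bar> * (real T ^ l * G)"
      using Suc.prems Suc.IH[of "\<lambda>cs. g (c # cs)"] assms(1)[of c] poly_mean_abs[of q "\<lambda>cs. g (c # cs)" G T l, OF assms(2)]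
      by (intro add_mono mult_mono) (auto simp: \<delta>_def)
    finally show "\<bar>p c * ?P - q c * ?Q\<bar> \<le> real l * real T ^ l * G * \<delta> + \<bar>p c - q c\<bar> * (real T ^ l * G)" by simp
  qed
  also have "\<dots> = real T * (real l * real T ^ l * G * \<delta>) + \<delta> * (real T ^ l * G)"
    by (simp add: sum.distrib sum_distrib_right \<delta>_def)
  also have "\<dots> \<le> real T * (real l * real T ^ l * G * \<delta>) + real T * (real T ^ l * G * \<delta>)"
  proof -
    have "1 * (real T ^ l * G * \<delta>) \<le> real T * (real T ^ l * G * \<delta>)"
      using assms(4) G \<delta> by (intro mult_right_mono) auto
    then show ?thesis by (simp add: mult.commute)
  qed
  also have "\<dots> = real (Suc l) * real T ^ Suc l * G * \<delta>" by (simp add: algebra_simps)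
  finally show ?case by (simp add: \<delta>_def)
qed simp

primrec euler :: "((nat \<Rightarrow> real) \<Rightarrow> nat \<Rightarrow> real) \<Rightarrow> (nat \<Rightarrow> real) \<Rightarrow> nat \<Rightarrow> nat \<Rightarrow> nat \<Rightarrow> real" where
  "euler F y0 n 0 = y0"
| "euler F y0 n (Suc i) = (\<lambda>k. euler F y0 n i k + F (euler F y0 n i) k / real n)"

context
  fixes F :: "(nat \<Rightarrow> real) \<Rightarrow> nat \<Rightarrow> real" and y0 :: "nat \<Rightarrow> real" and T :: nat and M L :: real
  assumes bounded: "\<And>p k. \<bar>F p k\<bar> \<le> M"
    and Lipschitz: "\<And>p q k. \<bar>F p k - F q k\<bar> \<le> L * (\<Sum>c=1..T. \<bar>p c - q c\<bar>)"
    and L0: "0 \<le> L"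
begin

lemma euler_increment:
  "\<bar>euler F y0 n (i + j) k - euler F y0 n i k\<bar> \<le> M * real j / real n"
proof (induction j)
  case (Suc j)
  have "\<bar>F (euler F y0 n (i + j)) k / real n\<bar> \<le> M / real n"
    using bounded[of "euler F y0 n (i + j)" k] by (simp add: divide_right_mono)
  moreover have "euler F y0 n (i + Suc j) k = euler F y0 n (i + j) k + F (euler F y0 n (i + j)) k / real n"
    by simp
  moreover have "M * real (Suc j) / real n = M * real j / real n + M / real n"
    by (simp add: algebra_simps add_divide_distrib)
  ultimately show ?case using Suc by linarith
qed simp

text \<open>
  The scheme with \<open>n * m\<close> steps per unit of time is followed in blocks of \<open>m\<close> steps. During a block it moves
  by at most \<open>M / n\<close>, so the block differs from one step of the coarse scheme by \<open>O(1/n\<^sup>2)\<close>, and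
  these errors are accumulated by the discrete Gronwall inequality.
\<close>

lemma euler_refine:
  assumes n: "0 < n" and m: "0 < m"
  shows "(\<Sum>k=1..T. \<bar>euler F y0 (n * m) (m * i) k - euler F y0 n i k\<bar>)
    \<le> exp (L * real T * real i / real n) * (real i * (L * (real T)\<^sup>2 * M / (real n)\<^sup>2))"
proof -
  let ?z = "euler F y0 (n * m)" and ?y = "euler F y0 n"
  define u where "u i = (\<Sum>k=1..T. \<bar>?z (m * i) k - ?y i k\<bar>)" for i
  have M0: "0 \<le> M" using bounded[of y0 0] by linarith
  \<comment> \<open>after j fine steps, compared with j steps along the drift frozen at the start of the block\<close>
  have block: "\<bar>?z (m * i + j) k - ?z (m * i) k - real j * F (?z (m * i)) k / real (n * m)\<bar>
      \<le> real j * (L * real T * M / (real n)\<^sup>2 / real m)" if "j \<le> m" for i j k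
    using that
  proof (induction j)
    case (Suc j)
    have close: "(\<Sum>c=1..T. \<bar>?z (m * i + j) c - ?z (m * i) c\<bar>) \<le> real T * (M / real n)"
    proof -
      have "\<bar>?z (m * i + j) c - ?z (m * i) c\<bar> \<le> M / real n" for c
      proof -
        have "\<bar>?z (m * i + j) c - ?z (m * i) c\<bar> \<le> M * real j / real (n * m)" by (rule euler_increment)
        also have "\<dots> \<le> M * real m / real (n * m)"
          using Suc.prems M0 by (intro divide_right_mono mult_left_mono) auto
        finally show ?thesis using m by simp
      qed
      then have "(\<Sum>c=1..T. \<bar>?z (m * i + j) c - ?z (m * i) c\<bar>) \<le> (\<Sum>c=1..T. M / real n)" by (intro sum_mono)
      then show ?thesis by simp
    qed
    have "\<bar>F (?z (m * i + j)) k - F (?z (m * i)) k\<bar> \<le> L * (real T * (M / real n))"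
      using Lipschitz[of "?z (m * i + j)" k "?z (m * i)"] mult_left_mono[OF close L0] by linarith
    then have "\<bar>F (?z (m * i + j)) k - F (?z (m * i)) k\<bar> / real (n * m) \<le> L * (real T * (M / real n)) / real (n * m)"
      by (intro divide_right_mono) auto
    then have d: "\<bar>F (?z (m * i + j)) k / real (n * m) - F (?z (m * i)) k / real (n * m)\<bar>
       \<le> L * real T * M / (real n)\<^sup>2 / real m"
      by (simp add: diff_divide_distrib[symmetric] abs_divide power2_eq_square mult.assoc)
    have "?z (m * i + Suc j) k - ?z (m * i) k - real (Suc j) * F (?z (m * i)) k / real (n * m)
       = (?z (m * i + j) k - ?z (m * i) k - real j * F (?z (m * i)) k / real (n * m))
         + (F (?z (m * i + j)) k / real (n * m) - F (?z (m * i)) k / real (n * m))"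
      by (simp add: algebra_simps add_divide_distrib)
    also have "\<bar>\<dots>\<bar> \<le> real j * (L * real T * M / (real n)\<^sup>2 / real m) + L * real T * M / (real n)\<^sup>2 / real m"
      using Suc d by (intro order.trans[OF abs_triangle_ineq] add_mono) auto
    also have "\<dots> = real (Suc j) * (L * real T * M / (real n)\<^sup>2 / real m)"
      unfolding of_nat_Suc distrib_right by (simp only: mult_1_left add.commute)
    finally show ?case .
  qed simp
  have step: "u (Suc i) \<le> (1 + L * real T / real n) * u i + L * (real T)\<^sup>2 * M / (real n)\<^sup>2" for i
  proof -
    have "\<bar>?z (m * Suc i) k - ?y (Suc i) k\<bar>
        \<le> \<bar>?z (m * i) k - ?y i k\<bar> + (L * u i / real n + L * real T * M / (real n)\<^sup>2)" for k
    proof -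
      have a: "\<bar>?z (m * i + m) k - ?z (m * i) k - F (?z (m * i)) k / real n\<bar> \<le> L * real T * M / (real n)\<^sup>2"
        using block[of m i k] m by (simp add: mult.commute)
      have b: "\<bar>F (?z (m * i)) k / real n - F (?y i) k / real n\<bar> \<le> L * u i / real n"
        using Lipschitz[of "?z (m * i)" k "?y i"]
        by (simp add: diff_divide_distrib[symmetric] u_def divide_right_mono)
      have "?z (m * Suc i) k - ?y (Suc i) k = (?z (m * i) k - ?y i k)
        + (?z (m * i + m) k - ?z (m * i) k - F (?z (m * i)) k / real n)
        + (F (?z (m * i)) k / real n - F (?y i) k / real n)"
        by (simp add: algebra_simps)
      then show ?thesis using a b by linarith
    qed
    then have "u (Suc i) \<le> (\<Sum>k=1..T. \<bar>?z (m * i) k - ?y i k\<bar> + (L * u i / real n + L * real T * M / (real n)\<^sup>2))"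
      unfolding u_def[of "Suc i"] by (intro sum_mono)
    also have "\<dots> = (1 + L * real T / real n) * u i + L * (real T)\<^sup>2 * M / (real n)\<^sup>2"
      by (simp add: sum.distrib u_def algebra_simps power2_eq_square)
    finally show ?thesis .
  qed
  have "u i \<le> exp (L * real T / real n * real i) * (u 0 + (\<Sum>j<i. L * (real T)\<^sup>2 * M / (real n)\<^sup>2))"
    using L0 M0 step by (intro gronwall_sum[where m = i]) (auto simp: u_def sum_nonneg)
  then show ?thesis by (simp add: u_def)
qed

lemma euler_refine_at:
  assumes n: "0 < n" and m: "0 < m" and t: "0 \<le> t" and k: "k \<in> {1..T}"
  shows "\<bar>euler F y0 (n * m) (steps t (n * m)) k - euler F y0 n (steps t n) k\<bar>
    \<le> (exp (L * real T * t) * t * (L * (real T)\<^sup>2 * M) + M) / real n"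
proof -
  let ?z = "euler F y0 (n * m)" and ?y = "euler F y0 n"
  define i where "i = steps t n"
  define j where "j = steps t (n * m)"
  have M0: "0 \<le> M" using bounded[of y0 0] by linarith
  have i: "real i \<le> t * real n" "t * real n < real i + 1"
    using t by (simp_all add: i_def of_nat_nat)
  have j: "real j \<le> t * real (n * m)" "t * real (n * m) < real j + 1"
    using t by (simp_all add: j_def of_nat_nat)
  have "real (m * i) < real j + 1"
  proof -
    have "real m * real i \<le> real m * (t * real n)" using i by (intro mult_left_mono) auto
    then show ?thesis using j by (simp add: mult_ac)
  qed
  then have ji: "m * i \<le> j" by linarith
  have "real j < real (m * i + m)"
  proof -
    have "real m * (t * real n) < real m * (real i + 1)" using i m by (intro mult_strict_left_mono) auto
    then show ?thesis using j by (simp add: algebra_simps)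
  qed
  then have jm: "j - m * i \<le> m" by linarith
  have "\<bar>?z (m * i) k - ?y i k\<bar> \<le> (\<Sum>k=1..T. \<bar>?z (m * i) k - ?y i k\<bar>)"
    using k member_le_sum[of k "{1..T}" "\<lambda>k. \<bar>?z (m * i) k - ?y i k\<bar>"] by simp
  also have "\<dots> \<le> exp (L * real T * real i / real n) * (real i * (L * (real T)\<^sup>2 * M / (real n)\<^sup>2))"
    by (rule euler_refine[OF n m])
  also have "\<dots> \<le> exp (L * real T * t) * ((t * real n) * (L * (real T)\<^sup>2 * M / (real n)\<^sup>2))"
  proof (intro mult_mono)
    have "L * real T * (real i / real n) \<le> L * real T * t"
      using i n L0 by (intro mult_left_mono) (auto simp: divide_le_eq)
    then show "exp (L * real T * real i / real n) \<le> exp (L * real T * t)" by simp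
  qed (use i L0 M0 t in auto)
  also have "\<dots> = exp (L * real T * t) * t * (L * (real T)\<^sup>2 * M) / real n"
    using n by (simp add: power2_eq_square)
  finally have A: "\<bar>?z (m * i) k - ?y i k\<bar> \<le> exp (L * real T * t) * t * (L * (real T)\<^sup>2 * M) / real n" .
  have "\<bar>?z (m * i + (j - m * i)) k - ?z (m * i) k\<bar> \<le> M * real (j - m * i) / real (n * m)"
    by (rule euler_increment)
  also have "\<dots> \<le> M * real m / real (n * m)" using jm M0 by (intro divide_right_mono mult_left_mono) auto
  finally have "\<bar>?z j k - ?z (m * i) k\<bar> \<le> M / real n" using ji m by simp
  then show ?thesis using A unfolding i_def[symmetric] j_def[symmetric] by (simp add: add_divide_distrib)
qed

text \<open>
  Schemes for \<open>n\<close> and \<open>m\<close> are both compared with their common refinement for \<open>n * m\<close>, so they form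
  a Cauchy sequence. This replaces an existence theorem for the limiting differential equation.
\<close>

lemma euler_convergent:
  assumes "0 \<le> t" "k \<in> {1..T}"
  shows "convergent (\<lambda>n. euler F y0 n (steps t n) k)"
proof -
  define C where "C = exp (L * real T * t) * t * (L * (real T)\<^sup>2 * M) + M"
  define y where "y n = euler F y0 n (steps t n) k" for n
  have ref: "\<bar>y (n * m) - y n\<bar> \<le> C / real n" if "0 < n" "0 < m" for n m
    using euler_refine_at[OF that assms] by (simp add: y_def C_def)
  have "Cauchy y"
  proof (rule metric_CauchyI)
    fix e :: real assume e: "0 < e"
    obtain N :: nat where N: "2 * C / e < real N" using reals_Archimedean2 by blast
    have "dist (y m) (y n) < e" if "Suc N \<le> m" "Suc N \<le> n" for m n
    proof -
      have small: "C / real l < e / 2" if "Suc N \<le> l" for l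
      proof -
        have "2 * C / e < real l" using N that by linarith
        then show ?thesis using e that by (simp add: field_simps)
      qed
      have "\<bar>y (n * m) - y n\<bar> < e / 2" "\<bar>y (m * n) - y m\<bar> < e / 2"
        using ref[of n m] ref[of m n] small[OF that(1)] small[OF that(2)] that by linarith+
      then show ?thesis unfolding mult.commute[of m n] dist_real_def by linarith
    qed
    then show "\<exists>M. \<forall>m\<ge>M. \<forall>n\<ge>M. dist (y m) (y n) < e" by blast
  qed
  then show ?thesis unfolding y_def[abs_def] by (simp only: Cauchy_convergent_iff)
qed

end

section \<open>Concentration of the component size distribution\<close>

lemma square_sum_le: "(a + b)\<^sup>2 \<le> 2 * a\<^sup>2 + 2 * (b :: real)\<^sup>2"
  using zero_le_power2[of "a - b"] by (simp add: power2_sum power2_diff)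

text \<open>
  The cross term in the expansion of the squared distance between the chain and the Euler
  scheme: \<open>a\<close> is the current distance, \<open>d\<close> the difference of the drifts.
\<close>

lemma sum_cross_bound:
  fixes a d :: "nat \<Rightarrow> real"
  assumes "\<And>k. k \<in> I \<Longrightarrow> \<bar>d k\<bar> \<le> \<alpha> + L * (\<Sum>c\<in>I. \<bar>a c\<bar>)" "0 \<le> L" "finite I"
  shows "(\<Sum>k\<in>I. 2 * a k * d k) \<le> (1 + 2 * L * real (card I)) * (\<Sum>k\<in>I. (a k)\<^sup>2) + real (card I) * \<alpha>\<^sup>2"
proof -
  define A where "A = (\<Sum>c\<in>I. \<bar>a c\<bar>)"
  have A: "A\<^sup>2 \<le> real (card I) * (\<Sum>k\<in>I. (a k)\<^sup>2)"
    using sum_squared_le_sum_of_squares[of "\<lambda>c. \<bar>a c\<bar>" I] by (simp add: A_def mult.commute)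
  have "2 * a k * d k \<le> (a k)\<^sup>2 + \<alpha>\<^sup>2 + 2 * L * A * \<bar>a k\<bar>" if "k \<in> I" for k
  proof -
    have "2 * a k * d k \<le> 2 * \<bar>a k\<bar> * \<bar>d k\<bar>" by (metis abs_ge_self abs_mult abs_numeral)
    also have "\<dots> \<le> 2 * \<bar>a k\<bar> * (\<alpha> + L * A)"
      using assms(1)[OF that] by (intro mult_left_mono) (auto simp: A_def)
    also have "\<dots> \<le> (a k)\<^sup>2 + \<alpha>\<^sup>2 + 2 * L * A * \<bar>a k\<bar>"
      using zero_le_power2[of "\<bar>a k\<bar> - \<alpha>"] by (simp add: power2_diff algebra_simps)
    finally show ?thesis .
  qed
  then have "(\<Sum>k\<in>I. 2 * a k * d k) \<le> (\<Sum>k\<in>I. (a k)\<^sup>2 + \<alpha>\<^sup>2 + 2 * L * A * \<bar>a k\<bar>)" by (rule sum_mono)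
  also have "\<dots> = (\<Sum>k\<in>I. (a k)\<^sup>2) + real (card I) * \<alpha>\<^sup>2 + 2 * L * A\<^sup>2"
    by (simp add: sum.distrib sum_distrib_left[symmetric] A_def[symmetric] power2_eq_square)
  also have "\<dots> \<le> (\<Sum>k\<in>I. (a k)\<^sup>2) + real (card I) * \<alpha>\<^sup>2 + 2 * L * (real (card I) * (\<Sum>k\<in>I. (a k)\<^sup>2))"
    using A assms(2) by (intro add_left_mono mult_left_mono) auto
  finally show ?thesis by (simp add: algebra_simps)
qed

lemma mean_types:
  assumes "0 < n" "\<And>v. v \<in> {1..n} \<Longrightarrow> \<tau> v \<in> {1..T}"
  shows "mean (replicate_pmf l (pmf_of_set {1..n})) (\<lambda>vs. g (map \<tau> vs))
    = poly_mean T l (\<lambda>c. real (card {v \<in> {1..n}. \<tau> v = c}) / real n) g"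
proof (induction l arbitrary: g)
  case (Suc l)
  let ?p = "\<lambda>c. real (card {v \<in> {1..n}. \<tau> v = c}) / real n"
  let ?Q = "\<lambda>c. poly_mean T l ?p (\<lambda>cs. g (c # cs))"
  have fin: "finite (set_pmf (pmf_of_set {1..n}))" using assms(1) by (simp add: set_pmf_of_set)
  have "mean (replicate_pmf (Suc l) (pmf_of_set {1..n})) (\<lambda>vs. g (map \<tau> vs))
      = mean (pmf_of_set {1..n}) (\<lambda>v. ?Q (\<tau> v))"
    unfolding mean_replicate_pmf_Suc[OF fin] list.map
    by (rule mean_cong) (rule Suc.IH[of "\<lambda>cs. g (_ # cs)"])
  also have "\<dots> = (\<Sum>v=1..n. ?Q (\<tau> v)) / real n"
    using assms(1) by (simp add: integral_pmf_of_set)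
  also have "(\<Sum>v=1..n. ?Q (\<tau> v)) = (\<Sum>v=1..n. \<Sum>c=1..T. of_bool (\<tau> v = c) * ?Q c)"
  proof (intro sum.cong refl)
    fix v assume "v \<in> {1..n}"
    then have "\<tau> v \<in> {1..T}" by (rule assms(2))
    then show "?Q (\<tau> v) = (\<Sum>c=1..T. of_bool (\<tau> v = c) * ?Q c)"
      by (simp add: of_bool_def if_distrib[of "\<lambda>x. x * _"] cong: if_cong)
  qed
  also have "\<dots> = (\<Sum>c=1..T. \<Sum>v=1..n. of_bool (\<tau> v = c) * ?Q c)" by (rule sum.swap)
  also have "\<dots> = (\<Sum>c=1..T. real (card {v \<in> {1..n}. \<tau> v = c}) * ?Q c)"
    unfolding card_Collect_sum sum_distrib_right ..
  finally show ?case by (simp add: sum_divide_distrib)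
qed simp

text \<open>
  Clipping makes a polynomial drift globally Lipschitz without changing it at fractions, so the
  Euler scheme need not be shown to stay in the unit cube.
\<close>

definition clip :: "real \<Rightarrow> real" where
  "clip x = max 0 (min 1 x)"

lemma clip_Lipschitz: "\<bar>clip x - clip y\<bar> \<le> \<bar>x - y\<bar>"
  by (auto simp: clip_def)

lemma clip_abs: "\<bar>clip x\<bar> \<le> 1"
  by (auto simp: clip_def)

context bounded_rule
begin

definition drift :: "nat \<Rightarrow> (nat \<Rightarrow> real) \<Rightarrow> nat \<Rightarrow> real" where
  "drift T p k = poly_mean T ell (\<lambda>c. clip (p c)) (increment T k)"

definition start :: "nat \<Rightarrow> nat \<Rightarrow> real" where
  "start T k = of_bool (k = min 1 T)"

abbreviation drift_bound :: "nat \<Rightarrow> real" where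
  "drift_bound T \<equiv> real T ^ ell * real (ell * T)"

abbreviation drift_Lip :: "nat \<Rightarrow> real" where
  "drift_Lip T \<equiv> real ell * real T ^ ell * real (ell * T)"

lemma drift_abs: "\<bar>drift T p k\<bar> \<le> drift_bound T"
  unfolding drift_def by (rule poly_mean_abs[OF clip_abs increment_abs])

lemma drift_Lipschitz:
  assumes "1 \<le> T"
  shows "\<bar>drift T p k - drift T q k\<bar> \<le> drift_Lip T * (\<Sum>c=1..T. \<bar>p c - q c\<bar>)"
proof -
  have "\<bar>drift T p k - drift T q k\<bar> \<le> drift_Lip T * (\<Sum>c=1..T. \<bar>clip (p c) - clip (q c)\<bar>)"
    unfolding drift_def by (rule poly_mean_Lipschitz[OF clip_abs clip_abs increment_abs assms])
  also have "\<dots> \<le> drift_Lip T * (\<Sum>c=1..T. \<bar>p c - q c\<bar>)"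
    by (intro mult_left_mono sum_mono clip_Lipschitz) auto
  finally show ?thesis .
qed

lemma mean_increment_drift:
  assumes "0 < n" "graph_on n E" "1 \<le> T"
  shows "mean (draw n) (\<lambda>vs. increment T k (map (capped_size T E) vs)) = drift T (\<lambda>c. type_count n T c E / real n) k"
proof -
  have capped_size: "capped_size T E v \<in> {1..T}" if "v \<in> {1..n}" for v
    using csize_pos[OF assms(2) that] assms(3) by auto
  have "clip (type_count n T c E / real n) = type_count n T c E / real n" for c
  proof -
    have "card {v \<in> {1..n}. capped_size T E v = c} \<le> card {1..n}" by (intro card_mono) auto
    then show ?thesis using assms(1) by (simp add: clip_def type_count_def)
  qed
  then have "drift T (\<lambda>c. type_count n T c E / real n) k = poly_mean T ell (\<lambda>c. type_count n T c E / real n) (increment T k)"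
    by (simp add: drift_def)
  also have "\<dots> = mean (draw n) (\<lambda>vs. increment T k (map (capped_size T E) vs))"
    unfolding draw_def type_count_def by (rule mean_types[OF assms(1) capped_size, symmetric])
  finally show ?thesis ..
qed

text \<open>
  Expand the square. The drifts differ by the error \<open>O(1/n)\<close> from coincidences and by a Lipschitz
  term in the current distance; the squared increments contribute \<open>O(1/n\<^sup>2)\<close>.
\<close>

lemma step_variance:
  assumes n: "0 < n" and E: "graph_on n E" and T: "B + 1 \<le> T"
  defines "A \<equiv> 2 * real (ell * T) * real (ell\<^sup>2 * T)"
  shows "mean (draw n) (\<lambda>vs. \<Sum>k=1..T. (type_count n T k (add_edges R E vs) / real n - (y k + drift T y k / real n))\<^sup>2)
    \<le> (1 + (1 + 2 * drift_Lip T * real T) / real n) * (\<Sum>k=1..T. (type_count n T k E / real n - y k)\<^sup>2)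
       + real T * (A\<^sup>2 + (real (ell * T) + drift_bound T)\<^sup>2) / (real n)\<^sup>2"
proof -
  let ?D = "\<lambda>k vs. type_count n T k (add_edges R E vs) - type_count n T k E"
  define a where "a k = type_count n T k E / real n - y k" for k
  define d where "d k = mean (draw n) (?D k) - drift T y k" for k
  note fin = finite_draw[OF n]
  have d: "\<bar>d k\<bar> \<le> A / real n + drift_Lip T * (\<Sum>c=1..T. \<bar>a c\<bar>)" for k
    using mean_count_increment[OF n E T, of k] mean_increment_drift[OF n E, of T k]
      drift_Lipschitz[of T "\<lambda>c. type_count n T c E / real n" k y] T
    by (simp add: d_def a_def A_def)
  have one: "mean (draw n) (\<lambda>vs. (type_count n T k (add_edges R E vs) / real n - (y k + drift T y k / real n))\<^sup>2)
     \<le> (a k)\<^sup>2 + (2 * a k * d k) / real n + (real (ell * T) + drift_bound T)\<^sup>2 / (real n)\<^sup>2" for k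
  proof -
    have "(type_count n T k (add_edges R E vs) / real n - (y k + drift T y k / real n))\<^sup>2
       = (a k)\<^sup>2 + 2 * a k / real n * (?D k vs - drift T y k) + (?D k vs - drift T y k)\<^sup>2 / (real n)\<^sup>2" for vs
    proof -
      have "type_count n T k (add_edges R E vs) / real n - (y k + drift T y k / real n) = a k + (?D k vs - drift T y k) / real n"
        by (simp add: a_def diff_divide_distrib)
      then show ?thesis by (simp add: power2_sum power_divide)
    qed
    then have "mean (draw n) (\<lambda>vs. (type_count n T k (add_edges R E vs) / real n - (y k + drift T y k / real n))\<^sup>2)
       = (a k)\<^sup>2 + 2 * a k / real n * d k + mean (draw n) (\<lambda>vs. (?D k vs - drift T y k)\<^sup>2) / (real n)\<^sup>2"
      using mean_diff[OF fin, of "?D k" "\<lambda>_. drift T y k"]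
      by (simp add: mean_add[OF fin] d_def)
    also have "mean (draw n) (\<lambda>vs. (?D k vs - drift T y k)\<^sup>2) \<le> mean (draw n) (\<lambda>vs. (real (ell * T) + drift_bound T)\<^sup>2)"
    proof (rule mean_mono[OF fin])
      fix vs assume "vs \<in> set_pmf (draw n)"
      then have "\<bar>?D k vs\<bar> \<le> real (ell * T)" using count_diff_abs[OF E] set_draw[OF n] by blast
      then have "\<bar>?D k vs - drift T y k\<bar> \<le> real (ell * T) + drift_bound T" using drift_abs[of T y k] by linarith
      then have "\<bar>?D k vs - drift T y k\<bar>\<^sup>2 \<le> (real (ell * T) + drift_bound T)\<^sup>2" by (intro power_mono) auto
      then show "(?D k vs - drift T y k)\<^sup>2 \<le> (real (ell * T) + drift_bound T)\<^sup>2" by simp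
    qed
    finally show ?thesis by (simp add: divide_right_mono)
  qed
  have "mean (draw n) (\<lambda>vs. \<Sum>k=1..T. (type_count n T k (add_edges R E vs) / real n - (y k + drift T y k / real n))\<^sup>2)
    \<le> (\<Sum>k=1..T. (a k)\<^sup>2 + (2 * a k * d k) / real n + (real (ell * T) + drift_bound T)\<^sup>2 / (real n)\<^sup>2)"
    unfolding mean_sum[OF fin] by (intro sum_mono one)
  also have "\<dots> = (\<Sum>k=1..T. (a k)\<^sup>2) + (\<Sum>k=1..T. 2 * a k * d k) / real n + real T * (real (ell * T) + drift_bound T)\<^sup>2 / (real n)\<^sup>2"
    by (simp add: sum.distrib sum_divide_distrib)
  also have "(\<Sum>k=1..T. 2 * a k * d k) / real n
     \<le> ((1 + 2 * drift_Lip T * real T) * (\<Sum>k=1..T. (a k)\<^sup>2) + real T * (A / real n)\<^sup>2) / real n"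
    using sum_cross_bound[of "{1..T}" d "A / real n" "drift_Lip T" a, OF d] by (intro divide_right_mono) auto
  also have "\<dots> \<le> (1 + 2 * drift_Lip T * real T) / real n * (\<Sum>k=1..T. (a k)\<^sup>2) + real T * A\<^sup>2 / (real n)\<^sup>2"
  proof -
    have "real T * (A / real n)\<^sup>2 / real n \<le> real T * (A / real n)\<^sup>2 / 1"
      using n by (intro divide_left_mono) auto
    moreover have "(c * S + r) / real n = c / real n * S + r / real n" for c S r :: real
      by (simp add: add_divide_distrib)
    ultimately show ?thesis by (simp add: power_divide)
  qed
  finally show ?thesis
    by (simp add: a_def[symmetric] distrib_right distrib_left add_divide_distrib)
qed

lemma evolve_variance:
  assumes "B + 1 \<le> T" "0 \<le> t"
  shows "\<exists>C. \<forall>n>0. mean (evolve n {} (steps t n))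
    (\<lambda>E. \<Sum>k=1..T. (type_count n T k E / real n - euler (drift T) (start T) n (steps t n) k)\<^sup>2) \<le> C / real n"
proof -
  define c1 where "c1 = 1 + 2 * drift_Lip T * real T"
  define c2 where "c2 = real T * ((2 * real (ell * T) * real (ell\<^sup>2 * T))\<^sup>2 + (real (ell * T) + drift_bound T)\<^sup>2)"
  have c: "0 \<le> c1" "0 \<le> c2" by (simp_all add: c1_def c2_def)
  have "mean (evolve n {} (steps t n))
    (\<lambda>E. \<Sum>k=1..T. (type_count n T k E / real n - euler (drift T) (start T) n (steps t n) k)\<^sup>2)
     \<le> exp (c1 * t) * (t * c2) / real n" if n: "0 < n" for n
  proof -
    define u where "u i = mean (evolve n {} i)
       (\<lambda>E. \<Sum>k=1..T. (type_count n T k E / real n - euler (drift T) (start T) n i k)\<^sup>2)" for i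
    define m where "m = steps t n"
    have m: "real m \<le> t * real n" using assms(2) by (simp add: m_def of_nat_nat)
    have init: "type_count n T k {} / real n = start T k" for k
    proof -
      have "{v. Suc 0 \<le> v \<and> v \<le> n} = {1..n}" by auto
      then show ?thesis using n by (auto simp: type_count_def start_def)
    qed
    have u0: "u 0 = 0" by (simp add: u_def init)
    have fin: "finite (set_pmf (evolve n {} i))" for i by (rule finite_evolve[OF n])
    have step: "u (Suc i) \<le> (1 + c1 / real n) * u i + c2 / (real n)\<^sup>2" for i
    proof -
      have "u (Suc i) \<le> mean (evolve n {} i) (\<lambda>E. (1 + c1 / real n) *
         (\<Sum>k=1..T. (type_count n T k E / real n - euler (drift T) (start T) n i k)\<^sup>2) + c2 / (real n)\<^sup>2)"
        unfolding u_def euler.simps c1_def c2_def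
        by (intro mean_evolve_step_le[OF n graph_on_empty] step_variance n assms)
      then show ?thesis by (simp add: mean_add[OF fin] u_def)
    qed
    have "u m \<le> exp (c1 / real n * real m) * (u 0 + (\<Sum>j<m. c2 / (real n)\<^sup>2))"
      using c step u0 by (intro gronwall_sum[where m = m]) auto
    also have "\<dots> \<le> exp (c1 * t) * ((t * real n) * (c2 / (real n)\<^sup>2))"
    proof (intro mult_mono)
      have "c1 * (real m / real n) \<le> c1 * t" using m n c by (intro mult_left_mono) (auto simp: divide_le_eq)
      then show "exp (c1 / real n * real m) \<le> exp (c1 * t)" by simp
      show "u 0 + (\<Sum>j<m. c2 / (real n)\<^sup>2) \<le> (t * real n) * (c2 / (real n)\<^sup>2)"
        using mult_right_mono[OF m, of "c2 / (real n)\<^sup>2"] c u0 by simp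
    qed (use c u0 in auto)
    also have "\<dots> = exp (c1 * t) * (t * c2) / real n" using n by (simp add: power2_eq_square)
    finally show ?thesis by (simp add: u_def m_def)
  qed
  then show ?thesis by blast
qed

lemma tail_eq_count:
  assumes "k \<le> T"
  shows "tail n k E = (\<Sum>c=k..T. type_count n T c E / real n)"
proof -
  have "real (card {v \<in> {1..n}. k \<le> csize E v}) = (\<Sum>c=k..T. type_count n T c E)"
    unfolding type_count_def card_Collect_sum
  proof (subst sum.swap, intro sum.cong refl)
    fix v
    show "of_bool (k \<le> csize E v) = (\<Sum>c=k..T. of_bool (capped_size T E v = c) :: real)"
      using assms by (auto simp: of_bool_def)
  qed
  then show ?thesis by (simp add: tail_def sum_divide_distrib)
qed

text \<open>
  With the cap \<open>T \<ge> k\<close> the tail is a sum of fractions of types, each of which is close in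
  mean square to an Euler scheme that converges as \<open>n\<close> tends to infinity.
\<close>

theorem tail_concentration:
  assumes "0 \<le> t"
  shows "\<exists>x. (\<lambda>n. mean (evolve n {} (steps t n)) (\<lambda>E. (tail n k E - x)\<^sup>2)) \<longlonglongrightarrow> 0"
proof (cases "k = 0")
  case True
  have "(\<lambda>n. mean (evolve n {} (steps t n)) (\<lambda>E. (tail n k E - 1)\<^sup>2)) \<longlonglongrightarrow> 0"
  proof (rule tendsto_eventually, rule eventually_sequentiallyI)
    fix n :: nat assume "1 \<le> n"
    moreover have "{v. Suc 0 \<le> v \<and> v \<le> n} = {1..n}" by auto
    ultimately show "mean (evolve n {} (steps t n)) (\<lambda>E. (tail n k E - 1)\<^sup>2) = 0"
      by (simp add: True tail_def)
  qed
  then show ?thesis by blast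
next
  case False
  define T where "T = max k (B + 1)"
  have T: "k \<le> T" "B + 1 \<le> T" "1 \<le> T" by (auto simp: T_def)
  define y where "y n c = euler (drift T) (start T) n (steps t n) c" for n c
  have "convergent (\<lambda>n. y n c)" if "c \<in> {1..T}" for c
    unfolding y_def
    by (rule euler_convergent[OF drift_abs drift_Lipschitz _ assms that]) (use T in auto)
  then have lim: "(\<lambda>n. y n c) \<longlonglongrightarrow> lim (\<lambda>n. y n c)" if "c \<in> {1..T}" for c
    using that convergent_LIMSEQ_iff by blast
  define x where "x = (\<Sum>c=k..T. lim (\<lambda>n. y n c))"
  obtain C where C: "\<And>n. 0 < n \<Longrightarrow> mean (evolve n {} (steps t n))
      (\<lambda>E. \<Sum>c=1..T. (type_count n T c E / real n - y n c)\<^sup>2) \<le> C / real n"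
    using evolve_variance[OF T(2) assms] unfolding y_def by blast
  have bound: "mean (evolve n {} (steps t n)) (\<lambda>E. (tail n k E - x)\<^sup>2)
      \<le> 2 * real T * (C / real n) + 2 * ((\<Sum>c=k..T. y n c) - x)\<^sup>2" if n: "0 < n" for n
  proof -
    have "mean (evolve n {} (steps t n)) (\<lambda>E. (tail n k E - x)\<^sup>2)
      \<le> mean (evolve n {} (steps t n)) (\<lambda>E. 2 * real T * (\<Sum>c=1..T. (type_count n T c E / real n - y n c)\<^sup>2)
          + 2 * ((\<Sum>c=k..T. y n c) - x)\<^sup>2)"
    proof (rule mean_mono[OF finite_evolve[OF n]])
      fix E
      let ?a = "\<Sum>c=k..T. type_count n T c E / real n - y n c" and ?b = "(\<Sum>c=k..T. y n c) - x"
      have "(tail n k E - x)\<^sup>2 = (?a + ?b)\<^sup>2"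
        by (simp add: tail_eq_count[OF T(1)] sum_subtractf)
      also have "\<dots> \<le> 2 * ?a\<^sup>2 + 2 * ?b\<^sup>2"
        by (rule square_sum_le)
      also have "?a\<^sup>2 \<le> real (card {k..T}) * (\<Sum>c=k..T. (type_count n T c E / real n - y n c)\<^sup>2)"
        using sum_squared_le_sum_of_squares[of "\<lambda>c. type_count n T c E / real n - y n c" "{k..T}"]
        by (simp add: mult.commute)
      also have "\<dots> \<le> real T * (\<Sum>c=1..T. (type_count n T c E / real n - y n c)\<^sup>2)"
        using False by (intro mult_mono sum_mono2) (auto simp: sum_nonneg)
      finally show "(tail n k E - x)\<^sup>2 \<le> 2 * real T * (\<Sum>c=1..T. (type_count n T c E / real n - y n c)\<^sup>2) + 2 * ?b\<^sup>2"
        by simp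
    qed
    also have "\<dots> = 2 * real T * mean (evolve n {} (steps t n)) (\<lambda>E. \<Sum>c=1..T. (type_count n T c E / real n - y n c)\<^sup>2)
          + 2 * ((\<Sum>c=k..T. y n c) - x)\<^sup>2"
      by (subst mean_add[OF finite_evolve[OF n]]) (simp add: mult.assoc)
    also have "\<dots> \<le> 2 * real T * (C / real n) + 2 * ((\<Sum>c=k..T. y n c) - x)\<^sup>2"
      by (intro add_right_mono mult_left_mono C n) auto
    finally show ?thesis .
  qed
  have "(\<lambda>n. 2 * real T * (C / real n) + 2 * ((\<Sum>c=k..T. y n c) - x)\<^sup>2) \<longlonglongrightarrow> 2 * real T * 0 + 2 * (x - x)\<^sup>2"
    using False unfolding x_def
    by (intro tendsto_intros lim lim_const_over_n) auto
  then have upper: "(\<lambda>n. 2 * real T * (C / real n) + 2 * ((\<Sum>c=k..T. y n c) - x)\<^sup>2) \<longlonglongrightarrow> 0"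
    by simp
  have "(\<lambda>n. mean (evolve n {} (steps t n)) (\<lambda>E. (tail n k E - x)\<^sup>2)) \<longlonglongrightarrow> 0"
  proof (rule tendsto_sandwich[OF _ _ tendsto_const upper])
    show "\<forall>\<^sub>F n in sequentially. 0 \<le> mean (evolve n {} (steps t n)) (\<lambda>E. (tail n k E - x)\<^sup>2)"
      by (intro always_eventually allI mean_nonneg) simp
    show "\<forall>\<^sub>F n in sequentially. mean (evolve n {} (steps t n)) (\<lambda>E. (tail n k E - x)\<^sup>2)
        \<le> 2 * real T * (C / real n) + 2 * ((\<Sum>c=k..T. y n c) - x)\<^sup>2"
      by (intro eventually_sequentiallyI[of 1] bound) simp
  qed
  then show ?thesis by blast
qed

end

section \<open>No susceptibility hidden in large components\<close>

lemma sum_UN_le: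
  fixes h :: "'a \<Rightarrow> real"
  assumes "finite I" "\<And>i. i \<in> I \<Longrightarrow> finite (A i)" "\<And>x. 0 \<le> h x"
  shows "sum h (\<Union>i\<in>I. A i) \<le> (\<Sum>i\<in>I. sum h (A i))"
  using assms(1,2)
proof (induction rule: finite_induct)
  case (insert i I)
  have "sum h (A i \<union> (\<Union>i\<in>I. A i)) \<le> sum h (A i) + sum h (\<Union>i\<in>I. A i)"
    using insert.prems insert.hyps(1) assms(3)
    by (subst sum.union_inter[symmetric]) (auto simp: sum_nonneg)
  then show ?case using insert by simp
qed simp

text \<open>
  If the sum exceeds \<open>K\<close>, then its largest term \<open>c m\<close> is at least \<open>K / l\<close>, and each product
  \<open>c i * c j\<close> is bounded by the product of \<open>c m\<close> and one of its two factors, with an index other than \<open>m\<close>.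
\<close>

lemma sum_off_diagonal:
  fixes c :: "nat \<Rightarrow> real"
  assumes "\<And>i. i < l \<Longrightarrow> 0 \<le> c i"
  shows "of_bool (K < (\<Sum>i<l. c i)) * (\<Sum>i<l. \<Sum>j\<in>{..<l} - {i}. c i * c j)
    \<le> (real l)\<^sup>2 * (\<Sum>i<l. \<Sum>j\<in>{..<l} - {i}. c i * of_bool (K \<le> real l * c i) * c j)"
    (is "?lhs \<le> _ * ?G")
proof -
  have G0: "0 \<le> (\<Sum>j\<in>{..<l} - {i}. c i * of_bool (K \<le> real l * c i) * c j)" if "i < l" for i
    using assms that by (intro sum_nonneg) auto
  show ?thesis
  proof (cases "K < (\<Sum>i<l. c i) \<and> 0 < l")
    case False
    then have "?lhs = 0" by auto
    moreover have "0 \<le> ?G" by (rule sum_nonneg) (use G0 in auto)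
    then have "0 \<le> (real l)\<^sup>2 * ?G" by (rule mult_nonneg_nonneg[OF zero_le_power2])
    ultimately show ?thesis by linarith
  next
    case True
    have "Max (c ` {..<l}) \<in> c ` {..<l}" using True by (intro Max_in) auto
    then obtain m where m: "m < l" "c m = Max (c ` {..<l})" by auto
    have max: "c i \<le> c m" if "i < l" for i using that m by (auto intro: Max_ge)
    have "(\<Sum>i<l. c i) \<le> (\<Sum>i<l. c m)" by (intro sum_mono max) auto
    \<comment> \<open>the largest term is at least the average\<close>
    then have Km: "K \<le> real l * c m" using True by simp
    have entry: "c i * c j \<le> ?G" if ij: "i < l" "j < l" "i \<noteq> j" for i j
    proof -
      define k where "k = (if j = m then i else j)"
      have k: "k < l" "k \<noteq> m" using ij by (auto simp: k_def)
      have "c i * c j \<le> c m * c k"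
      proof (cases "j = m")
        case True then show ?thesis by (simp add: k_def)
      next
        case False
        then show ?thesis using mult_right_mono[OF max[OF ij(1)] assms[OF ij(2)]] by (simp add: k_def)
      qed
      also have "\<dots> \<le> (\<Sum>j\<in>{..<l} - {m}. c m * of_bool (K \<le> real l * c m) * c j)"
        using member_le_sum[of k "{..<l} - {m}" "\<lambda>j. c m * of_bool (K \<le> real l * c m) * c j"] k m(1) Km mult_nonneg_nonneg[OF assms[OF m(1)] assms]
        by simp
      also have "\<dots> \<le> ?G"
        using member_le_sum[of m "{..<l}" "\<lambda>i. \<Sum>j\<in>{..<l} - {i}. c i * of_bool (K \<le> real l * c i) * c j"] m(1) G0
        by simp
      finally show ?thesis .
    qed
    have G: "0 \<le> ?G" using G0 by (auto intro: sum_nonneg)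
    have "(\<Sum>i<l. \<Sum>j\<in>{..<l} - {i}. c i * c j) \<le> (\<Sum>i<l. \<Sum>j\<in>{..<l} - {i}. ?G)"
      by (intro sum_mono entry) auto
    also have "\<dots> \<le> (\<Sum>i<l. \<Sum>j<l. ?G)" using G by (intro sum_mono sum_mono2) auto
    also have "\<dots> = (real l)\<^sup>2 * ?G" by (simp add: power2_eq_square)
    finally show ?thesis using True by simp
  qed
qed

context sized_rule
begin

text \<open>
  A vertex in the component of the \<open>i\<close>-th chosen vertex ends up in a component with at most
  \<open>(\<Sum>j<ell. c j)\<close> vertices, so its excess grows by at most the sum of the \<open>c j\<close> with \<open>j \<noteq> i\<close>,
  and not at all if the whole sum is at most \<open>K\<close>. Overlaps of components only help.
\<close>

lemma excess_step:
  assumes g: "graph_on n E" "vs \<in> draws n" and n: "0 < n"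
  defines "c \<equiv> \<lambda>j. real (csize E (vs ! j))"
  shows "real n * (excess n K (add_edges R E vs) - excess n K E)
    \<le> of_bool (real K < (\<Sum>j<ell. c j)) * (\<Sum>i<ell. \<Sum>j\<in>{..<ell} - {i}. c i * c j)"
proof -
  let ?E' = "add_edges R E vs"
  define s where "s = (\<Sum>j<ell. csize E (vs ! j))"
  have s: "real s = (\<Sum>j<ell. c j)" by (simp add: s_def c_def)
  have len: "length vs = ell" using g(2) by (simp add: draws_def)
  have tch: "touched E vs = (\<Union>j<ell. component E (vs ! j))"
    using len unfolding touched_def by (fastforce simp: in_set_conv_nth)
  define h where "h v = of_bool (K < s) * max 0 (real s - real (csize E v))" for v
  have diff: "real (csize ?E' v - K) - real (csize E v - K) \<le> h v" if "v \<in> touched E vs" for v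
  proof -
    have "csize ?E' v \<le> card (touched E vs)"
      using component_touched[OF g that] finite_touched(1)[OF g] by (intro card_mono)
    also have "\<dots> \<le> s" unfolding s_def by (rule card_touched_le[OF g])
    finally show ?thesis by (auto simp: h_def)
  qed
  have "real n * (excess n K ?E' - excess n K E)
      = (\<Sum>v=1..n. real (csize ?E' v - K) - real (csize E v - K))"
    using n by (simp add: excess_def sum_subtractf right_diff_distrib)
  also have "\<dots> = (\<Sum>v\<in>touched E vs. real (csize ?E' v - K) - real (csize E v - K))"
    using finite_touched(2)[OF g] component_untouched[OF g] by (intro sum.mono_neutral_right) auto
  also have "\<dots> \<le> sum h (touched E vs)" by (intro sum_mono diff)
  also have "\<dots> \<le> (\<Sum>i<ell. sum h (component E (vs ! i)))"
    unfolding tch using finite_component[OF g(1) draws_nth[OF g(2)]]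
    by (intro sum_UN_le) (auto simp: h_def)
  also have "\<dots> = (\<Sum>i<ell. of_bool (K < s) * (\<Sum>j\<in>{..<ell} - {i}. c i * c j))"
  proof (intro sum.cong refl)
    fix i assume i: "i \<in> {..<ell}"
    have rest: "real s - c i = (\<Sum>j\<in>{..<ell} - {i}. c j)" using i by (simp add: s sum_diff1)
    then have nn: "0 \<le> real s - c i" by (simp add: c_def sum_nonneg)
    have "sum h (component E (vs ! i)) = (\<Sum>v\<in>component E (vs ! i). of_bool (K < s) * (real s - c i))"
    proof (intro sum.cong refl)
      fix v assume "v \<in> component E (vs ! i)"
      then have "csize E v = csize E (vs ! i)" using component_eq by simp
      then show "h v = of_bool (K < s) * (real s - c i)" using nn by (simp add: h_def c_def)
    qed
    also have "\<dots> = c i * (of_bool (K < s) * (real s - c i))" by (simp add: c_def)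
    finally show "sum h (component E (vs ! i)) = of_bool (K < s) * (\<Sum>j\<in>{..<ell} - {i}. c i * c j)"
      unfolding rest by (simp add: sum_distrib_left mult_ac)
  qed
  finally show ?thesis by (simp add: s[symmetric] sum_distrib_left)
qed

text \<open>
  By \<open>sum_off_diagonal\<close> one of the two merged components has size at least \<open>2 * L\<close>, and a size
  \<open>c \<ge> 2 * L\<close> is at most \<open>2 * (c - L)\<close>, twice its contribution to the excess over \<open>L\<close>.
\<close>

lemma mean_excess_step:
  assumes n: "0 < n" and E: "graph_on n E" and L: "0 < L"
  shows "mean (draw n) (\<lambda>vs. excess n (2 * ell * L) (add_edges R E vs))
    \<le> excess n (2 * ell * L) E + 2 * real ell ^ 4 / real n * (sus n E * excess n L E)"
proof -
  let ?K = "2 * ell * L"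
  note fin = finite_draw[OF n]
  define f where "f v = real (csize E v)" for v
  define b where "b v = f v * of_bool (real ?K \<le> real ell * f v)" for v
  have bsum: "(\<Sum>v=1..n. b v) \<le> 2 * real n * excess n L E"
  proof -
    have "b v \<le> 2 * real (csize E v - L)" for v
    proof (cases "real ?K \<le> real ell * f v")
      case True
      then have "real ell * (2 * real L) \<le> real ell * f v" by (simp add: mult_ac)
      then have "2 * real L \<le> f v" using ell2 by simp
      then show ?thesis by (simp add: b_def f_def of_nat_diff)
    qed (simp add: b_def)
    then have "(\<Sum>v=1..n. b v) \<le> (\<Sum>v=1..n. 2 * real (csize E v - L))" by (intro sum_mono)
    then show ?thesis using n by (simp add: excess_def flip: sum_distrib_left)
  qed
  have "mean (draw n) (\<lambda>vs. real n * (excess n ?K (add_edges R E vs) - excess n ?K E))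
     \<le> mean (draw n) (\<lambda>vs. (real ell)\<^sup>2 * (\<Sum>i<ell. \<Sum>j\<in>{..<ell} - {i}. b (vs ! i) * f (vs ! j)))"
  proof (rule mean_mono[OF fin])
    fix vs assume "vs \<in> set_pmf (draw n)"
    then have vs: "vs \<in> draws n" using set_draw[OF n] by simp
    show "real n * (excess n ?K (add_edges R E vs) - excess n ?K E)
       \<le> (real ell)\<^sup>2 * (\<Sum>i<ell. \<Sum>j\<in>{..<ell} - {i}. b (vs ! i) * f (vs ! j))"
      using excess_step[OF E vs n, of ?K]
        sum_off_diagonal[of ell "\<lambda>j. real (csize E (vs ! j))" "real ?K"]
      by (simp add: b_def f_def)
  qed
  also have "\<dots> = (real ell)\<^sup>2 * (\<Sum>i<ell. \<Sum>j\<in>{..<ell} - {i}. mean (draw n) (\<lambda>vs. b (vs ! i) * f (vs ! j)))"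
    by (simp add: mean_sum[OF fin])
  also have "\<dots> = (real ell)\<^sup>2 * (\<Sum>i<ell. \<Sum>j\<in>{..<ell} - {i}. (\<Sum>v=1..n. b v) / real n * sus n E)"
  proof (intro arg_cong2[where f = "(*)"] sum.cong refl)
    fix i j assume ij: "i \<in> {..<ell}" "j \<in> {..<ell} - {i}"
    have "mean (draw n) (\<lambda>vs. b (vs ! i) * f (vs ! j)) = (\<Sum>u=1..n. \<Sum>w=1..n. b u * f w) / (real n)\<^sup>2"
      using ij by (intro mean_draw_pair n) auto
    then show "mean (draw n) (\<lambda>vs. b (vs ! i) * f (vs ! j)) = (\<Sum>v=1..n. b v) / real n * sus n E"
      by (simp add: sum_product[symmetric] sus_def f_def power2_eq_square)
  qed
  also have "\<dots> \<le> (real ell)\<^sup>2 * (\<Sum>i<ell. \<Sum>j\<in>{..<ell} - {i}. 2 * excess n L E * sus n E)"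
    using bsum n by (intro mult_left_mono sum_mono mult_right_mono) (auto simp: divide_le_eq mult_ac sus_def sum_nonneg)
  also have "\<dots> \<le> (real ell)\<^sup>2 * (\<Sum>i<ell. \<Sum>j<ell. 2 * excess n L E * sus n E)"
    using excess_nonneg[of n L E] by (intro mult_left_mono sum_mono sum_mono2) (auto simp: sus_def sum_nonneg)
  also have "\<dots> = 2 * real ell ^ 4 * (sus n E * excess n L E)"
    by (simp add: power4_eq_xxxx power2_eq_square)
  finally have "mean (draw n) (\<lambda>vs. real n * (excess n ?K (add_edges R E vs) - excess n ?K E))
      \<le> 2 * real ell ^ 4 * (sus n E * excess n L E)" .
  then have "real n * (mean (draw n) (\<lambda>vs. excess n ?K (add_edges R E vs)) - excess n ?K E)
      \<le> 2 * real ell ^ 4 * (sus n E * excess n L E)"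
    by (simp add: mean_diff[OF fin])
  then show ?thesis using n by (simp add: field_simps)
qed

text \<open>
  While the excess is below 1, the susceptibility is at most \<open>trunc_sus n K E + 1\<close>. Capping the excess
  at 1 stops the process at the moment when this fails. The last term accounts, with a crude bound,
  for the unlikely graphs whose truncated susceptibility exceeds \<open>M\<close>.
\<close>

lemma mean_capped_excess_step:
  assumes n: "0 < n" and E: "graph_on n E" and L: "0 < L" and M: "0 \<le> M"
  defines "K \<equiv> 2 * ell * L"
  shows "mean (draw n) (\<lambda>vs. min 1 (excess n K (add_edges R E vs)))
    \<le> min 1 (excess n K E) + 2 * real ell ^ 4 / real n *
      ((M + 1) * (min 1 (excess n K E) + (trunc_sus n K E - trunc_sus n L E)) + (real K + 1)\<^sup>2 * of_bool (M < trunc_sus n K E))"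
proof -
  let ?x = "excess n K E"
  note fin = finite_draw[OF n]
  have LK: "L \<le> K" using ell2 by (simp add: K_def)
  have dt: "0 \<le> trunc_sus n K E - trunc_sus n L E"
    unfolding trunc_sus_def using LK by (simp add: divide_right_mono sum_mono)
  have x0: "0 \<le> ?x" by (rule excess_nonneg)
  show ?thesis
  proof (cases "?x < 1")
    case False
    have "mean (draw n) (\<lambda>vs. min 1 (excess n K (add_edges R E vs))) \<le> mean (draw n) (\<lambda>vs. 1)"
      by (intro mean_mono fin) auto
    also have "\<dots> = min 1 ?x" using False by simp
    also have "\<dots> \<le> min 1 ?x + 2 * real ell ^ 4 / real n *
      ((M + 1) * (min 1 ?x + (trunc_sus n K E - trunc_sus n L E)) + (real K + 1)\<^sup>2 * of_bool (M < trunc_sus n K E))"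
      using M dt x0 by simp
    finally show ?thesis .
  next
    case True
    have eL: "excess n L E = ?x + (trunc_sus n K E - trunc_sus n L E)"
      using sus_split[of n E K] sus_split[of n E L] by simp
    have sus: "sus n E \<le> trunc_sus n K E + 1" using sus_split[of n E K] True by simp
    have prod: "sus n E * excess n L E \<le> (M + 1) * (min 1 ?x + (trunc_sus n K E - trunc_sus n L E)) + (real K + 1)\<^sup>2 * of_bool (M < trunc_sus n K E)"
    proof (cases "M < trunc_sus n K E")
      case True
      have "sus n E * excess n L E \<le> (real K + 1) * (real K + 1)"
        using sus trunc_sus_bounds[of n K E] trunc_sus_bounds[of n L E] \<open>?x < 1\<close> excess_nonneg[of n L E]
        by (intro mult_mono) (auto simp: eL)
      also have "\<dots> \<le> (M + 1) * (min 1 ?x + (trunc_sus n K E - trunc_sus n L E)) + (real K + 1)\<^sup>2"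
        using M dt x0 by (simp add: power2_eq_square)
      finally show ?thesis using True by simp
    next
      case False
      then have "sus n E * excess n L E \<le> (M + 1) * (min 1 ?x + (trunc_sus n K E - trunc_sus n L E))"
        using sus excess_nonneg[of n L E] \<open>?x < 1\<close> M by (intro mult_mono) (auto simp: eL)
      then show ?thesis using False by simp
    qed
    have "mean (draw n) (\<lambda>vs. min 1 (excess n K (add_edges R E vs))) \<le> mean (draw n) (\<lambda>vs. excess n K (add_edges R E vs))"
      by (intro mean_mono fin) auto
    also have "\<dots> \<le> ?x + 2 * real ell ^ 4 / real n * (sus n E * excess n L E)"
      unfolding K_def by (rule mean_excess_step[OF n E L])
    also have "\<dots> \<le> min 1 ?x + 2 * real ell ^ 4 / real n *
      ((M + 1) * (min 1 ?x + (trunc_sus n K E - trunc_sus n L E)) + (real K + 1)\<^sup>2 * of_bool (M < trunc_sus n K E))"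
      using True by (intro add_mono mult_left_mono prod) auto
    finally show ?thesis .
  qed
qed

lemma trunc_sus_mono_cap: "L \<le> K \<Longrightarrow> trunc_sus n L E \<le> trunc_sus n K E"
  unfolding trunc_sus_def by (intro divide_right_mono sum_mono) auto

lemma mean_capped_excess:
  assumes n: "0 < n" and L: "0 < L" and M: "0 \<le> M" and m: "real m \<le> t * real n"
  defines "K \<equiv> 2 * ell * L" and "C \<equiv> 2 * real ell ^ 4"
  shows "mean (evolve n {} m) (\<lambda>E. min 1 (excess n K E)) \<le> exp (C * (M + 1) * t) *
    (C * (M + 1) * ((\<Sum>i<m. mean (evolve n {} i) (\<lambda>E. trunc_sus n K E - trunc_sus n L E)) / real n)
      + C * t * (real K + 1)\<^sup>2 * prob_at n m (\<lambda>E. M < trunc_sus n K E))"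
proof -
  define u where "u i = mean (evolve n {} i) (\<lambda>E. min 1 (excess n K E))" for i
  define d where "d i = mean (evolve n {} i) (\<lambda>E. trunc_sus n K E - trunc_sus n L E)" for i
  define p where "p = prob_at n m (\<lambda>E. M < trunc_sus n K E)"
  define b where "b i = C / real n * ((M + 1) * d i + (real K + 1)\<^sup>2 * p)" for i
  have fin: "finite (set_pmf (evolve n {} i))" for i by (rule finite_evolve[OF n])
  have LK: "L \<le> K" using ell2 by (simp add: K_def)
  have C: "0 \<le> C" by (simp add: C_def)
  have p0: "0 \<le> p" by (simp add: p_def)
  have d0: "0 \<le> d i" for i unfolding d_def using trunc_sus_mono_cap[OF LK] by (intro mean_nonneg) auto
  have b0: "0 \<le> b i" for i using C M d0 p0 by (simp add: b_def)
  have K1: "1 \<le> K" using LK L by simp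
  have u0: "u 0 = 0" using K1 by (simp add: u_def excess_def)
  have step: "u (Suc i) \<le> (1 + C * (M + 1) / real n) * u i + b i" if i: "i < m" for i
  proof -
    have "u (Suc i) \<le> mean (evolve n {} i) (\<lambda>E. min 1 (excess n K E) + C / real n *
        ((M + 1) * (min 1 (excess n K E) + (trunc_sus n K E - trunc_sus n L E)) + (real K + 1)\<^sup>2 * of_bool (M < trunc_sus n K E)))"
      unfolding u_def K_def C_def
      by (intro mean_evolve_step_le[OF n graph_on_empty] mean_capped_excess_step n L M)
    also have "\<dots> = u i + C / real n * ((M + 1) * (u i + d i) + (real K + 1)\<^sup>2 * prob_at n i (\<lambda>E. M < trunc_sus n K E))"
      by (simp add: mean_add[OF fin] u_def d_def prob_eq_mean)
    also have "\<dots> \<le> u i + C / real n * ((M + 1) * (u i + d i) + (real K + 1)\<^sup>2 * p)"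
      unfolding p_def using i C trunc_sus_mono
      by (intro add_left_mono mult_left_mono prob_at_mono n) (auto intro: less_le_trans)
    also have "\<dots> = (1 + C * (M + 1) / real n) * u i + b i"
      by (simp add: b_def algebra_simps add_divide_distrib)
    finally show ?thesis .
  qed
  have t0: "0 \<le> t" using m n by (metis of_nat_0_le_iff of_nat_0_less_iff order_trans zero_le_mult_iff not_le)
  have "u m \<le> exp (C * (M + 1) / real n * real m) * (u 0 + (\<Sum>j<m. b j))"
    using C M b0 step u0 by (intro gronwall_sum[where m = m]) auto
  also have "\<dots> \<le> exp (C * (M + 1) * t) * (C * (M + 1) * ((\<Sum>i<m. d i) / real n) + C * t * (real K + 1)\<^sup>2 * p)"
  proof (intro mult_mono)
    have "C * (M + 1) * (real m / real n) \<le> C * (M + 1) * t"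
      using m n C M by (intro mult_left_mono) (auto simp: divide_le_eq)
    then show "exp (C * (M + 1) / real n * real m) \<le> exp (C * (M + 1) * t)" by simp
    have "(\<Sum>j<m. b j) = C / real n * ((M + 1) * (\<Sum>j<m. d j)) + (real m / real n) * (C * ((real K + 1)\<^sup>2 * p))"
      by (simp add: b_def sum_distrib_left sum.distrib distrib_left sum_divide_distrib)
    also have "\<dots> \<le> C / real n * ((M + 1) * (\<Sum>j<m. d j)) + t * (C * ((real K + 1)\<^sup>2 * p))"
      using m n C p0 by (intro add_left_mono mult_right_mono) (auto simp: divide_le_eq)
    finally show "u 0 + (\<Sum>j<m. b j) \<le> C * (M + 1) * ((\<Sum>i<m. d i) / real n) + C * t * (real K + 1)\<^sup>2 * p"
      by (simp add: u0 mult_ac)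
  qed (use b0 u0 in \<open>auto simp: sum_nonneg\<close>)
  finally show ?thesis by (simp add: u_def d_def p_def)
qed

text \<open>
  For each \<open>n\<close> a pigeonhole argument over the levels \<open>(2 * ell) ^ j\<close>, \<open>j < J\<close>, finds one range of
  levels whose share of the truncated susceptibility, averaged over time, is \<open>O(1/J)\<close>. The range
  may depend on \<open>n\<close>, since the final event does not mention it. Markov's inequality for the capped
  excess then bounds the limit superior of the probability by \<open>O(1/J)\<close> for every \<open>J\<close>.
\<close>

theorem susceptibility_tight:
  assumes t: "0 \<le> t" and M: "0 \<le> M"
    and conv: "\<And>K. (\<lambda>n. prob_at n (steps t n) (\<lambda>E. M < trunc_sus n K E)) \<longlonglongrightarrow> 0"
  shows "(\<lambda>n. prob_at n (steps t n) (\<lambda>E. M + 1 < sus n E)) \<longlonglongrightarrow> 0"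
proof -
  define C where "C = 2 * real ell ^ 4"
  define X where "X = exp (C * (M + 1) * t)"
  define K where "K j = (2 * ell) ^ j" for j
  define \<pi> where "\<pi> j n = prob_at n (steps t n) (\<lambda>E. M < trunc_sus n (K j) E)" for j n
  have C: "0 \<le> C" and X: "0 \<le> X" by (simp_all add: C_def X_def)
  have Kmono: "K i \<le> K j" if "i \<le> j" for i j unfolding K_def using ell2 that by (intro power_increasing) auto
  have Kpos: "0 < K j" for j using ell2 by (simp add: K_def)
  define U where "U J n = \<pi> J n + X * (C * (M + 1) * (t * (M + real (K J) * \<pi> J n) / real J) + C * t * (real (K J) + 1)\<^sup>2 * \<pi> J n)" for J n
  have bound: "prob_at n (steps t n) (\<lambda>E. M + 1 < sus n E) \<le> U J n"
    if n: "0 < n" and J: "0 < J" for n J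
  proof -
    define m where "m = steps t n"
    have m: "real m \<le> t * real n" using t by (simp add: m_def of_nat_nat)
    have fin: "finite (set_pmf (evolve n {} i))" for i by (rule finite_evolve[OF n])
    have \<pi>0: "0 \<le> \<pi> j n" for j by (simp add: \<pi>_def)
    have \<pi>mono: "\<pi> i n \<le> \<pi> j n" if "i \<le> j" for i j
      unfolding \<pi>_def using trunc_sus_mono_cap[OF Kmono[OF that]] by (intro prob_mono) (auto intro: less_le_trans)
    define s where "s j = (\<Sum>i<m. mean (evolve n {} i) (\<lambda>E. trunc_sus n (K (Suc j)) E - trunc_sus n (K j) E)) / real n" for j
    have mean_trunc_sus: "mean (evolve n {} i) (trunc_sus n (K J)) \<le> M + real (K J) * \<pi> J n" if "i < m" for i
    proof -
      have "mean (evolve n {} i) (trunc_sus n (K J)) \<le> mean (evolve n {} m) (trunc_sus n (K J))"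
        using that by (intro mean_evolve_mono[OF n graph_on_empty] trunc_sus_mono) auto
      also have "\<dots> \<le> mean (evolve n {} m) (\<lambda>E. M + real (K J) * of_bool (M < trunc_sus n (K J) E))"
      proof (intro mean_mono[OF fin])
        fix E
        show "trunc_sus n (K J) E \<le> M + real (K J) * of_bool (M < trunc_sus n (K J) E)"
          using trunc_sus_bounds[of n "K J" E] M by (cases "M < trunc_sus n (K J) E") auto
      qed
      also have "\<dots> = M + real (K J) * \<pi> J n"
        by (simp add: mean_add[OF fin] \<pi>_def prob_eq_mean m_def)
      finally show ?thesis .
    qed
    have "(\<Sum>j<J. s j) = (\<Sum>i<m. mean (evolve n {} i) (\<lambda>E. \<Sum>j<J. trunc_sus n (K (Suc j)) E - trunc_sus n (K j) E)) / real n"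
      unfolding s_def sum_divide_distrib[symmetric] mean_sum[OF fin] by (subst sum.swap) simp
    also have "\<dots> \<le> (\<Sum>i<m. M + real (K J) * \<pi> J n) / real n"
    proof (intro divide_right_mono sum_mono)
      have tele: "(\<Sum>j<J. trunc_sus n (K (Suc j)) E - trunc_sus n (K j) E) = trunc_sus n (K J) E - trunc_sus n (K 0) E" for E
        using sum_lessThan_telescope[of "\<lambda>j. trunc_sus n (K j) E" J] .
      fix i assume "i \<in> {..<m}"
      have "mean (evolve n {} i) (\<lambda>E. \<Sum>j<J. trunc_sus n (K (Suc j)) E - trunc_sus n (K j) E) \<le> mean (evolve n {} i) (trunc_sus n (K J))"
        unfolding tele using trunc_sus_bounds by (intro mean_mono[OF fin]) auto
      also have "\<dots> \<le> M + real (K J) * \<pi> J n" using mean_trunc_sus \<open>i \<in> {..<m}\<close> by simp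
      finally show "mean (evolve n {} i) (\<lambda>E. \<Sum>j<J. trunc_sus n (K (Suc j)) E - trunc_sus n (K j) E) \<le> M + real (K J) * \<pi> J n" .
    qed simp
    also have "\<dots> = (real m / real n) * (M + real (K J) * \<pi> J n)" by simp
    also have "\<dots> \<le> t * (M + real (K J) * \<pi> J n)"
      using m n M \<pi>0 by (intro mult_right_mono) (auto simp: divide_le_eq)
    finally have total: "(\<Sum>j<J. s j) \<le> t * (M + real (K J) * \<pi> J n)" .
    \<comment> \<open>the ranges between consecutive levels are disjoint, so the average of their shares is small\<close>
    have "\<exists>j<J. s j \<le> t * (M + real (K J) * \<pi> J n) / real J"
    proof (rule ccontr)
      assume "\<not> ?thesis"
      then have "(\<Sum>j<J. t * (M + real (K J) * \<pi> J n) / real J) < (\<Sum>j<J. s j)"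
        using J by (intro sum_strict_mono) auto
      then show False using total J by simp
    qed
    then obtain j where j: "j < J" "s j \<le> t * (M + real (K J) * \<pi> J n) / real J" by blast
    have "prob_at n m (\<lambda>E. M + 1 < sus n E) \<le> mean (evolve n {} m)
        (\<lambda>E. of_bool (M < trunc_sus n (K (Suc j)) E) + min 1 (excess n (K (Suc j)) E))"
      unfolding prob_eq_mean
    proof (rule mean_mono[OF fin])
      fix E
      show "of_bool (M + 1 < sus n E) \<le> of_bool (M < trunc_sus n (K (Suc j)) E) + min 1 (excess n (K (Suc j)) E)"
        using sus_split[of n E "K (Suc j)"] excess_nonneg[of n "K (Suc j)" E] by (auto simp: of_bool_def)
    qed
    also have "\<dots> = \<pi> (Suc j) n + mean (evolve n {} m) (\<lambda>E. min 1 (excess n (K (Suc j)) E))"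
      by (simp add: mean_add[OF fin] \<pi>_def prob_eq_mean m_def)
    also have "mean (evolve n {} m) (\<lambda>E. min 1 (excess n (K (Suc j)) E)) \<le> X * (C * (M + 1) * s j + C * t * (real (K (Suc j)) + 1)\<^sup>2 * \<pi> (Suc j) n)"
      using mean_capped_excess[OF n Kpos[of j] M m]
      by (simp add: X_def C_def s_def \<pi>_def m_def K_def mult.assoc)
    also have "\<dots> \<le> X * (C * (M + 1) * (t * (M + real (K J) * \<pi> J n) / real J) + C * t * (real (K J) + 1)\<^sup>2 * \<pi> J n)"
      using j X C M t Kmono[of "Suc j" J] \<pi>mono[of "Suc j" J] \<pi>0
      by (intro mult_left_mono add_mono mult_mono power_mono) auto
    also have "\<pi> (Suc j) n \<le> \<pi> J n" using j by (intro \<pi>mono) simp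
    finally show ?thesis by (simp add: m_def U_def)
  qed
  show ?thesis
  proof (rule LIMSEQ_I)
    fix \<epsilon> :: real assume \<epsilon>: "0 < \<epsilon>"
    define A where "A = X * (C * (M + 1) * (t * M))"
    obtain J :: nat where J: "2 * A / \<epsilon> < real J" "0 < J"
      using reals_Archimedean2[of "max 0 (2 * A / \<epsilon>)"] by (metis max_less_iff_conj of_nat_0_less_iff)
    have "U J \<longlonglongrightarrow> 0 + X * (C * (M + 1) * (t * (M + real (K J) * 0) / real J) + C * t * (real (K J) + 1)\<^sup>2 * 0)"
      unfolding U_def[abs_def] \<pi>_def using J by (intro tendsto_intros conv) auto
    then have lim: "U J \<longlonglongrightarrow> A / real J" by (simp add: A_def)
    have "0 \<le> A" using X C M t by (simp add: A_def)
    moreover have "2 * A < \<epsilon> * real J" using J \<epsilon> by (simp add: field_simps)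
    ultimately have "A < \<epsilon> * real J" by linarith
    then have "A / real J < \<epsilon>" using J by (simp add: field_simps)
    then have "\<forall>\<^sub>F n in sequentially. U J n < \<epsilon>" using order_tendstoD(2)[OF lim] by blast
    then have "\<forall>\<^sub>F n in sequentially. prob_at n (steps t n) (\<lambda>E. M + 1 < sus n E) < \<epsilon>"
      using eventually_gt_at_top[of 0]
    proof eventually_elim
      case (elim n)
      then show ?case using bound[OF _ J(2), of n] by linarith
    qed
    then show "\<exists>N. \<forall>n\<ge>N. norm (prob_at n (steps t n) (\<lambda>E. M + 1 < sus n E) - 0) < \<epsilon>"
      by (simp add: eventually_sequentially)
  qed
qed

end

section \<open>Sublinear components force t to be at most 1\<close>

context sized_rule
begin

text \<open>
  This is the number of components, as a component of size \<open>c\<close> has \<open>c\<close> vertices contributing \<open>1 / c\<close> each.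
\<close>

definition inv_sum :: "nat \<Rightarrow> nat set set \<Rightarrow> real" where
  "inv_sum n E = (\<Sum>v=1..n. 1 / real (csize E v))"

lemma inv_csize_antimono:
  assumes "E \<subseteq> E'" "graph_on n E" "graph_on n E'" "v \<in> {1..n}"
  shows "1 / real (csize E' v) \<le> 1 / real (csize E v)"
  using csize_mono[OF assms(1,3,4)] csize_pos[OF assms(2,4)] by (intro frac_le) auto

text \<open>
  If no two chosen vertices share a component, then any selected pair merges two components.
  Otherwise the sum on the right is at least 1 and compensates for the missing merger.
\<close>

lemma inv_sum_step:
  assumes g: "graph_on n E" "vs \<in> draws n"
  shows "inv_sum n (add_edges R E vs) \<le> inv_sum n E - 1
    + (\<Sum>i<ell. \<Sum>j\<in>{..<ell} - {i}. of_bool (vs ! j \<in> component E (vs ! i)))"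
    (is "_ \<le> _ + ?G")
proof -
  let ?E' = "add_edges R E vs"
  note g' = graph_on_add_edges[OF g]
  note anti = inv_csize_antimono[OF add_edges_supset g(1) g']
  have G0: "0 \<le> ?G" by (intro sum_nonneg) auto
  show ?thesis
  proof (cases "\<exists>i<ell. \<exists>j<ell. i \<noteq> j \<and> vs ! j \<in> component E (vs ! i)")
    case True
    then obtain i j where ij: "i < ell" "j < ell" "i \<noteq> j" "vs ! j \<in> component E (vs ! i)" by blast
    have "1 \<le> (\<Sum>j\<in>{..<ell} - {i}. of_bool (vs ! j \<in> component E (vs ! i)) :: real)"
      using member_le_sum[of j "{..<ell} - {i}" "\<lambda>j. of_bool (vs ! j \<in> component E (vs ! i)) :: real"] ij by simp
    also have "\<dots> \<le> ?G"
      using member_le_sum[of i "{..<ell}" "\<lambda>i. \<Sum>j\<in>{..<ell} - {i}. of_bool (vs ! j \<in> component E (vs ! i)) :: real"] ij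
      by (simp add: sum_nonneg)
    finally have "1 \<le> ?G" .
    moreover have "inv_sum n ?E' \<le> inv_sum n E" unfolding inv_sum_def by (intro sum_mono anti)
    ultimately show ?thesis by linarith
  next
    case False
    obtain a b where ab: "{a, b} \<in> pairs E vs" "a < ell" "b < ell" "a \<noteq> b"
      using pairs_wf[OF g] by blast
    define A where "A = component E (vs ! a)"
    define D where "D = component E (vs ! b)"
    have va: "vs ! a \<in> {1..n}" "vs ! b \<in> {1..n}" using draws_nth[OF g(2)] ab by auto
    have sub: "A \<subseteq> {1..n}" "D \<subseteq> {1..n}" using component_subset[OF g(1)] va by (auto simp: A_def D_def)
    then have fin: "finite A" "finite D" by (auto intro: finite_subset)
    have disj: "A \<inter> D = {}"
    proof -
      have "vs ! b \<in> component E (vs ! a)" if "w \<in> A" "w \<in> D" for w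
        using that component_sym component_trans unfolding A_def D_def by blast
      then show ?thesis using False ab by blast
    qed
    have pos: "0 < card A" "0 < card D" using csize_pos[OF g(1)] va by (simp_all add: A_def D_def)
    define s where "s = real (card A) + real (card D)"
    have sp: "0 < s" using pos by (simp add: s_def)
    have conn: "vs ! b \<in> component ?E' (vs ! a)" by (rule pair_connected[OF ab(1)])
    have big: "s \<le> real (csize ?E' v)" if "v \<in> A \<union> D" for v
    proof -
      have "A \<subseteq> component ?E' (vs ! a)" "D \<subseteq> component ?E' (vs ! b)"
        using component_mono[OF add_edges_supset] by (auto simp: A_def D_def)
      then have AD: "A \<union> D \<subseteq> component ?E' (vs ! a)" using component_eq[OF conn] by blast
      then have "component ?E' v = component ?E' (vs ! a)" using that by (intro component_eq) blast
      then have "card (A \<union> D) \<le> csize ?E' v"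
        using AD finite_component[OF g' va(1)] by (simp add: card_mono)
      then show ?thesis using card_Un_disjoint[OF fin disj] by (simp add: s_def)
    qed
    have part: "(\<Sum>v\<in>X. 1 / real (csize E v) - 1 / real (csize ?E' v)) \<ge> 1 - real (card X) / s"
      if X: "X = A \<or> X = D" for X
    proof -
      have cX: "0 < card X" "X \<subseteq> A \<union> D" using X pos by auto
      have same: "csize E v = card X" if "v \<in> X" for v
        using X that component_eq[of v E "vs ! a"] component_eq[of v E "vs ! b"] by (auto simp: A_def D_def)
      have "(\<Sum>v\<in>X. 1 / real (card X) - 1 / s) \<le> (\<Sum>v\<in>X. 1 / real (csize E v) - 1 / real (csize ?E' v))"
      proof (rule sum_mono)
        fix v assume v: "v \<in> X"
        have "1 / real (csize ?E' v) \<le> 1 / s" using big[of v] v cX sp by (intro frac_le) auto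
        then show "1 / real (card X) - 1 / s \<le> 1 / real (csize E v) - 1 / real (csize ?E' v)"
          using same[OF v] by simp
      qed
      then show ?thesis using cX by (simp add: right_diff_distrib)
    qed
    have "real (card A) / s + real (card D) / s = 1"
      using sp by (simp add: s_def add_divide_distrib[symmetric])
    then have "1 = (1 - real (card A) / s) + (1 - real (card D) / s)" by linarith
    also have "\<dots> \<le> (\<Sum>v\<in>A. 1 / real (csize E v) - 1 / real (csize ?E' v)) + (\<Sum>v\<in>D. 1 / real (csize E v) - 1 / real (csize ?E' v))"
      by (intro add_mono part) auto
    also have "\<dots> = (\<Sum>v\<in>A \<union> D. 1 / real (csize E v) - 1 / real (csize ?E' v))"
      using fin disj by (simp add: sum.union_disjoint)
    also have "\<dots> \<le> (\<Sum>v=1..n. 1 / real (csize E v) - 1 / real (csize ?E' v))"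
      using sub anti by (intro sum_mono2) auto
    also have "\<dots> = inv_sum n E - inv_sum n ?E'" by (simp add: inv_sum_def sum_subtractf)
    finally show ?thesis using G0 by linarith
  qed
qed

lemma mean_inv_sum_step:
  assumes n: "0 < n" and E: "graph_on n E"
  shows "mean (draw n) (\<lambda>vs. inv_sum n (add_edges R E vs)) \<le> inv_sum n E - 1 + (real ell)\<^sup>2 * (sus n E / real n)"
proof -
  note fin = finite_draw[OF n]
  let ?f = "\<lambda>u w. of_bool (w \<in> component E u) :: real"
  have "mean (draw n) (\<lambda>vs. inv_sum n (add_edges R E vs))
     \<le> mean (draw n) (\<lambda>vs. (inv_sum n E - 1) + (\<Sum>i<ell. \<Sum>j\<in>{..<ell} - {i}. ?f (vs ! i) (vs ! j)))"
    using inv_sum_step[OF E] set_draw[OF n] by (intro mean_mono[OF fin]) auto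
  also have "\<dots> = inv_sum n E - 1 + (\<Sum>i<ell. \<Sum>j\<in>{..<ell} - {i}. mean (draw n) (\<lambda>vs. ?f (vs ! i) (vs ! j)))"
    by (simp only: mean_add[OF fin] mean_sum[OF fin] mean_const)
  also have "(\<Sum>i<ell. \<Sum>j\<in>{..<ell} - {i}. mean (draw n) (\<lambda>vs. ?f (vs ! i) (vs ! j)))
      = (\<Sum>i<ell. \<Sum>j\<in>{..<ell} - {i}. sus n E / real n)"
  proof (intro sum.cong refl)
    fix i j assume ij: "i \<in> {..<ell}" "j \<in> {..<ell} - {i}"
    have "mean (draw n) (\<lambda>vs. ?f (vs ! i) (vs ! j)) = (\<Sum>u=1..n. \<Sum>w=1..n. ?f u w) / (real n)\<^sup>2"
      using ij by (intro mean_draw_pair n) auto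
    also have "(\<Sum>u=1..n. \<Sum>w=1..n. ?f u w) = (\<Sum>u=1..n. real (csize E u))"
    proof (intro sum.cong refl)
      fix u assume u: "u \<in> {1..n}"
      have "{w \<in> {1..n}. w \<in> component E u} = component E u" using component_subset[OF E u] by blast
      then show "(\<Sum>w=1..n. ?f u w) = real (csize E u)"
        using card_Collect_sum[of n "\<lambda>w. w \<in> component E u"] by simp
    qed
    finally show "mean (draw n) (\<lambda>vs. ?f (vs ! i) (vs ! j)) = sus n E / real n"
      by (simp add: sus_def power2_eq_square)
  qed
  also have "\<dots> \<le> (\<Sum>i<ell. \<Sum>j<ell. sus n E / real n)"
    by (intro sum_mono sum_mono2) (auto simp: sus_def sum_nonneg)
  also have "\<dots> = (real ell)\<^sup>2 * (sus n E / real n)" by (simp add: power2_eq_square)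
  finally show ?thesis by simp
qed

text \<open>
  At most \<open>n\<close> mergers are possible. The susceptibility divided by \<open>n\<close> is the probability that two random
  vertices share a component, and it never decreases, so its value at the end controls the expected
  number of steps without a merger.
\<close>

lemma steps_le:
  assumes n: "0 < n"
  shows "real m \<le> real n + (real ell)\<^sup>2 * (real m * (mean (evolve n {} m) (sus n) / real n))"
proof -
  have fin: "finite (set_pmf (evolve n {} i))" for i by (rule finite_evolve[OF n])
  define q where "q = mean (evolve n {} m) (sus n) / real n"
  have "mean (evolve n {} i) (inv_sum n) \<le> real n - real i + real i * ((real ell)\<^sup>2 * q)" if "i \<le> m" for i
    using that
  proof (induction i)
    case 0
    then show ?case by (simp add: inv_sum_def)
  next
    case (Suc i)
    have "mean (evolve n {} (Suc i)) (inv_sum n)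
       \<le> mean (evolve n {} i) (\<lambda>E. (inv_sum n E - 1) + (real ell)\<^sup>2 * (sus n E / real n))"
      by (intro mean_evolve_step_le[OF n graph_on_empty] mean_inv_sum_step n)
    also have "\<dots> = mean (evolve n {} i) (inv_sum n) - 1 + (real ell)\<^sup>2 * (mean (evolve n {} i) (sus n) / real n)"
      by (simp add: mean_add[OF fin] mean_diff[OF fin])
    also have "mean (evolve n {} i) (sus n) \<le> mean (evolve n {} m) (sus n)"
    proof (rule mean_evolve_mono[OF n graph_on_empty])
      fix E E' assume "E \<subseteq> E'" "graph_on n E'"
      then show "sus n E \<le> sus n E'"
        unfolding sus_def using csize_mono by (intro divide_right_mono sum_mono) auto
    qed (use Suc in simp)
    finally have "mean (evolve n {} (Suc i)) (inv_sum n) \<le> mean (evolve n {} i) (inv_sum n) - 1 + (real ell)\<^sup>2 * q"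
      by (simp add: q_def mult_left_mono divide_right_mono)
    then show ?case using Suc by (simp add: algebra_simps)
  qed
  from this[of m] have "mean (evolve n {} m) (inv_sum n) \<le> real n - real m + real m * ((real ell)\<^sup>2 * q)" by simp
  moreover have "0 \<le> mean (evolve n {} m) (inv_sum n)"
    by (intro mean_nonneg) (simp add: inv_sum_def sum_nonneg)
  ultimately show ?thesis by (simp add: q_def mult_ac)
qed

theorem sublinear_time_le_1:
  assumes t: "0 \<le> t"
    and conv: "\<And>\<epsilon>. 0 < \<epsilon> \<Longrightarrow>
      (\<lambda>n. prob_at n (steps t n) (\<lambda>E. \<epsilon> < real (largest_component n E) / real n)) \<longlonglongrightarrow> 0"
  shows "t \<le> 1"
proof (rule ccontr)
  assume "\<not> t \<le> 1"
  then have t1: "1 < t" by simp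
  \<comment> \<open>chosen so that at most half of the t n - n superfluous steps can fail to merge\<close>
  define \<epsilon> where "\<epsilon> = (t - 1) / (4 * t * (real ell)\<^sup>2)"
  have \<epsilon>: "0 < \<epsilon>" using t1 ell2 by (simp add: \<epsilon>_def)
  have "\<forall>\<^sub>F n in sequentially. prob_at n (steps t n) (\<lambda>E. \<epsilon> < real (largest_component n E) / real n) < \<epsilon>"
    using order_tendstoD(2)[OF conv[OF \<epsilon>] \<epsilon>] .
  moreover have "\<forall>\<^sub>F n in sequentially. 2 / (t - 1) < real n"
    using filterlim_real_sequentially by (simp add: filterlim_at_top_dense)
  ultimately have "\<forall>\<^sub>F n in sequentially. 0 < n \<and> 2 / (t - 1) < real n \<and>
      prob_at n (steps t n) (\<lambda>E. \<epsilon> < real (largest_component n E) / real n) < \<epsilon>"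
    using eventually_gt_at_top[of 0] by eventually_elim simp
  then obtain n where n: "0 < n" "2 / (t - 1) < real n"
    and p: "prob_at n (steps t n) (\<lambda>E. \<epsilon> < real (largest_component n E) / real n) < \<epsilon>"
    using eventually_happens'[OF sequentially_bot] by blast
  define m where "m = steps t n"
  have m: "real m \<le> t * real n" "t * real n - 1 < real m" using t by (simp_all add: m_def of_nat_nat)
  have fin: "finite (set_pmf (evolve n {} m))" by (rule finite_evolve[OF n(1)])
  have "mean (evolve n {} m) (sus n) / real n = mean (evolve n {} m) (\<lambda>E. sus n E / real n)" by simp
  also have "\<dots> \<le> mean (evolve n {} m) (\<lambda>E. \<epsilon> + of_bool (\<epsilon> < real (largest_component n E) / real n))"
  proof (rule mean_mono[OF fin])
    fix E assume "E \<in> set_pmf (evolve n {} m)"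
    then have E: "graph_on n E" by (rule evolve_support[OF n(1) graph_on_empty])
    have "sus n E / real n \<le> real (largest_component n E) / real n"
      using sus_le_largest[OF n(1)] by (rule divide_right_mono) simp
    moreover have "sus n E / real n \<le> 1" using sus_le_n[OF E n(1)] n(1) by simp
    ultimately show "sus n E / real n \<le> \<epsilon> + of_bool (\<epsilon> < real (largest_component n E) / real n)"
      using \<epsilon> by auto
  qed
  also have "\<dots> < 2 * \<epsilon>"
    using p unfolding prob_eq_mean m_def[symmetric] by (simp add: mean_add[OF fin])
  finally have q: "mean (evolve n {} m) (sus n) / real n < 2 * \<epsilon>" .
  have "(real ell)\<^sup>2 * (real m * (mean (evolve n {} m) (sus n) / real n)) \<le> (real ell)\<^sup>2 * ((t * real n) * (2 * \<epsilon>))"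
    using q m \<epsilon> t by (intro mult_left_mono mult_mono) (auto intro!: divide_nonneg_nonneg mean_nonneg simp: sus_def sum_nonneg)
  also have "\<dots> = (t - 1) / 2 * real n"
    using t1 ell2 by (simp add: \<epsilon>_def field_simps)
  finally have le: "real m \<le> real n + (t - 1) / 2 * real n" using steps_le[OF n(1), of m] by linarith
  have "(t - 1) / 2 * real n = ((t - 1) * real n) / 2" by simp
  moreover have "(t - 1) * real n = t * real n - real n" by (simp add: left_diff_distrib)
  ultimately have "(t - 1) * real n < 2" using m le by linarith
  then show False using n t1 by (simp add: field_simps)
qed

end

section \<open>The limiting profile of component sizes\<close>

context bounded_rule
begin

text \<open>
  The limit provided by \<open>tail_concentration\<close>.
\<close>

definition profile :: "real \<Rightarrow> nat \<Rightarrow> real" where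
  "profile t k = (SOME x. (\<lambda>n. mean (evolve n {} (steps t n)) (\<lambda>E. (tail n k E - x)\<^sup>2)) \<longlonglongrightarrow> 0)"

lemma profile_L2:
  "0 \<le> t \<Longrightarrow> (\<lambda>n. mean (evolve n {} (steps t n)) (\<lambda>E. (tail n k E - profile t k)\<^sup>2)) \<longlonglongrightarrow> 0"
  unfolding profile_def by (rule someI_ex[OF tail_concentration])

lemma profile_prob:
  assumes "0 \<le> t" "0 < \<epsilon>"
  shows "(\<lambda>n. prob_at n (steps t n) (\<lambda>E. \<epsilon> \<le> \<bar>tail n k E - profile t k\<bar>)) \<longlonglongrightarrow> 0"
proof (rule tendsto_sandwich[OF _ _ tendsto_const])
  have "(\<lambda>n. mean (evolve n {} (steps t n)) (\<lambda>E. (tail n k E - profile t k)\<^sup>2) / \<epsilon>\<^sup>2) \<longlonglongrightarrow> 0 / \<epsilon>\<^sup>2"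
    using assms by (intro tendsto_divide profile_L2 tendsto_const) auto
  then show "(\<lambda>n. mean (evolve n {} (steps t n)) (\<lambda>E. (tail n k E - profile t k)\<^sup>2) / \<epsilon>\<^sup>2) \<longlonglongrightarrow> 0"
    by simp
  show "\<forall>\<^sub>F n in sequentially. prob_at n (steps t n) (\<lambda>E. \<epsilon> \<le> \<bar>tail n k E - profile t k\<bar>)
     \<le> mean (evolve n {} (steps t n)) (\<lambda>E. (tail n k E - profile t k)\<^sup>2) / \<epsilon>\<^sup>2"
  proof (rule eventually_sequentiallyI)
    fix n :: nat assume "1 \<le> n"
    then have n: "0 < n" by simp
    have "prob_at n (steps t n) (\<lambda>E. \<epsilon> \<le> \<bar>tail n k E - profile t k\<bar>)
       \<le> prob_at n (steps t n) (\<lambda>E. \<epsilon>\<^sup>2 \<le> (tail n k E - profile t k)\<^sup>2)"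
      using assms by (intro prob_mono) (auto simp: abs_le_square_iff[symmetric])
    also have "\<dots> \<le> mean (evolve n {} (steps t n)) (\<lambda>E. (tail n k E - profile t k)\<^sup>2) / \<epsilon>\<^sup>2"
      using assms by (intro prob_Markov finite_evolve n) auto
    finally show "prob_at n (steps t n) (\<lambda>E. \<epsilon> \<le> \<bar>tail n k E - profile t k\<bar>)
       \<le> mean (evolve n {} (steps t n)) (\<lambda>E. (tail n k E - profile t k)\<^sup>2) / \<epsilon>\<^sup>2" .
  qed
qed (simp add: always_eventually)

lemma mean_square_ge:
  assumes "finite (set_pmf p)"
  shows "(mean p f)\<^sup>2 \<le> mean p (\<lambda>x. (f x)\<^sup>2)"
proof -
  have "0 \<le> mean p (\<lambda>x. (f x - mean p f)\<^sup>2)" by (intro mean_nonneg) simp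
  also have "\<dots> = mean p (\<lambda>x. ((f x)\<^sup>2 - 2 * mean p f * f x) + (mean p f)\<^sup>2)"
    by (intro mean_cong) (simp add: power2_diff)
  also have "\<dots> = mean p (\<lambda>x. (f x)\<^sup>2) - (mean p f)\<^sup>2"
    by (simp add: mean_add[OF assms] mean_diff[OF assms] power2_eq_square)
  finally show ?thesis by simp
qed

lemma profile_mean:
  assumes "0 \<le> t"
  shows "(\<lambda>n. mean (evolve n {} (steps t n)) (tail n k)) \<longlonglongrightarrow> profile t k"
proof -
  have "(\<lambda>n. (mean (evolve n {} (steps t n)) (tail n k) - profile t k)\<^sup>2) \<longlonglongrightarrow> 0"
  proof (rule tendsto_sandwich[OF _ _ tendsto_const profile_L2[OF assms]])
    show "\<forall>\<^sub>F n in sequentially. (mean (evolve n {} (steps t n)) (tail n k) - profile t k)\<^sup>2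
       \<le> mean (evolve n {} (steps t n)) (\<lambda>E. (tail n k E - profile t k)\<^sup>2)"
    proof (rule eventually_sequentiallyI)
      fix n :: nat assume "1 \<le> n"
      then have fin: "finite (set_pmf (evolve n {} (steps t n)))" by (intro finite_evolve) simp
      show "(mean (evolve n {} (steps t n)) (tail n k) - profile t k)\<^sup>2
       \<le> mean (evolve n {} (steps t n)) (\<lambda>E. (tail n k E - profile t k)\<^sup>2)"
        using mean_square_ge[OF fin, of "\<lambda>E. tail n k E - profile t k"] by (simp add: mean_diff[OF fin])
    qed
  qed (simp add: always_eventually)
  then have "(\<lambda>n. sqrt ((mean (evolve n {} (steps t n)) (tail n k) - profile t k)\<^sup>2)) \<longlonglongrightarrow> sqrt 0"
    by (rule tendsto_real_sqrt)
  then have "(\<lambda>n. mean (evolve n {} (steps t n)) (tail n k) - profile t k) \<longlonglongrightarrow> 0"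
    by (simp add: tendsto_rabs_zero_iff)
  then show ?thesis by (simp add: LIM_zero_iff)
qed

lemma profile_bounds:
  assumes "0 \<le> t" shows "0 \<le> profile t k" "profile t k \<le> 1"
proof -
  show "0 \<le> profile t k"
    by (rule LIMSEQ_le_const[OF profile_mean[OF assms]]) (auto intro!: mean_nonneg tail_bounds)
  show "profile t k \<le> 1"
  proof (rule LIMSEQ_le_const2[OF profile_mean[OF assms]], intro exI allI impI)
    fix n :: nat assume "1 \<le> n"
    then have "mean (evolve n {} (steps t n)) (tail n k) \<le> mean (evolve n {} (steps t n)) (\<lambda>_. 1)"
      by (intro mean_mono finite_evolve tail_bounds) simp
    then show "mean (evolve n {} (steps t n)) (tail n k) \<le> 1" by simp
  qed
qed

lemma profile_antimono:
  assumes "0 \<le> t" "j \<le> k" shows "profile t k \<le> profile t j"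
proof (rule LIMSEQ_le[OF profile_mean[OF assms(1)] profile_mean[OF assms(1)]], intro exI allI impI)
  fix n :: nat assume "1 \<le> n"
  then show "mean (evolve n {} (steps t n)) (tail n k) \<le> mean (evolve n {} (steps t n)) (tail n j)"
    by (intro mean_mono finite_evolve tail_antimono assms) simp
qed

lemma trunc_sus_prob:
  assumes "0 \<le> t" "0 < \<epsilon>"
  shows "(\<lambda>n. prob_at n (steps t n) (\<lambda>E. \<epsilon> < \<bar>trunc_sus n K E - (\<Sum>k=1..K. profile t k)\<bar>)) \<longlonglongrightarrow> 0"
proof (rule tendsto_sandwich[OF _ _ tendsto_const])
  have K: "0 < \<epsilon> / real (Suc K)" using assms by simp
  have "(\<lambda>n. \<Sum>k=1..K. prob_at n (steps t n) (\<lambda>E. \<epsilon> / real (Suc K) \<le> \<bar>tail n k E - profile t k\<bar>)) \<longlonglongrightarrow> (\<Sum>k=1..K. 0)"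
    by (intro tendsto_sum profile_prob assms K)
  then show "(\<lambda>n. \<Sum>k=1..K. prob_at n (steps t n) (\<lambda>E. \<epsilon> / real (Suc K) \<le> \<bar>tail n k E - profile t k\<bar>)) \<longlonglongrightarrow> 0" by simp
  show "\<forall>\<^sub>F n in sequentially. prob_at n (steps t n) (\<lambda>E. \<epsilon> < \<bar>trunc_sus n K E - (\<Sum>k=1..K. profile t k)\<bar>)
    \<le> (\<Sum>k=1..K. prob_at n (steps t n) (\<lambda>E. \<epsilon> / real (Suc K) \<le> \<bar>tail n k E - profile t k\<bar>))"
  proof (intro always_eventually allI)
    fix n
    let ?p = "evolve n {} (steps t n)"
    have "measure_pmf.prob ?p {E. \<epsilon> < \<bar>trunc_sus n K E - (\<Sum>k=1..K. profile t k)\<bar>}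
       \<le> measure_pmf.prob ?p (\<Union>k\<in>{1..K}. {E. \<epsilon> / real (Suc K) \<le> \<bar>tail n k E - profile t k\<bar>})"
    proof (rule measure_pmf.finite_measure_mono)
      show "{E. \<epsilon> < \<bar>trunc_sus n K E - (\<Sum>k=1..K. profile t k)\<bar>}
        \<subseteq> (\<Union>k\<in>{1..K}. {E. \<epsilon> / real (Suc K) \<le> \<bar>tail n k E - profile t k\<bar>})"
      proof (rule subsetI, rule ccontr)
        fix E assume E: "E \<in> {E. \<epsilon> < \<bar>trunc_sus n K E - (\<Sum>k=1..K. profile t k)\<bar>}"
          and "E \<notin> (\<Union>k\<in>{1..K}. {E. \<epsilon> / real (Suc K) \<le> \<bar>tail n k E - profile t k\<bar>})"
        then have s: "\<bar>tail n k E - profile t k\<bar> \<le> \<epsilon> / real (Suc K)" if "k \<in> {1..K}" for k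
          using that by force
        have "\<bar>trunc_sus n K E - (\<Sum>k=1..K. profile t k)\<bar> \<le> (\<Sum>k=1..K. \<bar>tail n k E - profile t k\<bar>)"
          unfolding trunc_sus_eq_sum_tail sum_subtractf[symmetric] by (rule sum_abs)
        also have "\<dots> \<le> (\<Sum>k=1..K. \<epsilon> / real (Suc K))" by (intro sum_mono s)
        also have "\<dots> \<le> \<epsilon>" using assms by (simp add: field_simps)
        finally show False using E by simp
      qed
    qed simp
    also have "\<dots> \<le> (\<Sum>k=1..K. measure_pmf.prob ?p {E. \<epsilon> / real (Suc K) \<le> \<bar>tail n k E - profile t k\<bar>})"
      by (intro measure_pmf.finite_measure_subadditive_finite) auto
    finally show "measure_pmf.prob ?p {E. \<epsilon> < \<bar>trunc_sus n K E - (\<Sum>k=1..K. profile t k)\<bar>}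
       \<le> (\<Sum>k=1..K. measure_pmf.prob ?p {E. \<epsilon> / real (Suc K) \<le> \<bar>tail n k E - profile t k\<bar>})" .
  qed
qed (simp add: always_eventually)

text \<open>
  Every truncated susceptibility is at most \<open>M + 1\<close> whp, and \<open>susceptibility_tight\<close> removes the truncation.
\<close>

theorem sus_bounded_of_profile:
  assumes t: "0 \<le> t" and M: "\<And>K. (\<Sum>k=1..K. profile t k) \<le> M"
  shows "(\<lambda>n. prob_at n (steps t n) (\<lambda>E. M + 2 < sus n E)) \<longlonglongrightarrow> 0"
proof -
  have M0: "0 \<le> M" using M[of 0] by simp
  have "(\<lambda>n. prob_at n (steps t n) (\<lambda>E. (M + 1) + 1 < sus n E)) \<longlonglongrightarrow> 0"
  proof (rule susceptibility_tight[OF t])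
    fix K
    show "(\<lambda>n. prob_at n (steps t n) (\<lambda>E. M + 1 < trunc_sus n K E)) \<longlonglongrightarrow> 0"
    proof (rule tendsto_sandwich[OF _ _ tendsto_const trunc_sus_prob[OF t zero_less_one, of K]])
      show "\<forall>\<^sub>F n in sequentially. prob_at n (steps t n) (\<lambda>E. M + 1 < trunc_sus n K E)
         \<le> prob_at n (steps t n) (\<lambda>E. 1 < \<bar>trunc_sus n K E - (\<Sum>k=1..K. profile t k)\<bar>)"
        using M[of K] by (intro always_eventually allI prob_mono) linarith
    qed (simp add: always_eventually)
  qed (use M0 in simp)
  then show ?thesis unfolding add.assoc one_add_one .
qed

theorem sus_unbounded_of_profile:
  assumes t: "0 \<le> t" and "C + 1 < (\<Sum>k=1..K. profile t k)"
  shows "(\<lambda>n. prob_at n (steps t n) (\<lambda>E. sus n E \<le> C)) \<longlonglongrightarrow> 0"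
proof (rule tendsto_sandwich[OF _ _ tendsto_const trunc_sus_prob[OF t zero_less_one, of K]])
  have far: "1 < \<bar>trunc_sus n K E - (\<Sum>k=1..K. profile t k)\<bar>" if "sus n E \<le> C" for n E
    using trunc_sus_le_sus[of n K E] that assms(2) by linarith
  show "\<forall>\<^sub>F n in sequentially. prob_at n (steps t n) (\<lambda>E. sus n E \<le> C)
       \<le> prob_at n (steps t n) (\<lambda>E. 1 < \<bar>trunc_sus n K E - (\<Sum>k=1..K. profile t k)\<bar>)"
    by (intro always_eventually allI prob_mono) (rule far)
qed (simp add: always_eventually)

end

section \<open>Blow-up of the susceptibility\<close>

text \<open>
  The discrete form of \<open>(1 / y)' \<le> - a\<close> for \<open>y' \<ge> a * y\<^sup>2\<close>. The factor 2 comes from the step size: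
  \<open>1 / (y * (1 + a * y)) = 1 / y - a / (1 + a * y)\<close> with \<open>a * y \<le> 1\<close>.
\<close>

lemma blow_up_time:
  fixes y :: "nat \<Rightarrow> real"
  assumes "\<And>i. i < m \<Longrightarrow> Y \<le> y i \<Longrightarrow> y i + a * (y i)\<^sup>2 \<le> y (Suc i)" "Y \<le> y 0" "0 < Y"
    "\<And>i. i \<le> m \<Longrightarrow> a * y i \<le> 1" "0 \<le> a"
  shows "real m * a / 2 < 1 / Y"
proof -
  have "Y \<le> y i \<and> 1 / y i \<le> 1 / Y - real i * a / 2" if "i \<le> m" for i
    using that
  proof (induction i)
    case 0
    then show ?case using assms by (auto intro: frac_le)
  next
    case (Suc i)
    then have Yi: "Y \<le> y i" and IH: "1 / y i \<le> 1 / Y - real i * a / 2" by auto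
    have yp: "0 < y i" using Yi assms(3) by linarith
    have up: "y i + a * (y i)\<^sup>2 \<le> y (Suc i)" using assms(1) Suc.prems Yi by simp
    then have Y': "Y \<le> y (Suc i)" using Yi assms(5) zero_le_power2[of "y i"] mult_nonneg_nonneg[of a "(y i)\<^sup>2"] by linarith
    have a1: "a * y i \<le> 1" "0 \<le> a * y i" using assms(4)[of i] Suc.prems assms(5) yp by auto
    have fac: "y i + a * (y i)\<^sup>2 = y i * (1 + a * y i)" by (simp add: power2_eq_square algebra_simps)
    have "1 / y (Suc i) \<le> 1 / (y i * (1 + a * y i))"
      using up yp a1 unfolding fac by (intro frac_le mult_pos_pos) auto
    also have "\<dots> = 1 / y i - a / (1 + a * y i)"
      using yp a1 by (simp add: field_simps)
    also have "\<dots> \<le> 1 / y i - a / 2"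
      using a1 assms(5) by (intro diff_left_mono divide_left_mono) auto
    finally have "1 / y (Suc i) \<le> 1 / Y - real (Suc i) * a / 2"
      using IH by (simp add: algebra_simps add_divide_distrib)
    then show ?case using Y' by blast
  qed
  from this[of m] have "Y \<le> y m" "1 / y m \<le> 1 / Y - real m * a / 2" by auto
  moreover have "0 < 1 / y m" using \<open>Y \<le> y m\<close> assms(3) by simp
  ultimately show ?thesis by linarith
qed

text \<open>
  The double sum contains each product of two different levels once, as does half of the square, and
  the squares of the single levels with the factor 1 instead of 1/2.
\<close>

lemma half_square_le_sum:
  fixes x :: "nat \<Rightarrow> real"
  shows "(\<Sum>k\<in>{B<..K}. x k)\<^sup>2 / 2 \<le> (\<Sum>k\<in>{B<..K}. x k * (\<Sum>j\<in>{B<..k}. x j))"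
proof (induction K)
  case (Suc K)
  show ?case
  proof (cases "B < Suc K")
    case True
    then have ins: "{B<..Suc K} = insert (Suc K) {B<..K}" by auto
    let ?Q = "\<Sum>k\<in>{B<..K}. x k"
    have "(x (Suc K) + ?Q)\<^sup>2 / 2 = ?Q\<^sup>2 / 2 + x (Suc K) * ?Q + (x (Suc K))\<^sup>2 / 2"
      by (simp add: power2_sum add_divide_distrib)
    also have "\<dots> \<le> ?Q\<^sup>2 / 2 + x (Suc K) * (x (Suc K) + ?Q)"
      by (simp add: power2_eq_square distrib_left)
    finally show ?thesis using Suc.IH by (simp add: ins)
  qed simp
qed simp

context bounded_rule
begin

text \<open>
  A pair of indices that the rule selects whenever all \<open>ell\<close> component sizes exceed \<open>B\<close>.
\<close>

definition join_fst :: nat where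
  "join_fst = fst (SOME p. {fst p, snd p} \<in> R (replicate ell (B + 1)))"
definition join_snd :: nat where
  "join_snd = snd (SOME p. {fst p, snd p} \<in> R (replicate ell (B + 1)))"

lemma join:
  "{join_fst, join_snd} \<in> R (replicate ell (B + 1))" "join_fst < ell" "join_snd < ell" "join_fst \<noteq> join_snd"
proof -
  have wf: "R (replicate ell (B + 1)) \<noteq> {}" "R (replicate ell (B + 1)) \<subseteq> {{a, b} | a b. a < ell \<and> b < ell \<and> a \<noteq> b}"
    using rule unfolding size_rule_def by (auto dest!: spec[of _ "replicate ell (B + 1)"])
  then obtain a b where "{a, b} \<in> R (replicate ell (B + 1))" by blast
  then have "\<exists>p. {fst p, snd p} \<in> R (replicate ell (B + 1))" by (intro exI[of _ "(a, b)"]) simp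
  then show *: "{join_fst, join_snd} \<in> R (replicate ell (B + 1))"
    unfolding join_fst_def join_snd_def by (rule someI_ex)
  show "join_fst < ell" "join_snd < ell" "join_fst \<noteq> join_snd"
    using wf(2) * by (auto simp: doubleton_eq_iff)
qed

lemma joined:
  assumes g: "graph_on n E" "vs \<in> draws n" and big: "\<And>i. i < ell \<Longrightarrow> B + 1 \<le> csize E (vs ! i)"
  shows "vs ! join_snd \<in> component (add_edges R E vs) (vs ! join_fst)"
proof -
  have len: "length vs = ell" using g(2) by (simp add: draws_def)
  have "map (capped_size (B + 1) E) vs = replicate ell (B + 1)"
    using big len by (intro nth_equalityI) auto
  then have "pairs E vs = R (replicate ell (B + 1))" using rule_capped_sizes[OF g, of "B + 1"] by simp
  then show ?thesis using join(1) pair_connected by metis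
qed

text \<open>
  The part of the truncated susceptibility coming from levels above \<open>B\<close>; the levels up to \<open>B\<close>
  contribute at most \<open>B\<close>.
\<close>

definition partial_sus :: "nat \<Rightarrow> nat \<Rightarrow> nat set set \<Rightarrow> real" where
  "partial_sus n K E = (\<Sum>k\<in>{B<..K}. tail n k E)"

text \<open>
  If the step joins a vertex in a component of size at least \<open>k\<close> with one in a smaller component,
  then all vertices of the smaller component enter the tail. Its size must exceed \<open>B\<close> for the
  rule to be forced to join the two.
\<close>

lemma tail_growth_step:
  assumes g: "graph_on n E" "vs \<in> draws n" and n: "0 < n" and k: "B < k"
  shows "of_bool (k \<le> csize E (vs ! join_fst)) *
      (real (csize E (vs ! join_snd)) * of_bool (B < csize E (vs ! join_snd) \<and> csize E (vs ! join_snd) < k)) *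
      (\<Prod>i\<in>{..<ell} - {join_fst, join_snd}. of_bool (B + 1 \<le> csize E (vs ! i)))
    \<le> real n * (tail n k (add_edges R E vs) - tail n k E)" (is "?prod \<le> _")
proof (cases "k \<le> csize E (vs ! join_fst) \<and> B < csize E (vs ! join_snd) \<and> csize E (vs ! join_snd) < k \<and>
    (\<forall>i\<in>{..<ell} - {join_fst, join_snd}. B + 1 \<le> csize E (vs ! i))")
  case True
  let ?E' = "add_edges R E vs"
  let ?D = "component E (vs ! join_snd)"
  note g' = graph_on_add_edges[OF g]
  have big: "B + 1 \<le> csize E (vs ! i)" if "i < ell" for i
    using True k that by (cases "i = join_fst \<or> i = join_snd") auto
  have conn: "vs ! join_snd \<in> component ?E' (vs ! join_fst)" by (rule joined[OF g big])
  have v: "vs ! join_fst \<in> {1..n}" "vs ! join_snd \<in> {1..n}" using draws_nth[OF g(2)] join by auto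
  have sub: "?D \<union> {v \<in> {1..n}. k \<le> csize E v} \<subseteq> {v \<in> {1..n}. k \<le> csize ?E' v}"
  proof (intro Un_least subsetI)
    fix w assume w: "w \<in> ?D"
    then have "w \<in> component ?E' (vs ! join_snd)" using component_mono[OF add_edges_supset] by blast
    then have "component ?E' w = component ?E' (vs ! join_fst)" using component_eq conn by metis
    then have "csize E (vs ! join_fst) \<le> csize ?E' w"
      using csize_mono[OF add_edges_supset g' v(1)] by simp
    then show "w \<in> {v \<in> {1..n}. k \<le> csize ?E' v}"
      using True w component_subset[OF g(1) v(2)] by auto
  next
    fix w assume "w \<in> {v \<in> {1..n}. k \<le> csize E v}"
    then show "w \<in> {v \<in> {1..n}. k \<le> csize ?E' v}"
      using csize_mono[OF add_edges_supset g', of w] by auto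
  qed
  have disj: "?D \<inter> {v \<in> {1..n}. k \<le> csize E v} = {}"
    using component_eq True by (metis (mono_tags, lifting) Int_emptyI mem_Collect_eq not_less)
  have "card ?D + card {v \<in> {1..n}. k \<le> csize E v} = card (?D \<union> {v \<in> {1..n}. k \<le> csize E v})"
    using disj finite_component[OF g(1) v(2)] by (intro card_Un_disjoint[symmetric]) auto
  also have "\<dots> \<le> card {v \<in> {1..n}. k \<le> csize ?E' v}" using sub by (intro card_mono) auto
  finally have "real (card ?D) + real n * tail n k E \<le> real n * tail n k ?E'"
    using n by (simp add: tail_def flip: of_nat_add)
  moreover have "?prod = real (card ?D)" using True by simp
  ultimately show ?thesis unfolding right_diff_distrib by linarith
next
  case False
  then have "?prod = 0" by (auto simp: prod_zero_iff)
  moreover have "0 \<le> real n * (tail n k (add_edges R E vs) - tail n k E)"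
    using tail_mono[OF add_edges_supset graph_on_add_edges[OF g]] by simp
  ultimately show ?thesis by linarith
qed

lemma real_n_tail: "0 < n \<Longrightarrow> real n * tail n k E = (\<Sum>v=1..n. of_bool (k \<le> csize E v))"
  unfolding tail_def card_Collect_sum by simp

text \<open>
  The mean of the product in \<open>tail_growth_step\<close> factorizes. A component of size \<open>c\<close> with
  \<open>B < c < k\<close> has at most \<open>c\<close> levels \<open>j\<close> with \<open>B < j \<le> c\<close>, so the sizes of these components make up at
  least \<open>partial_sus\<close> minus the share \<open>k * tail n k E\<close> of the components of size at least \<open>k\<close>.
\<close>

lemma mean_tail_growth:
  assumes n: "0 < n" and E: "graph_on n E" and k: "B < k"
  shows "tail n (B + 1) E ^ (ell - 2) / real n * (tail n k E * (partial_sus n k E - real k * tail n k E))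
    \<le> mean (draw n) (\<lambda>vs. tail n k (add_edges R E vs)) - tail n k E"
proof -
  note fin = finite_draw[OF n]
  let ?f = "\<lambda>v. of_bool (k \<le> csize E v) :: real"
  let ?g = "\<lambda>v. real (csize E v) * of_bool (B < csize E v \<and> csize E v < k)"
  let ?h = "\<lambda>v. of_bool (B + 1 \<le> csize E v) :: real"
  have fsum: "(\<Sum>v=1..n. ?f v) / real n = tail n k E" "(\<Sum>v=1..n. ?h v) / real n = tail n (B + 1) E"
    by (simp_all only: tail_def card_Collect_sum)
  have gsum: "partial_sus n k E - real k * tail n k E \<le> (\<Sum>v=1..n. ?g v) / real n"
  proof -
    have "(\<Sum>v=1..n. (\<Sum>j\<in>{B<..k}. of_bool (j \<le> csize E v)) - real k * of_bool (k \<le> csize E v)) \<le> (\<Sum>v=1..n. ?g v)"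
    proof (rule sum_mono)
      fix v
      have "(\<Sum>j\<in>{B<..k}. of_bool (j \<le> csize E v)) = real (card {j \<in> {B<..k}. j \<le> csize E v})"
        by (simp add: of_bool_def sum.If_cases Int_def)
      also have "{j \<in> {B<..k}. j \<le> csize E v} = {B<..min k (csize E v)}" by auto
      finally show "(\<Sum>j\<in>{B<..k}. of_bool (j \<le> csize E v)) - real k * of_bool (k \<le> csize E v) \<le> ?g v"
        by (auto simp: of_bool_def)
    qed
    moreover have "(\<Sum>v=1..n. (\<Sum>j\<in>{B<..k}. of_bool (j \<le> csize E v)) - real k * of_bool (k \<le> csize E v))
       = real n * (partial_sus n k E - real k * tail n k E)"
    proof -
      have "(\<Sum>v=1..n. \<Sum>j\<in>{B<..k}. of_bool (j \<le> csize E v)) = (\<Sum>j\<in>{B<..k}. real n * tail n j E)"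
        unfolding real_n_tail[OF n] by (rule sum.swap)
      moreover have "(\<Sum>v=1..n. real k * of_bool (k \<le> csize E v)) = real n * (real k * tail n k E)"
        unfolding mult.left_commute[of "real n"] real_n_tail[OF n] sum_distrib_left ..
      ultimately show ?thesis
        by (simp only: sum_subtractf partial_sus_def right_diff_distrib sum_distrib_left)
    qed
    ultimately show ?thesis using n by (simp add: field_simps)
  qed
  have "tail n k E * ((\<Sum>v=1..n. ?g v) / real n) * tail n (B + 1) E ^ (ell - 2)
     = mean (draw n) (\<lambda>vs. ?f (vs ! join_fst) * ?g (vs ! join_snd) * (\<Prod>i\<in>{..<ell} - {join_fst, join_snd}. ?h (vs ! i)))"
    unfolding fsum[symmetric] by (rule mean_draw_pair_rest[OF n join(2-4), of ?f ?g ?h, symmetric])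
  also have "\<dots> \<le> mean (draw n) (\<lambda>vs. real n * (tail n k (add_edges R E vs) - tail n k E))"
    using tail_growth_step[OF E _ n k] set_draw[OF n] by (intro mean_mono[OF fin]) blast
  also have "\<dots> = real n * (mean (draw n) (\<lambda>vs. tail n k (add_edges R E vs)) - tail n k E)"
    by (simp add: mean_diff[OF fin])
  finally have up: "tail n k E * ((\<Sum>v=1..n. ?g v) / real n) * tail n (B + 1) E ^ (ell - 2)
     \<le> real n * (mean (draw n) (\<lambda>vs. tail n k (add_edges R E vs)) - tail n k E)" .
  have "tail n k E * (partial_sus n k E - real k * tail n k E) * tail n (B + 1) E ^ (ell - 2)
     \<le> tail n k E * ((\<Sum>v=1..n. ?g v) / real n) * tail n (B + 1) E ^ (ell - 2)"
    using gsum tail_bounds by (intro mult_right_mono mult_left_mono) auto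
  then have "tail n k E * (partial_sus n k E - real k * tail n k E) * tail n (B + 1) E ^ (ell - 2)
     \<le> real n * (mean (draw n) (\<lambda>vs. tail n k (add_edges R E vs)) - tail n k E)"
    using up by linarith
  then show ?thesis using n by (simp add: field_simps)
qed

lemma partial_sus_bounds: "0 \<le> partial_sus n K E" "partial_sus n K E \<le> real K"
proof -
  show "0 \<le> partial_sus n K E" by (simp add: partial_sus_def sum_nonneg tail_bounds)
  have "partial_sus n K E \<le> (\<Sum>k\<in>{B<..K}. 1)" unfolding partial_sus_def by (intro sum_mono tail_bounds)
  then show "partial_sus n K E \<le> real K" by simp
qed

lemma partial_sus_mono: "E \<subseteq> E' \<Longrightarrow> graph_on n E' \<Longrightarrow> partial_sus n K E \<le> partial_sus n K E'"
  unfolding partial_sus_def by (intro sum_mono tail_mono)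

text \<open>
  Summing \<open>mean_tail_growth\<close> over the levels gives a quadratic lower bound by \<open>half_square_le_sum\<close>,
  provided that \<open>k * tail n k E\<close> is bounded at all levels. On the other graphs the monotonicity of the process
  is used, and the last term is an upper bound for what the quadratic estimate could claim there.
\<close>

lemma mean_partial_sus_growth:
  assumes n: "0 < n" and E: "graph_on n E" and \<gamma>: "0 < \<gamma>" "\<gamma> \<le> 1" and C: "0 \<le> C"
  shows "partial_sus n K E + \<gamma> ^ (ell - 2) / real n * ((partial_sus n K E)\<^sup>2 / 2 - C * partial_sus n K E
      - (real K)\<^sup>2 * of_bool (\<not> (\<gamma> \<le> tail n (B + 1) E \<and> (\<forall>k\<in>{B<..K}. real k * tail n k E \<le> C))))
    \<le> mean (draw n) (\<lambda>vs. partial_sus n K (add_edges R E vs))"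
proof -
  let ?Q = "partial_sus n K E"
  note fin = finite_draw[OF n]
  have mono: "?Q \<le> mean (draw n) (\<lambda>vs. partial_sus n K (add_edges R E vs))"
    by (intro mean_draw_add_edges_ge n E partial_sus_mono)
  have gp: "0 \<le> \<gamma> ^ (ell - 2) / real n" using \<gamma> by simp
  show ?thesis
  proof (cases "\<gamma> \<le> tail n (B + 1) E \<and> (\<forall>k\<in>{B<..K}. real k * tail n k E \<le> C)")
    case False
    have "?Q\<^sup>2 \<le> (real K)\<^sup>2" using partial_sus_bounds by (intro power_mono) auto
    then have "?Q\<^sup>2 / 2 - C * ?Q - (real K)\<^sup>2 \<le> 0"
      using mult_nonneg_nonneg[OF C partial_sus_bounds(1), of n K E] zero_le_power2[of "real K"] by linarith
    then have "\<gamma> ^ (ell - 2) / real n * (?Q\<^sup>2 / 2 - C * ?Q - (real K)\<^sup>2) \<le> 0"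
      using gp by (rule mult_nonneg_nonpos[rotated])
    then show ?thesis using False mono by simp
  next
    case True
    have per: "\<gamma> ^ (ell - 2) / real n * (tail n k E * partial_sus n k E - C * tail n k E)
       \<le> mean (draw n) (\<lambda>vs. tail n k (add_edges R E vs)) - tail n k E" if k: "k \<in> {B<..K}" for k
    proof (cases "0 \<le> partial_sus n k E - real k * tail n k E")
      case pos: True
      have "\<gamma> ^ (ell - 2) / real n * (tail n k E * partial_sus n k E - C * tail n k E)
         \<le> \<gamma> ^ (ell - 2) / real n * (tail n k E * (partial_sus n k E - real k * tail n k E))"
      proof (rule mult_left_mono[OF _ gp])
        have "tail n k E * (real k * tail n k E) \<le> tail n k E * C"
          using True k tail_bounds by (intro mult_left_mono) auto
        then show "tail n k E * partial_sus n k E - C * tail n k E \<le> tail n k E * (partial_sus n k E - real k * tail n k E)"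
          by (simp add: right_diff_distrib mult.commute)
      qed
      also have "\<dots> \<le> tail n (B + 1) E ^ (ell - 2) / real n * (tail n k E * (partial_sus n k E - real k * tail n k E))"
        using True \<gamma> pos tail_bounds by (intro mult_right_mono divide_right_mono power_mono) auto
      also have "\<dots> \<le> mean (draw n) (\<lambda>vs. tail n k (add_edges R E vs)) - tail n k E"
        using mean_tail_growth[OF n E] k by simp
      finally show ?thesis .
    next
      case False
      then have "partial_sus n k E \<le> C" using True k by force
      then have "tail n k E * partial_sus n k E \<le> tail n k E * C" using tail_bounds by (intro mult_left_mono) auto
      then have "\<gamma> ^ (ell - 2) / real n * (tail n k E * partial_sus n k E - C * tail n k E) \<le> 0"
        using gp by (intro mult_nonneg_nonpos) (auto simp: mult.commute)
      moreover have "tail n k E \<le> mean (draw n) (\<lambda>vs. tail n k (add_edges R E vs))"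
        by (intro mean_draw_add_edges_ge n E tail_mono)
      ultimately show ?thesis by linarith
    qed
    have "?Q\<^sup>2 / 2 - C * ?Q \<le> (\<Sum>k\<in>{B<..K}. tail n k E * partial_sus n k E - C * tail n k E)"
      using half_square_le_sum[of "\<lambda>k. tail n k E" B K]
      by (simp add: partial_sus_def sum_subtractf sum_distrib_left)
    then have "\<gamma> ^ (ell - 2) / real n * (?Q\<^sup>2 / 2 - C * ?Q)
       \<le> \<gamma> ^ (ell - 2) / real n * (\<Sum>k\<in>{B<..K}. tail n k E * partial_sus n k E - C * tail n k E)"
      using gp by (rule mult_left_mono)
    also have "\<dots> = (\<Sum>k\<in>{B<..K}. \<gamma> ^ (ell - 2) / real n * (tail n k E * partial_sus n k E - C * tail n k E))"
      by (rule sum_distrib_left)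
    also have "\<dots> \<le> (\<Sum>k\<in>{B<..K}. mean (draw n) (\<lambda>vs. tail n k (add_edges R E vs)) - tail n k E)"
      by (intro sum_mono per)
    also have "\<dots> = mean (draw n) (\<lambda>vs. partial_sus n K (add_edges R E vs)) - ?Q"
      by (simp add: partial_sus_def sum_subtractf mean_sum[OF fin])
    finally show ?thesis using True by simp
  qed
qed

text \<open>
  Taking means, \<open>y i\<close> satisfies \<open>y (Suc i) \<ge> y i + a * (y i)\<^sup>2\<close> with \<open>a\<close> of order \<open>1 / n\<close>: the mean of
  the square is at least the square of the mean, and the condition \<open>8 * C \<le> Y\<close> and the smallness of
  \<open>\<beta>\<close> let the quadratic term absorb the other two.
\<close>

lemma partial_sus_growth_time:
  assumes n: "0 < n" and \<gamma>: "0 < \<gamma>" "\<gamma> \<le> 1" and C: "0 \<le> C" and Y: "8 * C \<le> Y" "0 < Y"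
    and start: "Y \<le> mean (evolve n {} i0) (partial_sus n K)" and nK: "real K \<le> real n"
    and p: "prob_at n i0 (\<lambda>E. tail n (B + 1) E < \<gamma>) \<le> \<beta>"
      "prob_at n (i0 + m) (\<lambda>E. \<exists>k\<in>{B<..K}. C < real k * tail n k E) \<le> \<beta>"
    and \<beta>: "16 * (real K)\<^sup>2 * \<beta> \<le> Y\<^sup>2"
  shows "real m / real n * (\<gamma> ^ (ell - 2) / 8) < 1 / Y"
proof -
  define y where "y i = mean (evolve n {} (i0 + i)) (partial_sus n K)" for i
  define a where "a = \<gamma> ^ (ell - 2) / (4 * real n)"
  let ?bad = "\<lambda>E. \<not> (\<gamma> \<le> tail n (B + 1) E \<and> (\<forall>k\<in>{B<..K}. real k * tail n k E \<le> C))"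
  have fin: "finite (set_pmf (evolve n {} i))" for i by (rule finite_evolve[OF n])
  have g1: "\<gamma> ^ (ell - 2) \<le> 1" using \<gamma> by (intro power_le_one) auto
  have step: "y i + a * (y i)\<^sup>2 \<le> y (Suc i)" if i: "i < m" "Y \<le> y i" for i
  proof -
    let ?p = "evolve n {} (i0 + i)"
    have "prob_at n (i0 + i) ?bad \<le> prob_at n (i0 + i) (\<lambda>E. tail n (B + 1) E < \<gamma>)
        + prob_at n (i0 + i) (\<lambda>E. \<exists>k\<in>{B<..K}. C < real k * tail n k E)"
      unfolding prob_eq_mean mean_add[OF fin, symmetric] by (intro mean_mono[OF fin]) (auto simp: not_le)
    also have "prob_at n (i0 + i) (\<lambda>E. tail n (B + 1) E < \<gamma>) \<le> prob_at n i0 (\<lambda>E. tail n (B + 1) E < \<gamma>)"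
    proof -
      have "mean (evolve n {} i0) (\<lambda>E. - of_bool (tail n (B + 1) E < \<gamma>)) \<le> mean ?p (\<lambda>E. - of_bool (tail n (B + 1) E < \<gamma>))"
      proof (rule mean_evolve_mono[OF n graph_on_empty])
        fix E E' assume "E \<subseteq> E'" "graph_on n E'"
        then have "tail n (B + 1) E \<le> tail n (B + 1) E'" by (rule tail_mono)
        then show "- of_bool (tail n (B + 1) E < \<gamma>) \<le> (- of_bool (tail n (B + 1) E' < \<gamma>) :: real)"
          by (simp add: of_bool_def)
      qed simp
      then show ?thesis by (simp add: prob_eq_mean)
    qed
    also have "prob_at n (i0 + i) (\<lambda>E. \<exists>k\<in>{B<..K}. C < real k * tail n k E)
        \<le> prob_at n (i0 + m) (\<lambda>E. \<exists>k\<in>{B<..K}. C < real k * tail n k E)"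
    proof (rule prob_at_mono[OF n])
      fix E E' assume sub: "E \<subseteq> E'" "graph_on n E'" and "\<exists>k\<in>{B<..K}. C < real k * tail n k E"
      then obtain k where k: "k \<in> {B<..K}" "C < real k * tail n k E" by blast
      have "real k * tail n k E \<le> real k * tail n k E'" using tail_mono[OF sub] by (intro mult_left_mono) auto
      then show "\<exists>k\<in>{B<..K}. C < real k * tail n k E'" using k by (intro bexI[of _ k]) linarith+
    qed (use i in simp)
    finally have bad: "mean ?p (\<lambda>E. of_bool (?bad E)) \<le> 2 * \<beta>" using p unfolding prob_eq_mean by linarith
    have gp: "0 \<le> \<gamma> ^ (ell - 2) / real n" using \<gamma> by simp
    have "(y i)\<^sup>2 \<le> mean ?p (\<lambda>E. (partial_sus n K E)\<^sup>2)"
      unfolding y_def by (rule mean_square_ge[OF fin])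
    moreover have "(real K)\<^sup>2 * mean ?p (\<lambda>E. of_bool (?bad E)) \<le> (real K)\<^sup>2 * (2 * \<beta>)"
      using bad by (intro mult_left_mono) auto
    moreover have "8 * (C * y i) \<le> (y i)\<^sup>2"
    proof -
      have "8 * C * y i \<le> y i * y i" using Y i by (intro mult_right_mono) auto
      then show ?thesis by (simp add: power2_eq_square)
    qed
    moreover have "Y\<^sup>2 \<le> (y i)\<^sup>2" using Y i by (intro power_mono) auto
    ultimately have "(y i)\<^sup>2 / 4 \<le> mean ?p (\<lambda>E. (partial_sus n K E)\<^sup>2) / 2 - C * y i
        - (real K)\<^sup>2 * mean ?p (\<lambda>E. of_bool (?bad E))"
      using \<beta> by simp
    then have "y i + \<gamma> ^ (ell - 2) / real n * ((y i)\<^sup>2 / 4) \<le> y i + \<gamma> ^ (ell - 2) / real n *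
       (mean ?p (\<lambda>E. (partial_sus n K E)\<^sup>2) / 2 - C * y i - (real K)\<^sup>2 * mean ?p (\<lambda>E. of_bool (?bad E)))"
      using gp by (intro add_left_mono mult_left_mono)
    also have "\<dots> = mean ?p (\<lambda>E. partial_sus n K E + \<gamma> ^ (ell - 2) / real n *
       ((partial_sus n K E)\<^sup>2 / 2 - C * partial_sus n K E - (real K)\<^sup>2 * of_bool (?bad E)))"
      by (simp add: mean_add[OF fin] mean_diff[OF fin] y_def del: of_bool_not_iff)
    also have "\<dots> \<le> y (Suc i)"
      unfolding y_def add_Suc_right
      by (intro mean_evolve_step_ge[OF n graph_on_empty] mean_partial_sus_growth n \<gamma> C)
    finally show ?thesis by (simp add: a_def)
  qed
  have "a * y i \<le> 1" for i
  proof -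
    have "y i \<le> mean (evolve n {} (i0 + i)) (\<lambda>_. real K)"
      unfolding y_def by (intro mean_mono fin partial_sus_bounds)
    then have "y i \<le> real n" using nK by simp
    then have "a * y i \<le> a * real n" using \<gamma> by (intro mult_left_mono) (auto simp: a_def)
    also have "\<dots> \<le> 1" using g1 n by (simp add: a_def)
    finally show ?thesis .
  qed
  then have "real m * a / 2 < 1 / Y"
    using step Y start \<gamma> by (intro blow_up_time[where y = y]) (auto simp: y_def a_def)
  then show ?thesis by (simp add: a_def)
qed

end

section \<open>A level carrying many vertices\<close>

context bounded_rule
begin

text \<open>
  Rounding down both times costs less than one step, which is at most half of the time span for large \<open>n\<close>.
\<close>

lemma steps_between:
  assumes "0 \<le> s" "s < t" "2 / (t - s) \<le> real n" "0 < n"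
  shows "steps s n \<le> steps t n"
    "(t - s) / 2 \<le> real (steps t n - steps s n) / real n"
proof -
  have st: "s * real n \<le> t * real n" using assms by (intro mult_right_mono) auto
  show le: "steps s n \<le> steps t n" using st by (intro nat_mono floor_mono)
  have "real (steps s n) \<le> s * real n" "t * real n - 1 < real (steps t n)"
    using assms by (simp_all add: of_nat_nat)
  then have "(t - s) * real n - 1 \<le> real (steps t n - steps s n)"
    using le by (simp add: of_nat_diff left_diff_distrib)
  moreover have "2 \<le> (t - s) * real n" using assms by (simp add: divide_le_eq mult.commute)
  ultimately have "(t - s) / 2 * real n \<le> real (steps t n - steps s n)" by simp
  then show "(t - s) / 2 \<le> real (steps t n - steps s n) / real n"
    using assms by (simp add: le_divide_eq)
qed

lemma eventually_real_ge: "\<forall>\<^sub>F n in sequentially. c \<le> real n"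
  using filterlim_real_sequentially by (simp add: filterlim_at_top)

text \<open>
  If there were no such level, \<open>partial_sus_growth_time\<close> would apply between \<open>t1\<close> and \<open>t2\<close> with a starting value \<open>Y\<close> so
  large that the blow-up time is shorter than \<open>t2 - t1\<close>. The truncation level \<open>K\<close> is chosen after \<open>Y\<close>,
  which is possible because the growth rate does not depend on \<open>K\<close>.
\<close>

lemma heavy_level:
  assumes t: "0 \<le> t1" "t1 < t2" and unb: "\<And>M. \<exists>K. M < (\<Sum>k=1..K. profile t1 k)"
    and \<gamma>: "0 < \<gamma>" "\<gamma> < profile t1 (B + 1)" and C: "0 \<le> C"
  shows "\<exists>k>B. C \<le> real k * profile t2 k"
proof (rule ccontr)
  assume "\<not> ?thesis"
  then have light: "real k * profile t2 k < C" if "B < k" for k using that by force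
  define C' where "C' = C + 1"
  define g where "g = \<gamma> ^ (ell - 2)"
  have g: "0 < g" using \<gamma> by (simp add: g_def)
  have \<gamma>1: "\<gamma> \<le> 1" using \<gamma> profile_bounds[OF t(1), of "B + 1"] by linarith
  \<comment> \<open>the second argument makes the blow-up time 8 / (g Y) at most half of t2 - t1;
    the other half absorbs rounding\<close>
  define Y where "Y = max (8 * C') (16 / ((t2 - t1) * g))"
  have Y: "8 * C' \<le> Y" "16 / ((t2 - t1) * g) \<le> Y" "0 < Y" using C by (auto simp: Y_def C'_def)
  obtain K where K: "Y + 1 + real B < (\<Sum>k=1..K. profile t1 k)" using unb by blast
  have "(\<Sum>k=1..K. profile t1 k) \<le> (\<Sum>k\<in>{1..B} \<union> {B<..K}. profile t1 k)"
    using profile_bounds[OF t(1)] by (intro sum_mono2) auto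
  also have "\<dots> = (\<Sum>k=1..B. profile t1 k) + (\<Sum>k\<in>{B<..K}. profile t1 k)"
    by (intro sum.union_disjoint) auto
  also have "(\<Sum>k=1..B. profile t1 k) \<le> (\<Sum>k=1..B. 1)" by (intro sum_mono profile_bounds t)
  finally have S: "Y < (\<Sum>k\<in>{B<..K}. profile t1 k)" using K by simp
  have "(\<lambda>n. \<Sum>k\<in>{B<..K}. mean (evolve n {} (steps t1 n)) (tail n k)) \<longlonglongrightarrow> (\<Sum>k\<in>{B<..K}. profile t1 k)"
    by (intro tendsto_sum profile_mean t)
  from order_tendstoD(1)[OF this S]
  have ev1: "\<forall>\<^sub>F n in sequentially. Y < (\<Sum>k\<in>{B<..K}. mean (evolve n {} (steps t1 n)) (tail n k))" .
  \<comment> \<open>the 1 in the denominator only avoids a division by zero\<close>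
  define \<beta> where "\<beta> = Y\<^sup>2 / (16 * ((real K)\<^sup>2 + 1))"
  have \<beta>: "0 < \<beta>" using Y by (simp add: \<beta>_def add_nonneg_pos)
  have \<beta>K: "16 * (real K)\<^sup>2 * \<beta> \<le> Y\<^sup>2"
  proof -
    have "16 * (real K)\<^sup>2 * \<beta> \<le> 16 * ((real K)\<^sup>2 + 1) * \<beta>" using \<beta> by (intro mult_right_mono) auto
    also have "\<dots> = Y\<^sup>2"
    proof -
      have "(real K)\<^sup>2 + 1 \<noteq> 0" by (metis add_nonneg_pos less_irrefl zero_le_power2 zero_less_one)
      then show ?thesis by (simp add: \<beta>_def)
    qed
    finally show ?thesis .
  qed
  have ev2: "\<forall>\<^sub>F n in sequentially. prob_at n (steps t1 n) (\<lambda>E. profile t1 (B + 1) - \<gamma> \<le> \<bar>tail n (B + 1) E - profile t1 (B + 1)\<bar>) < \<beta>"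
    using \<gamma> by (intro order_tendstoD(2)[OF profile_prob \<beta>] t) simp
  have "(\<lambda>n. \<Sum>k\<in>{B<..K}. prob_at n (steps t2 n) (\<lambda>E. 1 / real k \<le> \<bar>tail n k E - profile t2 k\<bar>)) \<longlonglongrightarrow> (\<Sum>k\<in>{B<..K}. 0)"
    using t by (intro tendsto_sum profile_prob) auto
  then have "(\<lambda>n. \<Sum>k\<in>{B<..K}. prob_at n (steps t2 n) (\<lambda>E. 1 / real k \<le> \<bar>tail n k E - profile t2 k\<bar>)) \<longlonglongrightarrow> 0"
    by simp
  from order_tendstoD(2)[OF this \<beta>]
  have ev3: "\<forall>\<^sub>F n in sequentially. (\<Sum>k\<in>{B<..K}. prob_at n (steps t2 n) (\<lambda>E. 1 / real k \<le> \<bar>tail n k E - profile t2 k\<bar>)) < \<beta>" .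
  have "\<forall>\<^sub>F n in sequentially. False"
    using ev1 ev2 ev3 eventually_real_ge[of "real K"] eventually_real_ge[of "2 / (t2 - t1)"] eventually_gt_at_top[of 0]
  proof eventually_elim
    case (elim n)
    define m1 where "m1 = steps t1 n"
    define m2 where "m2 = steps t2 n"
    note n = \<open>0 < n\<close>
    have m: "m1 \<le> m2" "(t2 - t1) / 2 \<le> real (m2 - m1) / real n"
      using steps_between[OF t] elim by (auto simp: m1_def m2_def)
    have "real (m2 - m1) / real n * (\<gamma> ^ (ell - 2) / 8) < 1 / Y"
    proof (rule partial_sus_growth_time[OF n \<gamma>(1) \<gamma>1 _ Y(1,3) _ _ _ _ \<beta>K])
      show "0 \<le> C'" using C by (simp add: C'_def)
      show "Y \<le> mean (evolve n {} m1) (partial_sus n K)"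
        using elim by (simp add: partial_sus_def[abs_def] mean_sum[OF finite_evolve[OF n]] m1_def)
      show "real K \<le> real n" using elim by simp
      have "prob_at n m1 (\<lambda>E. tail n (B + 1) E < \<gamma>)
          \<le> prob_at n m1 (\<lambda>E. profile t1 (B + 1) - \<gamma> \<le> \<bar>tail n (B + 1) E - profile t1 (B + 1)\<bar>)"
        by (intro prob_mono) linarith
      then show "prob_at n m1 (\<lambda>E. tail n (B + 1) E < \<gamma>) \<le> \<beta>" using elim by (simp add: m1_def)
      have "prob_at n m2 (\<lambda>E. \<exists>k\<in>{B<..K}. C' < real k * tail n k E)
          \<le> measure_pmf.prob (evolve n {} m2) (\<Union>k\<in>{B<..K}. {E. 1 / real k \<le> \<bar>tail n k E - profile t2 k\<bar>})"
      proof (rule measure_pmf.finite_measure_mono)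
        show "{E. \<exists>k\<in>{B<..K}. C' < real k * tail n k E} \<subseteq> (\<Union>k\<in>{B<..K}. {E. 1 / real k \<le> \<bar>tail n k E - profile t2 k\<bar>})"
        proof
          fix E assume "E \<in> {E. \<exists>k\<in>{B<..K}. C' < real k * tail n k E}"
          then obtain k where k: "k \<in> {B<..K}" "C' < real k * tail n k E" by blast
          then have "1 < real k * (tail n k E - profile t2 k)"
            using light[of k] by (simp add: C'_def right_diff_distrib)
          then have "1 / real k \<le> tail n k E - profile t2 k"
            using k by (simp add: divide_le_eq mult.commute)
          then show "E \<in> (\<Union>k\<in>{B<..K}. {E. 1 / real k \<le> \<bar>tail n k E - profile t2 k\<bar>})"
            using k by (intro UN_I[of k]) auto
        qed
      qed simp
      also have "\<dots> \<le> (\<Sum>k\<in>{B<..K}. measure_pmf.prob (evolve n {} m2) {E. 1 / real k \<le> \<bar>tail n k E - profile t2 k\<bar>})"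
        by (intro measure_pmf.finite_measure_subadditive_finite) auto
      also have "\<dots> \<le> \<beta>" using elim by (simp add: m2_def)
      finally show "prob_at n (m1 + (m2 - m1)) (\<lambda>E. \<exists>k\<in>{B<..K}. C' < real k * tail n k E) \<le> \<beta>"
        using m by simp
    qed
    moreover have "(t2 - t1) / 2 * (g / 8) \<le> real (m2 - m1) / real n * (g / 8)"
      using m g by (intro mult_right_mono) auto
    moreover have "1 / Y \<le> (t2 - t1) / 2 * (g / 8)"
    proof -
      have "0 < (t2 - t1) * g" using t g by simp
      then have "1 / Y \<le> 1 / (16 / ((t2 - t1) * g))" using Y by (intro frac_le) auto
      then show ?thesis by simp
    qed
    ultimately show False unfolding g_def by linarith
  qed
  then show False by simp
qed

section \<open>Sprinkling\<close>

definition separated :: "nat set \<Rightarrow> nat set \<Rightarrow> nat set set \<Rightarrow> bool" where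
  "separated A D E \<longleftrightarrow> (\<forall>u\<in>A. \<forall>v\<in>D. v \<notin> component E u)"

text \<open>
  A separated pair of sets stops being separated as soon as the vertex with index \<open>join_fst\<close> falls into \<open>A\<close>,
  the one with index \<open>join_snd\<close> into \<open>D\<close>, and all others into components larger than \<open>B\<close>.
\<close>

lemma mean_separated_step:
  assumes n: "0 < n" and E: "graph_on n E" "graph_on n E0" "E0 \<subseteq> E" and AD: "A \<subseteq> {1..n}" "D \<subseteq> {1..n}"
    and big: "\<And>v. v \<in> A \<union> D \<Longrightarrow> B + 1 \<le> csize E0 v"
    and \<gamma>: "0 \<le> \<gamma>" "\<gamma> \<le> tail n (B + 1) E0"
  shows "mean (draw n) (\<lambda>vs. of_bool (separated A D (add_edges R E vs)))
    \<le> (1 - \<gamma> ^ (ell - 2) * (real (card A) / real n) * (real (card D) / real n)) * of_bool (separated A D E)"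
proof -
  note fin = finite_draw[OF n]
  show ?thesis
  proof (cases "separated A D E")
    case False
    then have "\<not> separated A D (add_edges R E vs)" for vs
      unfolding separated_def using component_mono[OF add_edges_supset, of E] by blast
    then show ?thesis using False by simp
  next
    case True
    let ?f = "\<lambda>v. of_bool (v \<in> A) :: real" and ?g = "\<lambda>v. of_bool (v \<in> D) :: real"
      and ?h = "\<lambda>v. of_bool (B + 1 \<le> csize E0 v) :: real"
    let ?P = "\<lambda>vs. ?f (vs ! join_fst) * ?g (vs ! join_snd) * (\<Prod>i\<in>{..<ell} - {join_fst, join_snd}. ?h (vs ! i))"
    have "mean (draw n) (\<lambda>vs. of_bool (separated A D (add_edges R E vs))) \<le> mean (draw n) (\<lambda>vs. 1 - ?P vs)"
    proof (rule mean_mono[OF fin])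
      fix vs assume "vs \<in> set_pmf (draw n)"
      then have vs: "vs \<in> draws n" using set_draw[OF n] by simp
      show "of_bool (separated A D (add_edges R E vs)) \<le> 1 - ?P vs"
      proof (cases "vs ! join_fst \<in> A \<and> vs ! join_snd \<in> D \<and> (\<forall>i\<in>{..<ell} - {join_fst, join_snd}. B + 1 \<le> csize E0 (vs ! i))")
        case all: True
        have "B + 1 \<le> csize E (vs ! i)" if i: "i < ell" for i
        proof -
          have "B + 1 \<le> csize E0 (vs ! i)" using all big that by (cases "i = join_fst \<or> i = join_snd") auto
          then show ?thesis using csize_mono[OF E(3,1) draws_nth[OF vs i]] by linarith
        qed
        then have "vs ! join_snd \<in> component (add_edges R E vs) (vs ! join_fst)" by (rule joined[OF E(1) vs])
        then have "\<not> separated A D (add_edges R E vs)" using all by (auto simp: separated_def)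
        then show ?thesis using all by simp
      next
        case False
        then have "?P vs = 0" by (auto simp: prod_zero_iff)
        moreover have "of_bool (separated A D (add_edges R E vs)) \<le> (1 :: real)" by simp
        ultimately show ?thesis by linarith
      qed
    qed
    also have "\<dots> = 1 - mean (draw n) ?P" by (simp add: mean_diff[OF fin])
    also have "mean (draw n) ?P = (\<Sum>v=1..n. ?f v) / real n * ((\<Sum>v=1..n. ?g v) / real n) * ((\<Sum>v=1..n. ?h v) / real n) ^ (ell - 2)"
      by (rule mean_draw_pair_rest[OF n join(2-4)])
    also have "(\<Sum>v=1..n. ?f v) = real (card A)"
      using AD card_Collect_sum[of n "\<lambda>v. v \<in> A"] by (simp only: Collect_conj_eq Collect_mem_eq) (simp add: Int_absorb1)
    also have "(\<Sum>v=1..n. ?g v) = real (card D)"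
      using AD card_Collect_sum[of n "\<lambda>v. v \<in> D"] by (simp only: Collect_conj_eq Collect_mem_eq) (simp add: Int_absorb1)
    also have "(\<Sum>v=1..n. ?h v) / real n = tail n (B + 1) E0" by (simp only: tail_def card_Collect_sum)
    also have "1 - real (card A) / real n * (real (card D) / real n) * tail n (B + 1) E0 ^ (ell - 2)
        \<le> 1 - real (card A) / real n * (real (card D) / real n) * \<gamma> ^ (ell - 2)"
      using \<gamma> by (intro diff_left_mono mult_left_mono power_mono) auto
    finally show ?thesis using True by (simp add: mult_ac)
  qed
qed

lemma prob_separated:
  assumes n: "0 < n" and E0: "graph_on n E0" and AD: "A \<subseteq> {1..n}" "D \<subseteq> {1..n}"
    and big: "\<And>v. v \<in> A \<union> D \<Longrightarrow> B + 1 \<le> csize E0 v"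
    and \<gamma>: "0 \<le> \<gamma>" "\<gamma> \<le> tail n (B + 1) E0"
  shows "mean (evolve n E0 m) (\<lambda>E. of_bool (separated A D E))
    \<le> (1 - \<gamma> ^ (ell - 2) * (real (card A) / real n) * (real (card D) / real n)) ^ m"
proof (induction m)
  case (Suc m)
  define q where "q = \<gamma> ^ (ell - 2) * (real (card A) / real n) * (real (card D) / real n)"
  have "q \<le> 1 * 1 * 1"
    unfolding q_def
  proof (intro mult_mono)
    show "\<gamma> ^ (ell - 2) \<le> 1" using \<gamma> tail_bounds(2)[of n "B + 1" E0] by (intro power_le_one) auto
    show "real (card A) / real n \<le> 1" "real (card D) / real n \<le> 1"
      using card_mono[OF _ AD(1)] card_mono[OF _ AD(2)] n by auto
  qed (use \<gamma> in auto)
  then have q: "0 \<le> 1 - q" by simp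
  have "mean (evolve n E0 (Suc m)) (\<lambda>E. of_bool (separated A D E))
     \<le> mean (evolve n E0 m) (\<lambda>E. (1 - q) * of_bool (separated A D E))"
    unfolding q_def by (intro mean_evolve_step_le[OF n E0] mean_separated_step[OF n _ E0 _ AD big \<gamma>])
  also have "\<dots> = (1 - q) * mean (evolve n E0 m) (\<lambda>E. of_bool (separated A D E))" by simp
  also have "\<dots> \<le> (1 - q) * (1 - q) ^ m" using Suc.IH q by (intro mult_left_mono) (auto simp: q_def)
  finally show ?case by (simp add: q_def)
qed simp

text \<open>
  A division into \<open>A\<close> and \<open>W - A\<close> that cuts no component of \<open>E0\<close> is represented by the part \<open>A\<close>. Parts with
  less than a third of \<open>W\<close> are excluded because they could remain separated by chance.
\<close>

definition splits :: "nat set set \<Rightarrow> nat set \<Rightarrow> nat set set" where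
  "splits E0 W = {A. A \<subseteq> W \<and> (\<forall>u\<in>A. component E0 u \<subseteq> A) \<and> card W \<le> 3 * card A \<and> card W \<le> 3 * card (W - A)}"

text \<open>
  Order the components of \<open>E\<close> by their least vertices and collect them one by one until a third of
  \<open>W\<close> is reached. The last one adds less than a third, so at least a third is left.
\<close>

lemma split_exists:
  assumes n: "0 < n" and E: "graph_on n E" "E0 \<subseteq> E"
    and W: "W \<subseteq> {1..n}" "\<And>u. u \<in> W \<Longrightarrow> component E0 u \<subseteq> W"
    and small: "3 * largest_component n E < card W"
  shows "\<exists>A\<in>splits E0 W. separated A (W - A) E"
proof -
  define A where "A r = {v \<in> W. Min (component E v) \<le> r}" for r
  have finW: "finite W" using W finite_subset by blast
  have min_mem: "Min (component E v) \<in> component E v" if "v \<in> {1..n}" for v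
    by (rule Min_in[OF finite_component[OF E(1) that]]) (use component_refl in blast)
  have range: "1 \<le> Min (component E v)" "Min (component E v) \<le> n" if "v \<in> W" for v
  proof -
    have "Min (component E v) \<in> {1..n}"
      using min_mem component_subset[OF E(1)] W(1) that by blast
    then show "1 \<le> Min (component E v)" "Min (component E v) \<le> n" by simp_all
  qed
  have "A 0 = {}"
  proof (rule equals0I)
    fix v assume "v \<in> A 0"
    then have "v \<in> W" "Min (component E v) \<le> 0" unfolding A_def by blast+
    then show False using range(1)[of v] by linarith
  qed
  moreover have "A n = W"
    unfolding A_def using range(2) by blast
  ultimately have ex: "card W \<le> 3 * card (A n)" and zero: "\<not> card W \<le> 3 * card (A 0)" using small by auto
  define r where "r = (LEAST r. card W \<le> 3 * card (A r))"
  have r: "card W \<le> 3 * card (A r)" unfolding r_def using ex by (rule LeastI)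
  then have "r \<noteq> 0" using zero by metis
  then obtain s where s: "r = Suc s" using not0_implies_Suc by blast
  have less: "3 * card (A s) < card W"
    using not_less_Least[of s "\<lambda>r. card W \<le> 3 * card (A r)"] s by (simp add: r_def not_le)
  have "card (A r) \<le> card (A s) + largest_component n E"
  proof -
    have "A r \<subseteq> A s \<union> {v \<in> W. Min (component E v) = r}" by (auto simp: A_def s)
    then have "card (A r) \<le> card (A s \<union> {v \<in> W. Min (component E v) = r})"
      using finW by (intro card_mono) (auto simp: A_def)
    also have "\<dots> \<le> card (A s) + card {v \<in> W. Min (component E v) = r}" by (rule card_Un_le)
    also have "card {v \<in> W. Min (component E v) = r} \<le> largest_component n E"
    proof (cases "{v \<in> W. Min (component E v) = r} = {}")
      case False
      then obtain v where v: "v \<in> W" "Min (component E v) = r" by blast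
      have sub: "{v \<in> W. Min (component E v) = r} \<subseteq> component E r"
      proof
        fix w assume "w \<in> {v \<in> W. Min (component E v) = r}"
        then have "r \<in> component E w" using min_mem W by blast
        then show "w \<in> component E r" by (rule component_sym)
      qed
      have rn: "r \<in> {1..n}" using v min_mem[of v] component_subset[OF E(1), of v] W by blast
      have "card {v \<in> W. Min (component E v) = r} \<le> csize E r"
        using sub finite_component[OF E(1) rn] by (intro card_mono)
      then show ?thesis using largest_ge[OF rn, of E] by linarith
    next
      case True
      show ?thesis unfolding True by simp
    qed
    finally show ?thesis by simp
  qed
  then have "3 * card (A r) < 2 * card W" using less small by linarith
  moreover have "card (W - A r) = card W - card (A r)"
    using finW by (intro card_Diff_subset) (auto simp: A_def)
  ultimately have "card W \<le> 3 * card (W - A r)" by linarith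
  moreover have "component E0 u \<subseteq> A r" if u: "u \<in> A r" for u
  proof
    fix w assume w: "w \<in> component E0 u"
    then have "component E w = component E u" using component_mono[OF E(2)] by (intro component_eq) blast
    then show "w \<in> A r" using u W(2)[of u] w by (auto simp: A_def)
  qed
  moreover have "separated (A r) (W - A r) E"
    unfolding separated_def
  proof (intro ballI notI)
    fix u v assume u: "u \<in> A r" and v: "v \<in> W - A r" and "v \<in> component E u"
    then have "component E v = component E u" by (intro component_eq)
    then show False using u v by (auto simp: A_def)
  qed
  moreover have "A r \<subseteq> W" by (auto simp: A_def)
  ultimately show ?thesis using r unfolding splits_def by blast
qed

text \<open>
  A division is determined by the set of components of \<open>E0\<close> it contains, and \<open>W\<close> consists of
  at most \<open>card W div k\<close> components.
\<close>

lemma card_splits: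
  assumes E0: "graph_on n E0" and W: "W \<subseteq> {1..n}" "\<And>u. u \<in> W \<Longrightarrow> component E0 u \<subseteq> W"
    and k: "\<And>u. u \<in> W \<Longrightarrow> k \<le> csize E0 u" "0 < k"
  shows "finite (splits E0 W)" "card (splits E0 W) \<le> 2 ^ (card W div k)"
proof -
  have finW: "finite W" using W finite_subset by blast
  show "finite (splits E0 W)"
    by (rule finite_subset[of _ "Pow W"]) (auto simp: splits_def finW)
  let ?P = "component E0 ` W"
  have finP: "finite ?P" using finW by simp
  have "card (\<Union>?P) = (\<Sum>D\<in>?P. card D)"
  proof (rule card_Union_disjoint)
    show "pairwise disjnt ?P"
      unfolding pairwise_def disjnt_def
    proof (intro ballI impI)
      fix X Y assume "X \<in> ?P" "Y \<in> ?P" "X \<noteq> Y"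
      then obtain u v where "X = component E0 u" "Y = component E0 v" by blast
      then show "X \<inter> Y = {}" using \<open>X \<noteq> Y\<close> component_eq by blast
    qed
    show "\<And>D. D \<in> ?P \<Longrightarrow> finite D" using finite_component[OF E0] W by blast
  qed
  moreover have "\<Union>?P = W" using W(2) component_refl by blast
  moreover have "card ?P * k \<le> (\<Sum>D\<in>?P. card D)"
    using sum_bounded_below[of ?P k card] k(1) by auto
  ultimately have "card ?P * k \<le> card W" by simp
  then have P: "card ?P \<le> card W div k" using k(2) by (simp add: less_eq_div_iff_mult_less_eq)
  have "card (splits E0 W) \<le> card (Pow ?P)"
  proof (rule card_inj_on_le[where f = "\<lambda>A. component E0 ` A"])
    show "inj_on (\<lambda>A. component E0 ` A) (splits E0 W)"
    proof (rule inj_onI)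
      have eq: "A = \<Union>(component E0 ` A)" if "A \<in> splits E0 W" for A
        using that component_refl unfolding splits_def by blast
      fix A A' assume "A \<in> splits E0 W" "A' \<in> splits E0 W" "component E0 ` A = component E0 ` A'"
      then show "A = A'" using eq by metis
    qed
    show "(\<lambda>A. component E0 ` A) ` splits E0 W \<subseteq> Pow ?P" by (auto simp: splits_def)
  qed (use finP in simp)
  also have "\<dots> = 2 ^ card ?P" using finP by (rule card_Pow)
  also have "\<dots> \<le> 2 ^ (card W div k)" using P by (intro power_increasing) auto
  finally show "card (splits E0 W) \<le> 2 ^ (card W div k)" .
qed

text \<open>
  If the largest component stays below a third of the vertices in components of size at least \<open>k\<close>,
  then some balanced division of these vertices is still separated; take a union bound over all of them.
\<close>

lemma sprinkling:
  assumes n: "0 < n" and E0: "graph_on n E0" and k: "B < k"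
    and \<gamma>: "0 \<le> \<gamma>" "\<gamma> \<le> tail n (B + 1) E0"
  shows "measure_pmf.prob (evolve n E0 m) {E. 3 * real (largest_component n E) < real n * tail n k E0}
    \<le> 2 ^ (card {v \<in> {1..n}. k \<le> csize E0 v} div k) * (1 - \<gamma> ^ (ell - 2) * (tail n k E0 / 3)\<^sup>2) ^ m"
proof -
  define W where "W = {v \<in> {1..n}. k \<le> csize E0 v}"
  define \<tau> where "\<tau> = tail n k E0"
  have W: "W \<subseteq> {1..n}" by (auto simp: W_def)
  have nW: "real n * \<tau> = real (card W)" using n by (simp add: tail_def \<tau>_def W_def)
  have Wcl: "component E0 u \<subseteq> W" if u: "u \<in> W" for u
  proof
    fix w assume w: "w \<in> component E0 u"
    then have "component E0 w = component E0 u" by (rule component_eq)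
    then show "w \<in> W" using u w component_subset[OF E0, of u] by (auto simp: W_def)
  qed
  have kW: "k \<le> csize E0 u" if "u \<in> W" for u using that by (simp add: W_def)
  have "0 < k" using k by simp
  note card = card_splits[OF E0 W Wcl kW this]
  have fin: "finite (set_pmf (evolve n E0 m))" by (rule finite_evolve[OF n])
  have "measure_pmf.prob (evolve n E0 m) {E. 3 * real (largest_component n E) < real n * \<tau>}
     \<le> mean (evolve n E0 m) (\<lambda>E. \<Sum>A\<in>splits E0 W. of_bool (separated A (W - A) E))"
    unfolding prob_eq_mean
  proof (rule mean_mono[OF fin])
    fix E assume "E \<in> set_pmf (evolve n E0 m)"
    then have E: "graph_on n E" "E0 \<subseteq> E" using evolve_support[OF n E0] by auto
    show "of_bool (3 * real (largest_component n E) < real n * \<tau>) \<le> (\<Sum>A\<in>splits E0 W. of_bool (separated A (W - A) E) :: real)"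
    proof (cases "3 * real (largest_component n E) < real n * \<tau>")
      case True
      then have "3 * largest_component n E < card W" unfolding nW by linarith
      then obtain A where A: "A \<in> splits E0 W" "separated A (W - A) E"
        using split_exists[OF n E W Wcl] by blast
      then show ?thesis
        using member_le_sum[of A "splits E0 W" "\<lambda>A. of_bool (separated A (W - A) E) :: real"] card(1) by simp
    qed (simp add: sum_nonneg)
  qed
  also have "\<dots> = (\<Sum>A\<in>splits E0 W. mean (evolve n E0 m) (\<lambda>E. of_bool (separated A (W - A) E)))"
    by (rule mean_sum[OF fin])
  also have "\<dots> \<le> (\<Sum>A\<in>splits E0 W. (1 - \<gamma> ^ (ell - 2) * (\<tau> / 3)\<^sup>2) ^ m)"
  proof (rule sum_mono)
    fix A assume A: "A \<in> splits E0 W"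
    define q where "q = \<gamma> ^ (ell - 2) * (real (card A) / real n) * (real (card (W - A)) / real n)"
    have third: "\<tau> / 3 \<le> real (card X) / real n" if "card W \<le> 3 * card X" for X :: "nat set"
    proof -
      have "real n * \<tau> \<le> 3 * real (card X)" unfolding nW using that by linarith
      then show ?thesis using n by (simp add: field_simps)
    qed
    have sub: "A \<subseteq> {1..n}" "W - A \<subseteq> {1..n}" using A W by (auto simp: splits_def)
    have "(\<tau> / 3)\<^sup>2 \<le> (real (card A) / real n) * (real (card (W - A)) / real n)"
      unfolding power2_eq_square using A third[of A] third[of "W - A"] tail_bounds[of n k E0]
      by (intro mult_mono) (auto simp: splits_def \<tau>_def)
    then have q: "\<gamma> ^ (ell - 2) * (\<tau> / 3)\<^sup>2 \<le> q"
      unfolding q_def mult.assoc using \<gamma> by (intro mult_left_mono) auto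
    have "q \<le> 1 * 1 * 1"
      unfolding q_def
    proof (intro mult_mono)
      show "\<gamma> ^ (ell - 2) \<le> 1" using \<gamma> tail_bounds(2)[of n "B + 1" E0] by (intro power_le_one) auto
      show "real (card A) / real n \<le> 1" "real (card (W - A)) / real n \<le> 1"
        using card_mono[OF _ sub(1)] card_mono[OF _ sub(2)] n by auto
    qed (use \<gamma> in auto)
    then have "(1 - q) ^ m \<le> (1 - \<gamma> ^ (ell - 2) * (\<tau> / 3)\<^sup>2) ^ m" using q by (intro power_mono) auto
    moreover have "mean (evolve n E0 m) (\<lambda>E. of_bool (separated A (W - A) E)) \<le> (1 - q) ^ m"
      unfolding q_def using A k by (intro prob_separated n E0 sub \<gamma>) (auto simp: W_def splits_def)
    ultimately show "mean (evolve n E0 m) (\<lambda>E. of_bool (separated A (W - A) E)) \<le> (1 - \<gamma> ^ (ell - 2) * (\<tau> / 3)\<^sup>2) ^ m"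
      by linarith
  qed
  also have "\<dots> = real (card (splits E0 W)) * (1 - \<gamma> ^ (ell - 2) * (\<tau> / 3)\<^sup>2) ^ m" by simp
  also have "\<dots> \<le> 2 ^ (card W div k) * (1 - \<gamma> ^ (ell - 2) * (\<tau> / 3)\<^sup>2) ^ m"
  proof (rule mult_right_mono)
    show "real (card (splits E0 W)) \<le> 2 ^ (card W div k)" using card(2) by (metis of_nat_le_iff of_nat_numeral of_nat_power)
    have "\<gamma> ^ (ell - 2) * (\<tau> / 3)\<^sup>2 \<le> 1 * 1"
      using \<gamma> tail_bounds[of n "B + 1" E0] tail_bounds[of n k E0]
      by (intro mult_mono power_le_one) (auto simp: \<tau>_def)
    then show "0 \<le> (1 - \<gamma> ^ (ell - 2) * (\<tau> / 3)\<^sup>2) ^ m" by simp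
  qed
  finally show ?thesis unfolding W_def \<tau>_def .
qed

text \<open>
  The entropy of the divisions is at most \<open>n * \<tau> / k\<close>, where \<open>\<tau> = tail n k E0\<close>, while each
  individual division survives with probability at most the exponential of \<open>- m * \<gamma> ^ (ell - 2) * (\<tau> / 3)\<^sup>2\<close>.
  The hypothesis that \<open>k * \<xi>\<close> is large makes the second exponent at least twice the first.
\<close>

lemma sprinkling_exp:
  assumes n: "0 < n" and E0: "graph_on n E0" and k: "B < k"
    and \<gamma>: "0 < \<gamma>" "\<gamma> \<le> tail n (B + 1) E0" and \<xi>: "0 < \<xi>" "\<xi> \<le> tail n k E0"
    and m: "\<delta> / 2 \<le> real m / real n" "0 < \<delta>"
    and heavy: "36 / (\<delta> * \<gamma> ^ (ell - 2)) \<le> real k * \<xi>"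
  shows "measure_pmf.prob (evolve n E0 m) {E. real (largest_component n E) < \<xi> / 3 * real n}
    \<le> exp (- (\<xi> / real k * real n))"
proof -
  define \<tau> where "\<tau> = tail n k E0"
  define g where "g = \<gamma> ^ (ell - 2)"
  define w where "w = card {v \<in> {1..n}. k \<le> csize E0 v}"
  have w: "real w = real n * \<tau>" using n by (simp add: tail_def \<tau>_def w_def)
  have g: "0 < g" using \<gamma> by (simp add: g_def)
  have \<tau>: "\<xi> \<le> \<tau>" "\<tau> \<le> 1" using \<xi> tail_bounds by (auto simp: \<tau>_def)
  have kp: "0 < real k" using k by simp
  have "measure_pmf.prob (evolve n E0 m) {E. real (largest_component n E) < \<xi> / 3 * real n}
     \<le> measure_pmf.prob (evolve n E0 m) {E. 3 * real (largest_component n E) < real n * \<tau>}"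
  proof (rule prob_mono)
    fix E assume "real (largest_component n E) < \<xi> / 3 * real n"
    then have "3 * real (largest_component n E) < \<xi> * real n" by simp
    also have "\<dots> \<le> \<tau> * real n" using \<tau> by (intro mult_right_mono) auto
    finally show "3 * real (largest_component n E) < real n * \<tau>" by (simp add: mult.commute)
  qed
  also have "\<dots> \<le> 2 ^ (w div k) * (1 - g * (\<tau> / 3)\<^sup>2) ^ m"
    unfolding \<tau>_def w_def g_def using \<gamma> by (intro sprinkling n E0 k) auto
  also have "\<dots> \<le> exp (real n * \<tau> / real k) * exp (- (g * (\<tau> / 3)\<^sup>2 * real m))"
  proof (rule mult_mono)
    have "(2::real) ^ (w div k) \<le> exp 1 ^ (w div k)"
      using exp_ge_add_one_self[of 1] by (intro power_mono) auto
    also have "\<dots> = exp (real (w div k))" by (simp add: exp_of_nat_mult[symmetric])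
    also have "\<dots> \<le> exp (real n * \<tau> / real k)"
      using of_nat_div_le_of_nat[of w k, where 'a = real] by (simp add: w)
    finally show "2 ^ (w div k) \<le> exp (real n * \<tau> / real k)" .
    have "g * (\<tau> / 3)\<^sup>2 \<le> 1 * 1"
      using g \<gamma> \<tau> \<xi> tail_bounds[of n "B + 1" E0] unfolding g_def by (intro mult_mono power_le_one) auto
    then have base: "0 \<le> 1 - g * (\<tau> / 3)\<^sup>2" by simp
    have "(1 - g * (\<tau> / 3)\<^sup>2) ^ m \<le> exp (- (g * (\<tau> / 3)\<^sup>2)) ^ m"
      using base exp_ge_add_one_self[of "- (g * (\<tau> / 3)\<^sup>2)"] by (intro power_mono) auto
    also have "\<dots> = exp (- (g * (\<tau> / 3)\<^sup>2 * real m))"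
      by (simp add: exp_of_nat_mult[symmetric] mult.commute)
    finally show "(1 - g * (\<tau> / 3)\<^sup>2) ^ m \<le> exp (- (g * (\<tau> / 3)\<^sup>2 * real m))" .
    show "0 \<le> (1 - g * (\<tau> / 3)\<^sup>2) ^ m" using base by simp
  qed simp
  also have "\<dots> = exp (real n * \<tau> / real k - g * (\<tau> / 3)\<^sup>2 * real m)"
    by (simp add: exp_add[symmetric])
  also have "\<dots> \<le> exp (- (\<xi> / real k * real n))"
  proof -
    \<comment> \<open>this is where the heavy level is used\<close>
    have "2 / real k \<le> g * \<xi> / 9 * (\<delta> / 2)"
      using heavy kp g m by (simp add: g_def[symmetric] field_simps)
    also have "\<dots> \<le> g * \<tau> / 9 * (real m / real n)"
      using g \<tau> \<xi> m by (intro mult_mono divide_right_mono mult_left_mono) auto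
    finally have "real n * \<tau> * (2 / real k) \<le> real n * \<tau> * (g * \<tau> / 9 * (real m / real n))"
      using \<tau> \<xi> by (intro mult_left_mono) auto
    also have "\<dots> = g * (\<tau> / 3)\<^sup>2 * real m" using n by (simp add: power2_eq_square)
    finally have "real n * \<tau> * (2 / real k) \<le> g * (\<tau> / 3)\<^sup>2 * real m" .
    moreover have "real n * \<tau> * (2 / real k) = 2 * (real n * \<tau> / real k)" by simp
    ultimately have "real n * \<tau> / real k - g * (\<tau> / 3)\<^sup>2 * real m \<le> - (real n * \<tau> / real k)" by linarith
    also have "\<dots> \<le> - (\<xi> / real k * real n)"
    proof -
      have "\<xi> * real n / real k \<le> \<tau> * real n / real k"
        using \<tau> kp by (intro divide_right_mono mult_right_mono) auto
      then show ?thesis by (simp add: mult.commute)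
    qed
    finally show ?thesis by simp
  qed
  finally show ?thesis .
qed

text \<open>
  The heavy level is found at the midpoint of \<open>t1\<close> and \<open>t\<close>, and the second half of the time is used
  for sprinkling. The bound on the size of the largest component depends only on the profile
  at these times.
\<close>

theorem giant_after:
  assumes t: "0 \<le> t1" "t1 < t" and unb: "\<And>M. \<exists>K. M < (\<Sum>k=1..K. profile t1 k)"
  shows "\<exists>\<alpha>>0. (\<lambda>n. prob_at n (steps t n) (\<lambda>E. real (largest_component n E) < \<alpha> * real n)) \<longlonglongrightarrow> 0"
proof -
  have pos: "0 < profile t1 (B + 1)"
  proof (rule ccontr)
    assume "\<not> 0 < profile t1 (B + 1)"
    then have z: "profile t1 k \<le> of_bool (k \<le> B)" for k
      using profile_antimono[OF t(1), of "B + 1" k] profile_bounds[OF t(1), of k] by (cases "k \<le> B") auto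
    obtain K where "real B < (\<Sum>k=1..K. profile t1 k)" using unb by blast
    also have "\<dots> \<le> (\<Sum>k=1..K. of_bool (k \<le> B))" by (intro sum_mono z)
    also have "\<dots> = real (card {k \<in> {1..K}. k \<le> B})" unfolding card_Collect_sum ..
    also have "\<dots> \<le> real (card {1..B})" by (intro of_nat_mono card_mono) auto
    finally show False by simp
  qed
  define \<gamma> where "\<gamma> = profile t1 (B + 1) / 2"
  have \<gamma>: "0 < \<gamma>" "\<gamma> < profile t1 (B + 1)" using pos by (auto simp: \<gamma>_def)
  have half: "profile t1 (B + 1) = 2 * \<gamma>" by (simp add: \<gamma>_def)
  define t2 where "t2 = (t1 + t) / 2"
  have t2: "t1 < t2" "t2 < t" "0 \<le> t2" using t by (auto simp: t2_def)
  define \<delta> where "\<delta> = t - t2"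
  have \<delta>: "0 < \<delta>" using t2 by (simp add: \<delta>_def)
  \<comment> \<open>twice the constant of the sprinkling bound, because only half of the profile is kept as a lower bound\<close>
  define C where "C = 72 / (\<delta> * \<gamma> ^ (ell - 2))"
  have C: "0 < C" using \<delta> \<gamma> by (simp add: C_def)
  obtain k where k: "B < k" "C \<le> real k * profile t2 k"
    using heavy_level[OF t(1) t2(1) unb \<gamma>] C by (meson less_imp_le)
  define \<xi> where "\<xi> = profile t2 k / 2"
  have half': "profile t2 k = 2 * \<xi>" by (simp add: \<xi>_def)
  have \<xi>: "0 < \<xi>"
  proof -
    have "0 < real k * profile t2 k" using k C by linarith
    then show ?thesis using k by (simp add: \<xi>_def zero_less_mult_iff)
  qed
  have heavy: "36 / (\<delta> * \<gamma> ^ (ell - 2)) \<le> real k * \<xi>" using k by (simp add: \<xi>_def C_def)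
  define p1 where "p1 n = prob_at n (steps t1 n) (\<lambda>E. \<gamma> \<le> \<bar>tail n (B + 1) E - profile t1 (B + 1)\<bar>)" for n
  define p2 where "p2 n = prob_at n (steps t2 n) (\<lambda>E. \<xi> \<le> \<bar>tail n k E - profile t2 k\<bar>)" for n
  have bound: "prob_at n (steps t n) (\<lambda>E. real (largest_component n E) < \<xi> / 3 * real n)
      \<le> p1 n + p2 n + exp (- (\<xi> / real k * real n))"
    if n: "0 < n" "2 / (t - t2) \<le> real n" "2 / (t2 - t1) \<le> real n" for n
  proof -
    define m1 where "m1 = steps t1 n"
    define m2 where "m2 = steps t2 n"
    define m where "m = steps t n - m2"
    have m12: "m1 \<le> m2" using steps_between(1)[OF t(1) t2(1) n(3,1)] by (simp add: m1_def m2_def)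
    have m: "steps t n = m2 + m" "\<delta> / 2 \<le> real m / real n"
      using steps_between[OF t2(3,2) n(2,1)] by (auto simp: m_def m2_def \<delta>_def)
    have fin: "finite (set_pmf (evolve n {} i))" for i by (rule finite_evolve[OF n(1)])
    let ?L = "\<lambda>E. real (largest_component n E) < \<xi> / 3 * real n"
    have "prob_at n (steps t n) ?L = mean (evolve n {} m2) (\<lambda>E0. mean (evolve n E0 m) (\<lambda>E. of_bool (?L E)))"
      unfolding prob_eq_mean m(1) evolve_add using n by (intro mean_bind fin finite_evolve)
    also have "\<dots> \<le> mean (evolve n {} m2) (\<lambda>E0. (of_bool (tail n (B + 1) E0 < \<gamma>) + of_bool (tail n k E0 < \<xi>)) + exp (- (\<xi> / real k * real n)))"
    proof (rule mean_mono[OF fin])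
      fix E0 assume "E0 \<in> set_pmf (evolve n {} m2)"
      then have E0: "graph_on n E0" by (rule evolve_support[OF n(1) graph_on_empty])
      have le1: "measure_pmf.prob (evolve n E0 m) {E. ?L E} \<le> 1" by simp
      have ex: "measure_pmf.prob (evolve n E0 m) {E. ?L E} \<le> exp (- (\<xi> / real k * real n))"
        if "\<gamma> \<le> tail n (B + 1) E0" "\<xi> \<le> tail n k E0"
        by (rule sprinkling_exp[OF n(1) E0 k(1) \<gamma>(1) that(1) \<xi> that(2) m(2) \<delta> heavy])
      show "mean (evolve n E0 m) (\<lambda>E. of_bool (?L E)) \<le> (of_bool (tail n (B + 1) E0 < \<gamma>) + of_bool (tail n k E0 < \<xi>)) + exp (- (\<xi> / real k * real n))"
        unfolding prob_eq_mean[symmetric]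
        by (cases "tail n (B + 1) E0 < \<gamma> \<or> tail n k E0 < \<xi>") (use le1 ex in \<open>auto intro: order.trans add_increasing2\<close>)
    qed
    also have "\<dots> = prob_at n m2 (\<lambda>E. tail n (B + 1) E < \<gamma>) + prob_at n m2 (\<lambda>E. tail n k E < \<xi>) + exp (- (\<xi> / real k * real n))"
      by (simp only: mean_add[OF fin] mean_const prob_eq_mean)
    also have "prob_at n m2 (\<lambda>E. tail n (B + 1) E < \<gamma>) \<le> prob_at n m1 (\<lambda>E. tail n (B + 1) E < \<gamma>)"
    proof -
      have "mean (evolve n {} m1) (\<lambda>E. - of_bool (tail n (B + 1) E < \<gamma>)) \<le> mean (evolve n {} m2) (\<lambda>E. - of_bool (tail n (B + 1) E < \<gamma>))"
      proof (rule mean_evolve_mono[OF n(1) graph_on_empty m12])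
        fix E E' assume "E \<subseteq> E'" "graph_on n E'"
        then have "tail n (B + 1) E \<le> tail n (B + 1) E'" by (rule tail_mono)
        then show "- of_bool (tail n (B + 1) E < \<gamma>) \<le> (- of_bool (tail n (B + 1) E' < \<gamma>) :: real)"
          by (simp add: of_bool_def)
      qed
      then show ?thesis by (simp add: prob_eq_mean)
    qed
    also have "\<dots> \<le> p1 n"
      unfolding p1_def m1_def half by (intro prob_mono) linarith
    also have "prob_at n m2 (\<lambda>E. tail n k E < \<xi>) \<le> p2 n"
      unfolding p2_def m2_def half' by (intro prob_mono) linarith
    finally show ?thesis by simp
  qed
  have "(\<lambda>n. p1 n + p2 n + exp (- (\<xi> / real k * real n))) \<longlonglongrightarrow> 0 + 0 + 0"
  proof (intro tendsto_add)
    show "p1 \<longlonglongrightarrow> 0" unfolding p1_def[abs_def] by (rule profile_prob[OF t(1) \<gamma>(1)])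
    show "p2 \<longlonglongrightarrow> 0" unfolding p2_def[abs_def] by (rule profile_prob[OF t2(3) \<xi>])
    have "0 < \<xi> / real k" using \<xi> k by simp
    then have "filterlim (\<lambda>n. \<xi> / real k * real n) at_top sequentially"
      by (intro filterlim_tendsto_pos_mult_at_top[OF tendsto_const] filterlim_real_sequentially)
    then show "(\<lambda>n. exp (- (\<xi> / real k * real n))) \<longlonglongrightarrow> 0"
      by (intro filterlim_compose[OF exp_at_bot] filterlim_compose[OF filterlim_uminus_at_bot_at_top])
  qed
  then have lim: "(\<lambda>n. p1 n + p2 n + exp (- (\<xi> / real k * real n))) \<longlonglongrightarrow> 0" by simp
  have "(\<lambda>n. prob_at n (steps t n) (\<lambda>E. real (largest_component n E) < \<xi> / 3 * real n)) \<longlonglongrightarrow> 0"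
  proof (rule tendsto_sandwich[OF _ _ tendsto_const lim])
    show "\<forall>\<^sub>F n in sequentially. prob_at n (steps t n) (\<lambda>E. real (largest_component n E) < \<xi> / 3 * real n)
      \<le> p1 n + p2 n + exp (- (\<xi> / real k * real n))"
      using eventually_gt_at_top[of 0] eventually_real_ge[of "2 / (t - t2)"] eventually_real_ge[of "2 / (t2 - t1)"]
      by eventually_elim (rule bound)
  qed (simp add: always_eventually)
  then show ?thesis using \<xi> by (intro exI[of _ "\<xi> / 3"]) auto
qed

end

section \<open>Comparison of the two thresholds\<close>

context bounded_rule
begin

lemma prob_rule_graph_at:
  "\<P>(\<omega> in choices ell n. P (rule_graph_at R t n \<omega>)) = prob_at n (steps t n) P"
  unfolding rule_graph_at_def by (rule prob_choices)

lemma prob_at_compl: "prob_at n i (\<lambda>E. \<not> P E) = 1 - prob_at n i P"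
  using measure_pmf.prob_compl[of "{E. P E}" "evolve n {} i"] by (simp add: Compl_eq_Diff_UNIV[symmetric] Collect_neg_eq)

abbreviation sus_bounded_at :: "real \<Rightarrow> bool" where
  "sus_bounded_at t \<equiv> bounded_in_prob (choices ell) (\<lambda>n \<omega>. susceptibility n (rule_graph_at R t n \<omega>))"

abbreviation sublinear_at :: "real \<Rightarrow> bool" where
  "sublinear_at t \<equiv> tendsto_in_prob (choices ell) (\<lambda>n \<omega>. real (largest_component n (rule_graph_at R t n \<omega>)) / real n) 0"

lemma prob_susceptibility:
  assumes "0 < n"
  shows "\<P>(\<omega> in choices ell n. \<bar>susceptibility n (rule_graph_at R t n \<omega>)\<bar> > C) = prob_at n (steps t n) (\<lambda>E. C < sus n E)"
  unfolding prob_rule_graph_at[of n "\<lambda>E. \<bar>susceptibility n E\<bar> > C" t] prob_eq_mean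
proof (rule mean_cong)
  fix E assume "E \<in> set_pmf (evolve n {} (steps t n))"
  then have "graph_on n E" by (rule evolve_support[OF assms graph_on_empty])
  moreover have "0 \<le> sus n E" by (simp add: sus_def sum_nonneg)
  ultimately show "of_bool (\<bar>susceptibility n E\<bar> > C) = (of_bool (C < sus n E) :: real)"
    by (simp add: susceptibility_eq_sus)
qed

lemma sus_bounded_iff_profile:
  assumes t: "0 \<le> t"
  shows "sus_bounded_at t \<longleftrightarrow> (\<exists>M. \<forall>K. (\<Sum>k=1..K. profile t k) \<le> M)"
proof
  assume bdd: "sus_bounded_at t"
  show "\<exists>M. \<forall>K. (\<Sum>k=1..K. profile t k) \<le> M"
  proof (rule ccontr)
    assume "\<not> ?thesis"
    then have unb: "\<exists>K. M < (\<Sum>k=1..K. profile t k)" for M by (metis not_le)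
    have half: "(0::real) < 1 / 2" by simp
    obtain C where C: "\<forall>\<^sub>F n in sequentially. \<P>(\<omega> in choices ell n. \<bar>susceptibility n (rule_graph_at R t n \<omega>)\<bar> > C) \<le> 1 / 2"
      using bdd[unfolded bounded_in_prob_def, rule_format, OF half] by blast
    obtain K where "C + 1 < (\<Sum>k=1..K. profile t k)" using unb by blast
    from order_tendstoD(2)[OF sus_unbounded_of_profile[OF t this], of "1 / 2"]
    have "\<forall>\<^sub>F n in sequentially. prob_at n (steps t n) (\<lambda>E. sus n E \<le> C) < 1 / 2" by simp
    with C have "\<forall>\<^sub>F n in sequentially. False"
      using eventually_gt_at_top[of 0]
    proof eventually_elim
      case (elim n)
      then show ?case
        using prob_at_compl[of n "steps t n" "\<lambda>E. sus n E \<le> C"]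
        by (simp add: prob_susceptibility not_le)
    qed
    then show False by simp
  qed
next
  assume "\<exists>M. \<forall>K. (\<Sum>k=1..K. profile t k) \<le> M"
  then obtain M where "\<And>K. (\<Sum>k=1..K. profile t k) \<le> M" by blast
  from sus_bounded_of_profile[OF t this]
  have lim: "(\<lambda>n. prob_at n (steps t n) (\<lambda>E. M + 2 < sus n E)) \<longlonglongrightarrow> 0" .
  show "sus_bounded_at t"
    unfolding bounded_in_prob_def
  proof (intro allI impI exI)
    fix \<epsilon> :: real assume "0 < \<epsilon>"
    from order_tendstoD(2)[OF lim this] eventually_gt_at_top[of 0]
    show "\<forall>\<^sub>F n in sequentially. \<P>(\<omega> in choices ell n. \<bar>susceptibility n (rule_graph_at R t n \<omega>)\<bar> > M + 2) \<le> \<epsilon>"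
      by eventually_elim (simp add: prob_susceptibility)
  qed
qed

lemma sublinear_iff:
  "sublinear_at t \<longleftrightarrow> (\<forall>\<epsilon>>0. (\<lambda>n. prob_at n (steps t n) (\<lambda>E. \<epsilon> < real (largest_component n E) / real n)) \<longlonglongrightarrow> 0)"
  unfolding tendsto_in_prob_def
  by (simp add: prob_rule_graph_at[of _ "\<lambda>E. _ < real (largest_component _ E) / _"])

lemma sus_bounded_imp_sublinear:
  assumes t: "0 \<le> t" and bdd: "sus_bounded_at t"
  shows "sublinear_at t"
  unfolding sublinear_iff
proof (intro allI impI)
  fix \<epsilon> :: real assume \<epsilon>: "0 < \<epsilon>"
  obtain M where "\<And>K. (\<Sum>k=1..K. profile t k) \<le> M" using bdd sus_bounded_iff_profile[OF t] by blast
  from sus_bounded_of_profile[OF t this]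
  have lim: "(\<lambda>n. prob_at n (steps t n) (\<lambda>E. M + 2 < sus n E)) \<longlonglongrightarrow> 0" .
  show "(\<lambda>n. prob_at n (steps t n) (\<lambda>E. \<epsilon> < real (largest_component n E) / real n)) \<longlonglongrightarrow> 0"
  proof (rule tendsto_sandwich[OF _ _ tendsto_const lim])
    show "\<forall>\<^sub>F n in sequentially. prob_at n (steps t n) (\<lambda>E. \<epsilon> < real (largest_component n E) / real n)
       \<le> prob_at n (steps t n) (\<lambda>E. M + 2 < sus n E)"
      using eventually_gt_at_top[of 0] eventually_real_ge[of "(M + 2) / \<epsilon>\<^sup>2"]
    proof eventually_elim
      case (elim n)
      show ?case
      proof (rule prob_mono)
        fix E assume "E \<in> set_pmf (evolve n {} (steps t n))" and big: "\<epsilon> < real (largest_component n E) / real n"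
        then have E: "graph_on n E" using evolve_support[OF elim(1) graph_on_empty] by blast
        have "\<epsilon> * real n < real (largest_component n E)" using big elim by (simp add: less_divide_eq)
        then have "(\<epsilon> * real n)\<^sup>2 < (real (largest_component n E))\<^sup>2"
          using \<epsilon> by (intro power_strict_mono) auto
        also have "\<dots> \<le> real n * sus n E" by (rule largest_sq_le[OF E elim(1)])
        finally have "real n * (\<epsilon>\<^sup>2 * real n) < real n * sus n E" by (simp add: power2_eq_square mult_ac)
        then have "\<epsilon>\<^sup>2 * real n < sus n E" using elim by simp
        moreover have "M + 2 \<le> \<epsilon>\<^sup>2 * real n" using elim \<epsilon> by (simp add: divide_le_eq mult.commute)
        ultimately show "M + 2 < sus n E" by linarith
      qed
    qed
  qed (simp add: always_eventually)
qed

lemma giant_whp: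
  assumes "0 \<le> t1" "t1 < t" "\<not> sus_bounded_at t1"
  shows "\<exists>\<alpha>>0. whp (choices ell) (\<lambda>n \<omega>. real (largest_component n (rule_graph_at R t n \<omega>)) \<ge> \<alpha> * real n)"
proof -
  have "\<exists>K. M < (\<Sum>k=1..K. profile t1 k)" for M
    using assms(3) sus_bounded_iff_profile[OF assms(1)] by (metis not_le)
  from giant_after[OF assms(1,2) this] obtain \<alpha> where \<alpha>: "0 < \<alpha>"
    and lim: "(\<lambda>n. prob_at n (steps t n) (\<lambda>E. real (largest_component n E) < \<alpha> * real n)) \<longlonglongrightarrow> 0" by blast
  have "(\<lambda>n. 1 - prob_at n (steps t n) (\<lambda>E. real (largest_component n E) < \<alpha> * real n)) \<longlonglongrightarrow> 1 - 0"
    by (intro tendsto_diff tendsto_const lim)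
  then have "whp (choices ell) (\<lambda>n \<omega>. real (largest_component n (rule_graph_at R t n \<omega>)) \<ge> \<alpha> * real n)"
    unfolding whp_def prob_rule_graph_at[of _ "\<lambda>E. \<alpha> * real _ \<le> real (largest_component _ E)"]
    by (simp add: prob_at_compl[symmetric] not_less)
  then show ?thesis using \<alpha> by blast
qed

lemma giant_not_sublinear:
  assumes "0 < \<alpha>" "whp (choices ell) (\<lambda>n \<omega>. real (largest_component n (rule_graph_at R t n \<omega>)) \<ge> \<alpha> * real n)"
  shows "\<not> sublinear_at t"
proof
  assume "sublinear_at t"
  then have "(\<lambda>n. prob_at n (steps t n) (\<lambda>E. \<alpha> / 2 < real (largest_component n E) / real n)) \<longlonglongrightarrow> 0"
    unfolding sublinear_iff by (elim allE[of _ "\<alpha> / 2"] impE) (use assms(1) in simp)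
  from order_tendstoD(2)[OF this, of "1 / 2"]
  have "\<forall>\<^sub>F n in sequentially. prob_at n (steps t n) (\<lambda>E. \<alpha> / 2 < real (largest_component n E) / real n) < 1 / 2" by simp
  moreover have "\<forall>\<^sub>F n in sequentially. 1 / 2 < prob_at n (steps t n) (\<lambda>E. \<alpha> * real n \<le> real (largest_component n E))"
    using order_tendstoD(1)[OF assms(2)[unfolded whp_def], of "1 / 2"]
    by (simp add: prob_rule_graph_at[of _ "\<lambda>E. \<alpha> * real _ \<le> real (largest_component _ E)"])
  ultimately have "\<forall>\<^sub>F n in sequentially. False"
    using eventually_gt_at_top[of 0]
  proof eventually_elim
    case (elim n)
    have "prob_at n (steps t n) (\<lambda>E. \<alpha> * real n \<le> real (largest_component n E))
       \<le> prob_at n (steps t n) (\<lambda>E. \<alpha> / 2 < real (largest_component n E) / real n)"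
    proof (rule prob_mono)
      fix E assume "\<alpha> * real n \<le> real (largest_component n E)"
      moreover have "\<alpha> / 2 * real n < \<alpha> * real n" using assms(1) elim by simp
      ultimately show "\<alpha> / 2 < real (largest_component n E) / real n"
        using elim by (simp add: less_divide_eq)
    qed
    then show False using elim by linarith
  qed
  then show False by simp
qed

lemma sublinear_le_1: "0 \<le> t \<Longrightarrow> sublinear_at t \<Longrightarrow> t \<le> 1"
  using sublinear_time_le_1[of t] unfolding sublinear_iff by blast

lemma sus_bounded_at_0: "sus_bounded_at 0"
  unfolding bounded_in_prob_def
proof (intro allI impI exI)
  fix \<epsilon> :: real assume "0 < \<epsilon>"
  show "\<forall>\<^sub>F n in sequentially. \<P>(\<omega> in choices ell n. \<bar>susceptibility n (rule_graph_at R 0 n \<omega>)\<bar> > 1) \<le> \<epsilon>"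
    using eventually_gt_at_top[of 0]
    by eventually_elim (use \<open>0 < \<epsilon>\<close> in \<open>simp add: prob_susceptibility sus_def measure_return_pmf\<close>)
qed

text \<open>
  The defining set of \<open>t_b\<close> is bounded by 1, since it is contained in that of \<open>t_c\<close>.
\<close>

lemma t_b_upper:
  shows "0 \<le> t_b ell R" "\<And>t. 0 \<le> t \<Longrightarrow> sus_bounded_at t \<Longrightarrow> t \<le> t_b ell R"
proof -
  have bdd: "bdd_above {t. t \<ge> 0 \<and> sus_bounded_at t}"
    using sus_bounded_imp_sublinear sublinear_le_1 by (intro bdd_aboveI[of _ 1]) blast
  show upper: "t \<le> t_b ell R" if "0 \<le> t" "sus_bounded_at t" for t
    unfolding t_b_def using that by (intro cSup_upper bdd) simp
  show "0 \<le> t_b ell R" using upper[OF _ sus_bounded_at_0] by simp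
qed

lemma giant_after_t_b:
  assumes "t_b ell R < t"
  shows "\<exists>\<alpha>>0. whp (choices ell) (\<lambda>n \<omega>. real (largest_component n (rule_graph_at R t n \<omega>)) \<ge> \<alpha> * real n)"
proof (rule giant_whp)
  show "0 \<le> (t_b ell R + t) / 2" "(t_b ell R + t) / 2 < t" using t_b_upper(1) assms by simp_all
  show "\<not> sus_bounded_at ((t_b ell R + t) / 2)"
    using t_b_upper(2)[of "(t_b ell R + t) / 2"] t_b_upper(1) assms by auto
qed

lemma t_b_eq_t_c: "t_b ell R = t_c ell R"
proof (rule antisym)
  have bdd: "bdd_above {t. t \<ge> 0 \<and> sublinear_at t}"
    using sublinear_le_1 by (intro bdd_aboveI[of _ 1]) blast
  show "t_b ell R \<le> t_c ell R"
    unfolding t_b_def t_c_def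
    using sus_bounded_at_0 sus_bounded_imp_sublinear by (intro cSup_subset_mono bdd) auto
  show "t_c ell R \<le> t_b ell R"
    unfolding t_c_def
  proof (rule cSup_least)
    have "sublinear_at 0" by (rule sus_bounded_imp_sublinear[OF order_refl sus_bounded_at_0])
    then show "{t. t \<ge> 0 \<and> sublinear_at t} \<noteq> {}" by auto
    fix t assume "t \<in> {t. t \<ge> 0 \<and> sublinear_at t}"
    then show "t \<le> t_b ell R" using giant_after_t_b[of t] giant_not_sublinear[of _ t] not_le by blast
  qed
qed

end

theorem theorem15:
  fixes ell :: nat and R :: "nat list \<Rightarrow> nat set set"
  assumes "ell \<ge> 2" and "bounded_size_rule ell R"
  shows "t_b ell R = t_c ell R \<and>
    (\<forall>t \<epsilon>. t > t_b ell R \<and> \<epsilon> > 0 \<longrightarrow>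
      (\<exists>(\<delta>::real) (n0::nat). \<delta> > 0 \<and> n0 > 0 \<and>
        (\<forall>n\<ge>n0. \<P>(\<omega> in choices ell n.
            real (largest_component n (rule_graph_at R t n \<omega>)) \<ge> \<delta> * real n) \<ge> 1 - \<epsilon>))) \<and>
    (\<forall>\<epsilon>>0. \<exists>\<alpha>>0. whp (choices ell) (\<lambda>n \<omega>.
        real (largest_component n (rule_graph_at R (t_b ell R + \<epsilon>) n \<omega>)) \<ge> \<alpha> * real n))"
proof -
  obtain B where B: "\<forall>cs. length cs = ell \<and> (\<forall>c\<in>set cs. 0 < c) \<longrightarrow> R (map (\<lambda>c. min c (B + 1)) cs) = R cs"
    and rule: "size_rule ell R"
    using assms(2) unfolding bounded_size_rule_def by blast
  interpret bounded_rule ell R B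
    by unfold_locales (use assms(1) rule B in auto)
  have early: "\<exists>(\<delta>::real) (n0::nat). \<delta> > 0 \<and> n0 > 0 \<and>
        (\<forall>n\<ge>n0. \<P>(\<omega> in choices ell n.
            real (largest_component n (rule_graph_at R t n \<omega>)) \<ge> \<delta> * real n) \<ge> 1 - \<epsilon>)"
    if t: "t > t_b ell R" and \<epsilon>: "\<epsilon> > 0" for t \<epsilon> :: real
  proof -
    obtain \<alpha> where \<alpha>: "0 < \<alpha>" and whp: "whp (choices ell) (\<lambda>n \<omega>. real (largest_component n (rule_graph_at R t n \<omega>)) \<ge> \<alpha> * real n)"
      using giant_after_t_b[OF t] by blast
    have "\<forall>\<^sub>F n in sequentially. 1 - \<epsilon> < \<P>(\<omega> in choices ell n. real (largest_component n (rule_graph_at R t n \<omega>)) \<ge> \<alpha> * real n)"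
      using \<epsilon> by (intro order_tendstoD(1)[OF whp[unfolded whp_def]]) simp
    then obtain N where N: "\<And>n. N \<le> n \<Longrightarrow> 1 - \<epsilon> < \<P>(\<omega> in choices ell n. real (largest_component n (rule_graph_at R t n \<omega>)) \<ge> \<alpha> * real n)"
      unfolding eventually_sequentially by blast
    show ?thesis
      by (rule exI[of _ \<alpha>], rule exI[of _ "Suc N"]) (use \<alpha> N in \<open>auto intro: less_imp_le\<close>)
  qed
  show ?thesis
    using t_b_eq_t_c early giant_after_t_b by simp
qed

end
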